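(* Let $Y\to X$ be a finite normal cover of finite connected graphs with deck group $G$, defined by a surjection $\phi:\pi_1(X)=F_n\to G$. Assume that $n=\operatorname{rank}(\pi_1(X))\ge 3$ and that $G$ is either abelian or $2$-step nilpotent. Then: (1) $\operatorname{Irr^{pr}}(\phi,G)=\operatorname{Irr}(G)$. (2) In the case that $G$ is nonabelian, assume further that $n$ is odd and that every nontrivial cyclic subgroup of the center of $G$ has prime order (no further assumption is made if $G$ is abelian). Then $H_1^{\mathrm{prim}}(Y;\mathbb{C})=H_1(Y;\mathbb{C})$.
   Context: $F_n$ is the free group of rank $n$; an element of $F_n$ is primitive if it is part of a free basis. A normal cover $Y\to X$ with deck group $G$ corresponds to a surjection $\phi:\pi_1(X)=F_n\to G$ with kernel $\pi_1(Y)$. A group is $2$-step nilpotent if its commutator subgroup is contained in its center. Fix a basepoint $x_0\in X$ and a lift $\hat x_0\in Y$. For a loop $\gamma$ in $X$ at $x_0$, the preferred elevation is the lift at $\hat x_0$ of the smallest power $\gamma^k$ ($k\ge1$) that lifts to a closed loop in $Y$; its images under deck transformations are the elevations of $\gamma$. The primitive homology $H_1^{\mathrm{prim}}(Y;\mathbb{C})\subseteq H_1(Y;\mathbb{C})$ is the $\mathbb{C}$-span of the homology classes of all elevations of loops representing primitive elements of $\pi_1(X)$. $\operatorname{Irr}(G)$ is the set of isomorphism classes of complex irreducible $G$-representations. $\operatorname{Irr^{pr}}(\phi,G)\subseteq\operatorname{Irr}(G)$ is the set of irreducible representations $V$ such that $\phi(\gamma)(v)=v$ for some primitive $\gamma\in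 F_n$ and some nonzero $v\in V$. *)

theory Defs
  imports
    "Graph_Theory.Graph_Theory"
    "Jordan_Normal_Form.VS_Connect"
    "HOL-Algebra.Bij"
    "HOL-Algebra.Elementary_Groups"
    "HOL-Library.Function_Algebras"
    "HOL-Computational_Algebra.Primes"
begin

text \<open>A pair \<open>(a, True)\<close> stands for the letter \<open>a\<close>, and \<open>(a, False)\<close> for its formal inverse.
  Letters are both the generators of a free group and the arcs of a graph, the latter traversed
  along or against their orientation.\<close>

definition flip :: "'a \<times> bool \<Rightarrow> 'a \<times> bool" where
  "flip a = (fst a, \<not> snd a)"

definition reduced :: "('a \<times> bool) list \<Rightarrow> bool" where
  "reduced w \<longleftrightarrow> (\<forall>i. Suc i < length w \<longrightarrow> w ! Suc i \<noteq> flip (w ! i))"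

definition word_value :: "('g, 'm) monoid_scheme \<Rightarrow> ('g \<times> bool) list \<Rightarrow> 'g" where
  "word_value F w =
    foldr (\<lambda>(b, s) g. (if s then b else inv\<^bsub>F\<^esub> b) \<otimes>\<^bsub>F\<^esub> g) w \<one>\<^bsub>F\<^esub>"

text \<open>Freeness is expressed by normal forms: every element is the value of exactly one reduced
  word in the basis.\<close>

definition free_basis :: "('g, 'm) monoid_scheme \<Rightarrow> 'g set \<Rightarrow> bool" where
  "free_basis F B \<longleftrightarrow> B \<subseteq> carrier F \<and>
    bij_betw (word_value F) {w \<in> lists (B \<times> UNIV). reduced w} (carrier F)"

definition free_of_rank :: "('g, 'm) monoid_scheme \<Rightarrow> nat \<Rightarrow> bool" where
  "free_of_rank F n \<longleftrightarrow> group F \<and> (\<exists>B. free_basis F B \<and> finite B \<and> card B = n)"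

definition primitive :: "('g, 'm) monoid_scheme \<Rightarrow> 'g \<Rightarrow> bool" where
  "primitive F g \<longleftrightarrow> (\<exists>B. free_basis F B \<and> g \<in> B)"

definition center :: "('g, 'm) monoid_scheme \<Rightarrow> 'g set" where
  "center G = {z \<in> carrier G. \<forall>g \<in> carrier G. z \<otimes>\<^bsub>G\<^esub> g = g \<otimes>\<^bsub>G\<^esub> z}"

definition two_step_nilpotent :: "('g, 'm) monoid_scheme \<Rightarrow> bool" where
  "two_step_nilpotent G \<longleftrightarrow> group G \<and> derived G (carrier G) \<subseteq> center G"

text \<open>A graph (loops and multiple edges allowed) is a digraph, i.e. a one-dimensional cell complex
  with a chosen orientation of each edge. Edge paths may traverse arcs in both directions; they are
  the directed walks in the graph that has a second, reversed copy of each arc.\<close>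

definition double :: "('v, 'e) pre_digraph \<Rightarrow> ('v, 'e \<times> bool) pre_digraph" where
  "double X = \<lparr> verts = verts X, arcs = arcs X \<times> UNIV,
     tail = (\<lambda>(e, b). if b then tail X e else head X e),
     head = (\<lambda>(e, b). if b then head X e else tail X e) \<rparr>"

definition loops_at :: "('v, 'e) pre_digraph \<Rightarrow> 'v \<Rightarrow> ('e \<times> bool) list set" where
  "loops_at X x = {w. pre_digraph.awalk (double X) x w x}"

definition backtrack :: "('v, 'e) pre_digraph \<Rightarrow> 'v \<Rightarrow> ('e \<times> bool) list rel" where
  "backtrack X x = {(u @ w, u @ [a, flip a] @ w) | u a w.
     u @ w \<in> loops_at X x \<and> u @ [a, flip a] @ w \<in> loops_at X x}"

definition homotopy :: "('v, 'e) pre_digraph \<Rightarrow> 'v \<Rightarrow> ('e \<times> bool) list rel" where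
  "homotopy X x = Restr ((backtrack X x \<union> (backtrack X x)\<inverse>)\<^sup>*) (loops_at X x)"

definition homotopy_class :: "('v, 'e) pre_digraph \<Rightarrow> 'v \<Rightarrow> ('e \<times> bool) list \<Rightarrow> ('e \<times> bool) list set" where
  "homotopy_class X x w = homotopy X x `` {w}"

definition fundamental_group :: "('v, 'e) pre_digraph \<Rightarrow> 'v \<Rightarrow> ('e \<times> bool) list set monoid" where
  "fundamental_group X x =
    \<lparr> carrier = loops_at X x // homotopy X x,
      mult = (\<lambda>A B. homotopy X x `` {u @ w | u w. u \<in> A \<and> w \<in> B}),
      one = homotopy_class X x [] \<rparr>"

text \<open>A cover is a graph morphism, given by its vertex part \<open>pv\<close> and its arc part \<open>pa\<close>, which is
  bijective on stars. It is no restriction that it preserves the orientations: an orientation of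
  the base lifts to any cover.\<close>

definition cover ::
  "('w, 'f) pre_digraph \<Rightarrow> ('v, 'e) pre_digraph \<Rightarrow> ('w \<Rightarrow> 'v) \<Rightarrow> ('f \<Rightarrow> 'e) \<Rightarrow> bool" where
  "cover Y X pv pa \<longleftrightarrow>
     pv ` verts Y = verts X \<and> pa ` arcs Y \<subseteq> arcs X \<and>
     (\<forall>f \<in> arcs Y. tail X (pa f) = pv (tail Y f) \<and> head X (pa f) = pv (head Y f)) \<and>
     (\<forall>y \<in> verts Y. bij_betw pa (out_arcs Y y) (out_arcs X (pv y)) \<and>
                    bij_betw pa (in_arcs Y y) (in_arcs X (pv y)))"

definition deck_group ::
  "('w, 'f) pre_digraph \<Rightarrow> ('w \<Rightarrow> 'v) \<Rightarrow> ('f \<Rightarrow> 'e) \<Rightarrow> (('w \<Rightarrow> 'w) \<times> ('f \<Rightarrow> 'f)) monoid" where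
  "deck_group Y pv pa = (BijGroup (verts Y) \<times>\<times> BijGroup (arcs Y))
     \<lparr> carrier := {(s, t). s \<in> Bij (verts Y) \<and> t \<in> Bij (arcs Y) \<and>
         (\<forall>f \<in> arcs Y. tail Y (t f) = s (tail Y f) \<and> head Y (t f) = s (head Y f)) \<and>
         (\<forall>y \<in> verts Y. pv (s y) = pv y) \<and> (\<forall>f \<in> arcs Y. pa (t f) = pa f)} \<rparr>"

definition normal_cover ::
  "('w, 'f) pre_digraph \<Rightarrow> ('v, 'e) pre_digraph \<Rightarrow> ('w \<Rightarrow> 'v) \<Rightarrow> ('f \<Rightarrow> 'e) \<Rightarrow> bool" where
  "normal_cover Y X pv pa \<longleftrightarrow> cover Y X pv pa \<and>
     (\<forall>y \<in> verts Y. \<forall>y' \<in> verts Y. pv y = pv y' \<longrightarrow>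
        (\<exists>(s, t) \<in> carrier (deck_group Y pv pa). s y = y'))"

definition map_path :: "('f \<Rightarrow> 'e) \<Rightarrow> ('f \<times> bool) list \<Rightarrow> ('e \<times> bool) list" where
  "map_path h = map (map_prod h id)"

definition covering_subgroup ::
  "('w, 'f) pre_digraph \<Rightarrow> ('v, 'e) pre_digraph \<Rightarrow> ('w \<Rightarrow> 'v) \<Rightarrow> ('f \<Rightarrow> 'e) \<Rightarrow> 'w \<Rightarrow>
   ('e \<times> bool) list set set" where
  "covering_subgroup Y X pv pa y =
     (\<lambda>w. homotopy_class X (pv y) (map_path pa w)) ` loops_at Y y"

text \<open>Identifying \<open>\<pi>\<^sub>1(Y, y)\<close> with its image \<open>covering_subgroup\<close> in \<open>\<pi>\<^sub>1(X, pv y)\<close>, the cover is the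
  one that corresponds to the kernel of \<open>\<phi>\<close>.\<close>

definition defining_surjection ::
  "('w, 'f) pre_digraph \<Rightarrow> ('v, 'e) pre_digraph \<Rightarrow> ('w \<Rightarrow> 'v) \<Rightarrow> ('f \<Rightarrow> 'e) \<Rightarrow> 'w \<Rightarrow>
   ('g, 'm) monoid_scheme \<Rightarrow> (('e \<times> bool) list set \<Rightarrow> 'g) \<Rightarrow> bool" where
  "defining_surjection Y X pv pa y G \<phi> \<longleftrightarrow>
     \<phi> \<in> epi (fundamental_group X (pv y)) G \<and>
     kernel (fundamental_group X (pv y)) G \<phi> = covering_subgroup Y X pv pa y"

text \<open>Cellular chains with complex coefficients: functions vanishing off the arcs.\<close>

definition chain_scale :: "complex \<Rightarrow> ('a \<Rightarrow> complex) \<Rightarrow> 'a \<Rightarrow> complex" where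
  "chain_scale c f = (\<lambda>a. c * f a)"

interpretation chains: vector_space "chain_scale :: complex \<Rightarrow> ('a \<Rightarrow> complex) \<Rightarrow> 'a \<Rightarrow> complex"
  by unfold_locales (auto simp: chain_scale_def fun_eq_iff algebra_simps)

definition one_chains :: "('v, 'e) pre_digraph \<Rightarrow> ('e \<Rightarrow> complex) set" where
  "one_chains Y = {c. \<forall>e. e \<notin> arcs Y \<longrightarrow> c e = 0}"

definition boundary :: "('v, 'e) pre_digraph \<Rightarrow> ('e \<Rightarrow> complex) \<Rightarrow> 'v \<Rightarrow> complex" where
  "boundary Y c = (\<lambda>v. (\<Sum>e \<in> in_arcs Y v. c e) - (\<Sum>e \<in> out_arcs Y v. c e))"

text \<open>A graph has no 2-cells, so its first homology is the space of 1-cycles.\<close>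

definition H1 :: "('v, 'e) pre_digraph \<Rightarrow> ('e \<Rightarrow> complex) set" where
  "H1 Y = {c \<in> one_chains Y. boundary Y c = 0}"

definition homology_class :: "('e \<times> bool) list \<Rightarrow> 'e \<Rightarrow> complex" where
  "homology_class w = (\<lambda>e. of_nat (count_list w (e, True)) - of_nat (count_list w (e, False)))"

definition loop_power :: "'a list \<Rightarrow> nat \<Rightarrow> 'a list" where
  "loop_power w k = concat (replicate k w)"

definition closed_lift ::
  "('w, 'f) pre_digraph \<Rightarrow> ('f \<Rightarrow> 'e) \<Rightarrow> 'w \<Rightarrow> ('e \<times> bool) list \<Rightarrow> ('f \<times> bool) list \<Rightarrow> bool" where
  "closed_lift Y pa y w u \<longleftrightarrow> u \<in> loops_at Y y \<and> map_path pa u = w"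

definition preferred_elevation ::
  "('w, 'f) pre_digraph \<Rightarrow> ('f \<Rightarrow> 'e) \<Rightarrow> 'w \<Rightarrow> ('e \<times> bool) list \<Rightarrow> ('f \<times> bool) list \<Rightarrow> bool" where
  "preferred_elevation Y pa y w u \<longleftrightarrow>
     (\<exists>k \<ge> 1. closed_lift Y pa y (loop_power w k) u \<and>
        (\<forall>j \<ge> 1. (\<exists>u'. closed_lift Y pa y (loop_power w j) u') \<longrightarrow> k \<le> j))"

definition elevations ::
  "('w, 'f) pre_digraph \<Rightarrow> ('w \<Rightarrow> 'v) \<Rightarrow> ('f \<Rightarrow> 'e) \<Rightarrow> 'w \<Rightarrow> ('e \<times> bool) list \<Rightarrow>
   ('f \<times> bool) list set" where
  "elevations Y pv pa y w = {map_path t u | s t u.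
     (s, t) \<in> carrier (deck_group Y pv pa) \<and> preferred_elevation Y pa y w u}"

definition H1_prim ::
  "('w, 'f) pre_digraph \<Rightarrow> ('v, 'e) pre_digraph \<Rightarrow> ('w \<Rightarrow> 'v) \<Rightarrow> ('f \<Rightarrow> 'e) \<Rightarrow> 'w \<Rightarrow>
   ('f \<Rightarrow> complex) set" where
  "H1_prim Y X pv pa y = chains.span {homology_class u | u w.
     w \<in> loops_at X (pv y) \<and>
     primitive (fundamental_group X (pv y)) (homotopy_class X (pv y) w) \<and>
     u \<in> elevations Y pv pa y w}"

text \<open>A representation of dimension \<open>d\<close> is a pair \<open>(d, \<rho>)\<close> with \<open>\<rho>\<close> a homomorphism to \<open>GL\<^sub>d(\<complex>)\<close>
  acting on \<open>\<complex>\<^sup>d\<close>. All irreducible representations of a finite group are finite-dimensional, so up to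
  isomorphism this loses none of them.\<close>

type_synonym 'g rep = "nat \<times> ('g \<Rightarrow> complex mat)"

definition GL :: "nat \<Rightarrow> complex mat monoid" where
  "GL d = units_of (ring_mat TYPE(complex) d ())"

definition irreducible_rep :: "('g, 'm) monoid_scheme \<Rightarrow> 'g rep \<Rightarrow> bool" where
  "irreducible_rep G = (\<lambda>(d, \<rho>). \<rho> \<in> hom G (GL d) \<and> d \<noteq> 0 \<and>
     (\<forall>W. VectorSpace.subspace class_ring W (module_vec TYPE(complex) d) \<and>
        (\<forall>g \<in> carrier G. \<forall>v \<in> W. \<rho> g *\<^sub>v v \<in> W) \<longrightarrow> W = {0\<^sub>v d} \<or> W = carrier_vec d))"

definition rep_iso :: "('g, 'm) monoid_scheme \<Rightarrow> 'g rep rel" where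
  "rep_iso G = {((d, \<rho>), (d', \<rho>')). d = d' \<and>
     (\<exists>P \<in> carrier (GL d). \<forall>g \<in> carrier G. P * \<rho> g = \<rho>' g * P)}"

definition Irr :: "('g, 'm) monoid_scheme \<Rightarrow> 'g rep set set" where
  "Irr G = {V. irreducible_rep G V} // Restr (rep_iso G) {V. irreducible_rep G V}"

definition Irr_pr ::
  "('h, 'k) monoid_scheme \<Rightarrow> ('h \<Rightarrow> 'g) \<Rightarrow> ('g, 'm) monoid_scheme \<Rightarrow> 'g rep set set" where
  "Irr_pr F \<phi> G = {C \<in> Irr G. \<exists>(d, \<rho>) \<in> C. \<exists>\<gamma> v. primitive F \<gamma> \<and>
     v \<in> carrier_vec d \<and> v \<noteq> 0\<^sub>v d \<and> \<rho> (\<phi> \<gamma>) *\<^sub>v v = v}"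

end

theory Submission
  imports Defs "HOL-Number_Theory.Cong" "HOL-Algebra.Multiplicative_Group"
begin

text \<open>Restrict a representation of \<open>G\<close> to a joint eigenspace of the center. There the commutator pairing
  \<open>(x, y) \<mapsto> [x, y]\<close> takes scalar values, so it is an alternating form on \<open>F\<^sub>n\<close> modulo its commutator
  subgroup. For (1), the Euclidean algorithm on two basis elements produces basis elements \<open>x\<close>, \<open>y\<close>
  that act by commuting operators; on a common eigenvector the algorithm, applied to the
  eigenvalues, turns \<open>x\<close> and \<open>y\<close> into a primitive element that fixes it.

  For (2), a functional on \<open>H\<^sub>1(Y; \<complex>)\<close> that vanishes on primitive homology is a homomorphism
  \<open>ker \<phi> \<rightarrow> \<complex>\<close> that kills the powers of primitive elements. These form a representation of \<open>G\<close>, and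
  averaging extends them to a cocycle on \<open>F\<^sub>n\<close>. When the center has prime exponent \<open>p\<close> and \<open>n\<close> is odd,
  the alternating form has a radical that contains a primitive element \<open>z\<close>. It acts by a scalar,
  which is made nontrivial by multiplying \<open>z\<close> by a commutator, and a coboundary makes the cocycle
  vanish at \<open>z\<close>. The values at the other elements \<open>x\<close> of a basis that contains \<open>z\<close> then vanish because
  of the primitive elements \<open>x z\<^sup>a\<close> and \<open>z x\<^sup>b\<close>. In the abelian case a basis with at most one element
  that acts nontrivially on an eigenvector plays the role of \<open>z\<close>.\<close>

section \<open>Free bases\<close>

text \<open>Irreducibility is replaced by shrinking. Both parts need only one nonzero vector with
  the wanted property, so an argument may pass to a nonzero subrepresentation as often as it likes.
  For (2) this is applied to the representation of all offending homomorphisms at once: a nonzero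
  member that vanishes on the kernel is absurd, so there are none. No finite dimension is needed,
  since eigenvectors come from averaging over operators of finite order.

  Rank 3 enters (1) because one basis element must stay in place while the Euclidean algorithm runs
  on two others. Oddness enters (2) because hyperbolic pairs use up two basis elements at a time.
  Primality of p enters because a nontrivial p-th root of unity generates all of them, so that a
  pairing can be cancelled by a power, as over a field.

  The cocycle must vanish at z first: only then does it have the same value at x and at all x z^a.
  The scalar of z has order p or p^2. If it is p and x^p acts nontrivially, the powers of x z^a no
  longer help, and elements z x^b that act trivially take over.\<close>

lemma map_prod_flip: "map_prod h id (flip a) = flip (map_prod h id a)"
  by (cases a) (simp add: flip_def)

lemma reduced_Nil [simp]: "reduced []" and reduced_single [simp]: "reduced [a]"
  by (simp_all add: reduced_def)

lemma reduced_Cons_Cons [simp]: "reduced (a # b # w) \<longleftrightarrow> b \<noteq> flip a \<and> reduced (b # w)"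
proof
  assume "reduced (a # b # w)"
  then show "b \<noteq> flip a \<and> reduced (b # w)"
    unfolding reduced_def by (metis (no_types, lifting) One_nat_def Suc_less_eq length_Cons nth_Cons_0 nth_Cons_Suc zero_less_Suc)
next
  assume *: "b \<noteq> flip a \<and> reduced (b # w)"
  show "reduced (a # b # w)"
    unfolding reduced_def
  proof (intro allI impI)
    fix i assume "Suc i < length (a # b # w)"
    then show "(a # b # w) ! Suc i \<noteq> flip ((a # b # w) ! i)"
      using * unfolding reduced_def by (cases i) auto
  qed
qed

fun cancel_cons :: "'a \<times> bool \<Rightarrow> ('a \<times> bool) list \<Rightarrow> ('a \<times> bool) list" where
  "cancel_cons a [] = [a]"
| "cancel_cons a (b # w) = (if b = flip a then w else a # b # w)"

definition free_reduction :: "('a \<times> bool) list \<Rightarrow> ('a \<times> bool) list" where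
  "free_reduction w = foldr cancel_cons w []"

lemma reduced_tl: "reduced (a # w) \<Longrightarrow> reduced w"
  by (cases w) auto

lemma reduced_cancel_cons: "reduced w \<Longrightarrow> reduced (cancel_cons a w)"
  by (cases w) (auto dest: reduced_tl)

lemma reduced_free_reduction: "reduced (free_reduction w)"
  unfolding free_reduction_def by (induction w) (auto intro: reduced_cancel_cons)

lemma set_free_reduction: "set (free_reduction w) \<subseteq> set w"
proof -
  have "set (cancel_cons a v) \<subseteq> insert a (set v)" for a :: "'a \<times> bool" and v
    by (cases v) auto
  then show ?thesis
    unfolding free_reduction_def by (induction w) (simp, fastforce)
qed

lemma word_value_Nil [simp]: "word_value H [] = \<one>\<^bsub>H\<^esub>"
  by (simp add: word_value_def)

lemma word_value_Cons:
  "word_value H (a # w) = (if snd a then fst a else inv\<^bsub>H\<^esub> (fst a)) \<otimes>\<^bsub>H\<^esub> word_value H w"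
  by (cases a) (simp add: word_value_def)

context group
begin

lemma word_value_closed [intro]: "set w \<subseteq> carrier G \<times> UNIV \<Longrightarrow> word_value G w \<in> carrier G"
  by (induction w) (auto simp: word_value_Cons)

lemma word_value_append:
  "\<lbrakk>set u \<subseteq> carrier G \<times> UNIV; set v \<subseteq> carrier G \<times> UNIV\<rbrakk> \<Longrightarrow>
   word_value G (u @ v) = word_value G u \<otimes> word_value G v"
  by (induction u) (auto simp: word_value_Cons m_assoc word_value_closed)

lemma word_value_single: "g \<in> carrier G \<Longrightarrow> word_value G [(g, True)] = g"
  by (simp add: word_value_Cons)

text \<open>Letters are evaluated through \<open>h\<close>, so that one statement serves both the
  group \<open>F\<close> itself, with \<open>h\<close> the identity, and the target of the universal
  property, where \<open>h\<close> need not be injective.\<close>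

lemma word_value_cancel_cons:
  assumes "set (a # w) \<subseteq> A \<times> UNIV" "h ` A \<subseteq> carrier G"
  shows "word_value G (map_path h (cancel_cons a w)) = word_value G (map_path h (a # w))"
proof (cases w)
  case (Cons b v)
  obtain x s where a: "a = (x, s)" by fastforce
  have "h x \<in> carrier G" "set (map_path h v) \<subseteq> carrier G \<times> UNIV"
    using assms Cons a by (auto simp: map_path_def)
  then show ?thesis
    using Cons a by (auto simp: map_path_def flip_def word_value_Cons word_value_closed m_assoc[symmetric])
qed (simp add: map_path_def)

lemma word_value_free_reduction:
  assumes "set w \<subseteq> A \<times> UNIV" "h ` A \<subseteq> carrier G"
  shows "word_value G (map_path h (free_reduction w)) = word_value G (map_path h w)"
  using assms(1)
proof (induction w)
  case (Cons a w)
  have *: "free_reduction (a # w) = cancel_cons a (free_reduction w)"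
    by (simp add: free_reduction_def)
  have "set (a # free_reduction w) \<subseteq> A \<times> UNIV"
    using Cons.prems set_free_reduction[of w] by auto
  then have "word_value G (map_path h (free_reduction (a # w))) = word_value G (map_path h (a # free_reduction w))"
    unfolding * by (rule word_value_cancel_cons) (rule assms(2))
  also have "\<dots> = word_value G (map_path h (a # w))"
    using Cons by (simp add: map_path_def word_value_Cons)
  finally show ?case .
qed (simp add: free_reduction_def)

lemma word_value_in_generate:
  "set w \<subseteq> A \<times> UNIV \<Longrightarrow> word_value G w \<in> generate G A"
proof (induction w)
  case (Cons a w)
  then have "(if snd a then fst a else inv (fst a)) \<in> generate G A"
    by (auto intro: generate.incl generate.inv)
  with Cons show ?case
    unfolding word_value_Cons by (intro generate.eng) auto
qed (simp add: generate.one)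

end

lemma hom_word_value:
  assumes "group F" "group H" "\<theta> \<in> hom F H" "set w \<subseteq> carrier F \<times> UNIV"
  shows "\<theta> (word_value F w) = word_value H (map_path \<theta> w)"
proof -
  interpret group_hom F H \<theta>
    using assms by (simp add: group_hom_def group_hom_axioms_def)
  show ?thesis
    using assms(4) by (induction w) (auto simp: map_path_def word_value_Cons G.word_value_closed)
qed

text \<open>Injectivity prevents two letters that do not cancel from having images that
  cancel.\<close>

lemma reduced_map_path:
  assumes "inj_on h A" "set w \<subseteq> A \<times> UNIV"
  shows "reduced (map_path h w) \<longleftrightarrow> reduced w"
  using assms(2)
proof (induction w rule: induct_list012)
  case (3 a b w)
  have "map_prod h id b = flip (map_prod h id a) \<longleftrightarrow> b = flip a"
    using 3(3) assms(1) by (cases a; cases b) (auto simp: flip_def inj_on_def)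
  then show ?case
    using 3 by (simp add: map_path_def)
qed (auto simp: map_path_def)

section \<open>Universal property of free bases and Nielsen transformations\<close>

lemma free_basisD:
  assumes "free_basis F B"
  shows "B \<subseteq> carrier F" "bij_betw (word_value F) {w \<in> lists (B \<times> UNIV). reduced w} (carrier F)"
  using assms by (auto simp: free_basis_def)

lemma free_basis_word:
  assumes "free_basis F B" "\<gamma> \<in> carrier F"
  obtains w where "set w \<subseteq> B \<times> UNIV" "reduced w" "word_value F w = \<gamma>"
proof -
  have "\<gamma> \<in> word_value F ` {w \<in> lists (B \<times> UNIV). reduced w}"
    using free_basisD(2)[OF assms(1)] assms(2) by (simp add: bij_betw_def)
  then show thesis
    using that by auto
qed

lemma free_basis_generate:
  assumes "group F" "free_basis F B"
  shows "generate F B = carrier F"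
proof
  interpret group F by fact
  show "generate F B \<subseteq> carrier F"
    using generate_incl free_basisD(1)[OF assms(2)] by blast
  show "carrier F \<subseteq> generate F B"
    using word_value_in_generate free_basisD(1)[OF assms(2)] by (metis assms(2) free_basis_word subsetI)
qed

text \<open>The universal property, recovered from normal forms: \<open>\<theta>\<close> evaluates
  \<open>h\<close> on the reduced word of an element. Multiplicativity follows because a
  concatenation of two normal forms, although not reduced, may be used in place of the normal form
  of the product.\<close>

lemma free_basis_extend_hom:
  assumes "group F" "free_basis F B" "group H" "h ` B \<subseteq> carrier H"
  shows "\<exists>\<theta> \<in> hom F H. \<forall>b \<in> B. \<theta> b = h b"
proof -
  interpret F: group F by fact
  interpret H: group H by fact
  let ?R = "{w \<in> lists (B \<times> UNIV). reduced w}"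
  have BF: "B \<subseteq> carrier F" and bij: "bij_betw (word_value F) ?R (carrier F)"
    using free_basisD[OF assms(2)] by auto
  define nf where "nf = the_inv_into ?R (word_value F)"
  define \<theta> where "\<theta> \<gamma> = word_value H (map_path h (nf \<gamma>))" for \<gamma>
  have nf: "set (nf \<gamma>) \<subseteq> B \<times> UNIV" "reduced (nf \<gamma>)" "word_value F (nf \<gamma>) = \<gamma>" if "\<gamma> \<in> carrier F" for \<gamma>
  proof -
    have "nf \<gamma> \<in> ?R"
      unfolding nf_def using that bij by (metis (no_types, lifting) bij_betw_def order_refl the_inv_into_into)
    then show "set (nf \<gamma>) \<subseteq> B \<times> UNIV" "reduced (nf \<gamma>)" by auto
    show "word_value F (nf \<gamma>) = \<gamma>"
      unfolding nf_def using that bij by (metis (no_types, lifting) bij_betw_def f_the_inv_into_f)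
  qed
  \<comment> \<open>By uniqueness of reduced words, the normal form of the value of \<open>w\<close>
    is the free reduction of \<open>w\<close>; reducing changes the value neither in
    \<open>F\<close> nor in \<open>H\<close>.\<close>
  have val: "\<theta> (word_value F w) = word_value H (map_path h w)" if w: "set w \<subseteq> B \<times> UNIV" for w
  proof -
    have "free_reduction w \<in> ?R"
      using w set_free_reduction[of w] reduced_free_reduction[of w] by auto
    moreover have "word_value F (free_reduction w) = word_value F w"
      using F.word_value_free_reduction[OF w, of id] BF by (simp add: map_path_def map_prod.id)
    ultimately have "nf (word_value F w) = free_reduction w"
      unfolding nf_def using bij by (metis (no_types, lifting) bij_betw_def the_inv_into_f_f)
    then show ?thesis
      unfolding \<theta>_def using H.word_value_free_reduction[OF w assms(4)] by simp
  qed
  have mp: "set (map_path h w) \<subseteq> carrier H \<times> UNIV" if "set w \<subseteq> B \<times> UNIV" for w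
    using that assms(4) by (fastforce simp: map_path_def)
  show ?thesis
  proof (intro bexI ballI)
    show "\<theta> \<in> hom F H"
    proof (rule homI)
      fix a assume "a \<in> carrier F"
      then show "\<theta> a \<in> carrier H"
        unfolding \<theta>_def using nf mp by blast
    next
      fix a b assume ab: "a \<in> carrier F" "b \<in> carrier F"
      have inF: "set (nf c) \<subseteq> carrier F \<times> UNIV" if "c \<in> carrier F" for c
        using nf(1)[OF that] BF by blast
      have "a \<otimes>\<^bsub>F\<^esub> b = word_value F (nf a @ nf b)"
        using ab nf inF by (simp add: F.word_value_append)
      then have "\<theta> (a \<otimes>\<^bsub>F\<^esub> b) = word_value H (map_path h (nf a @ nf b))"
        using val[of "nf a @ nf b"] nf ab by simp
      also have "\<dots> = word_value H (map_path h (nf a)) \<otimes>\<^bsub>H\<^esub> word_value H (map_path h (nf b))"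
        using H.word_value_append mp nf(1) ab by (metis map_append map_path_def)
      finally show "\<theta> (a \<otimes>\<^bsub>F\<^esub> b) = \<theta> a \<otimes>\<^bsub>H\<^esub> \<theta> b"
        by (simp add: \<theta>_def)
    qed
  next
    fix b assume "b \<in> B"
    then have "\<theta> (word_value F [(b, True)]) = h b"
      using assms(4) by (subst val) (auto simp: map_path_def H.word_value_single)
    then show "\<theta> b = h b"
      using \<open>b \<in> B\<close> BF by (auto simp: F.word_value_single)
  qed
qed

lemma hom_eq_on_generate:
  assumes "group F" "group H" "\<theta> \<in> hom F H" "\<theta>' \<in> hom F H" "A \<subseteq> carrier F"
    and "\<And>a. a \<in> A \<Longrightarrow> \<theta> a = \<theta>' a" and "\<gamma> \<in> generate F A"
  shows "\<theta> \<gamma> = \<theta>' \<gamma>"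
proof -
  interpret a: group_hom F H \<theta>
    using assms by (simp add: group_hom_def group_hom_axioms_def)
  interpret b: group_hom F H \<theta>'
    using assms by (simp add: group_hom_def group_hom_axioms_def)
  show ?thesis
    using assms(7)
  proof induction
    case (eng g k)
    then have "g \<in> carrier F" "k \<in> carrier F"
      using a.G.generate_in_carrier assms(5) by blast+
    then show ?case using eng by simp
  qed (use assms(5,6) in auto)
qed

text \<open>An automorphism acts on reduced words letter by letter, so it transports normal forms
  over \<open>B\<close> to normal forms over the image of \<open>B\<close>.\<close>

lemma free_basis_image:
  assumes "group F" "free_basis F B" "\<theta> \<in> hom F F" "bij_betw \<theta> (carrier F) (carrier F)"
  shows "free_basis F (\<theta> ` B)"
proof -
  have BF: "B \<subseteq> carrier F" and bij: "bij_betw (word_value F) {w \<in> lists (B \<times> UNIV). reduced w} (carrier F)"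
    using free_basisD[OF assms(2)] by auto
  have inj: "inj_on \<theta> B"
    using BF assms(4) by (meson bij_betw_def inj_on_subset)
  let ?R = "\<lambda>B. {w \<in> lists (B \<times> UNIV). reduced w}"
  have im: "map_path \<theta> ` ?R B = ?R (\<theta> ` B)"
  proof
    show "map_path \<theta> ` ?R B \<subseteq> ?R (\<theta> ` B)"
    proof (rule image_subsetI)
      fix w assume w: "w \<in> ?R B"
      then have s: "set w \<subseteq> B \<times> UNIV" by auto
      then have "set (map_path \<theta> w) \<subseteq> \<theta> ` B \<times> UNIV"
        by (fastforce simp: map_path_def)
      then show "map_path \<theta> w \<in> ?R (\<theta> ` B)"
        using reduced_map_path[OF inj s] w by blast
    qed
    show "?R (\<theta> ` B) \<subseteq> map_path \<theta> ` ?R B"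
    proof
      fix w assume "w \<in> ?R (\<theta> ` B)"
      then have w: "w \<in> lists (\<theta> ` B \<times> UNIV)" "reduced w" by auto
      have "\<theta> ` B \<times> (UNIV :: bool set) = map_prod \<theta> id ` (B \<times> UNIV)"
        by force
      then have "w \<in> map (map_prod \<theta> id) ` lists (B \<times> UNIV)"
        using w(1) by (metis lists_image)
      then obtain u where u: "u \<in> lists (B \<times> UNIV)" "w = map_path \<theta> u"
        by (auto simp: map_path_def)
      then have "reduced u"
        using reduced_map_path[OF inj, of u] w by auto
      then show "w \<in> map_path \<theta> ` ?R B"
        using u by blast
    qed
  qed
  have eq: "\<theta> (word_value F w) = word_value F (map_path \<theta> w)" if "w \<in> ?R B" for w
  proof (rule hom_word_value[OF assms(1,1,3)])
    have "set w \<subseteq> B \<times> UNIV" using that by auto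
    then show "set w \<subseteq> carrier F \<times> UNIV" using BF by auto
  qed
  have "bij_betw (\<theta> \<circ> word_value F) (?R B) (carrier F)"
    using bij assms(4) by (rule bij_betw_trans)
  then have b: "bij_betw (word_value F \<circ> map_path \<theta>) (?R B) (carrier F)"
    by (subst bij_betw_cong[where g = "\<theta> \<circ> word_value F"]) (auto simp: eq)
  have "inj_on (word_value F) (map_path \<theta> ` ?R B)"
    using b by (intro inj_on_imageI) (rule bij_betw_imp_inj_on)
  moreover have "word_value F ` map_path \<theta> ` ?R B = carrier F"
    using b by (simp only: bij_betw_def image_comp)
  ultimately have "bij_betw (word_value F) (?R (\<theta> ` B)) (carrier F)"
    unfolding im bij_betw_def by blast
  moreover have "\<theta> ` B \<subseteq> carrier F"
    using BF assms(4) by (auto simp: bij_betw_def)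
  ultimately show ?thesis
    by (simp add: free_basis_def)
qed

text \<open>All elements of \<open>D\<close> are modified at once, by words in the untouched
  elements. The induced endomorphism fixes these words, so multiplying by their inverses undoes it,
  and an automorphism maps bases to bases. Injectivity of \<open>\<tau>\<close> is kept for counting
  basis elements later.\<close>

lemma free_basis_transvection:
  assumes "group F" "free_basis F B" "D \<subseteq> B" "\<And>t. t \<in> D \<Longrightarrow> w t \<in> generate F (B - D)"
  defines "\<tau> \<equiv> \<lambda>t. if t \<in> D then t \<otimes>\<^bsub>F\<^esub> w t else t"
  shows "free_basis F (\<tau> ` B)" "inj_on \<tau> B"
proof -
  interpret group F by fact
  have BF: "B \<subseteq> carrier F"
    using free_basisD[OF assms(2)] by auto
  have wF: "w t \<in> carrier F" if "t \<in> D" for t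
    using assms(4)[OF that] BF generate_in_carrier[of "B - D"] by blast
  have im: "\<tau> ` B \<subseteq> carrier F"
    using BF wF by (auto simp: \<tau>_def)
  obtain \<theta> where \<theta>: "\<theta> \<in> hom F F" "\<And>b. b \<in> B \<Longrightarrow> \<theta> b = \<tau> b"
    using free_basis_extend_hom[OF assms(1,2,1) im] by blast
  have im': "(\<lambda>t. if t \<in> D then t \<otimes>\<^bsub>F\<^esub> inv\<^bsub>F\<^esub> w t else t) ` B \<subseteq> carrier F"
    using BF wF by auto
  obtain \<theta>' where \<theta>': "\<theta>' \<in> hom F F"
    "\<And>b. b \<in> B \<Longrightarrow> \<theta>' b = (if b \<in> D then b \<otimes>\<^bsub>F\<^esub> inv\<^bsub>F\<^esub> w b else b)"
    using free_basis_extend_hom[OF assms(1,2,1) im'] by blast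
  interpret t: group_hom F F \<theta>
    using \<theta>(1) by unfold_locales
  interpret t': group_hom F F \<theta>'
    using \<theta>'(1) by unfold_locales
  have id: "(\<lambda>x. x) \<in> hom F F"
    by (rule homI) auto
  \<comment> \<open>The words \<open>w t\<close> avoid \<open>D\<close>, where alone
    \<open>\<theta>\<close> and \<open>\<theta>'\<close> differ from the identity.\<close>
  have fix1: "\<theta> (w t) = w t" if "t \<in> D" for t
    by (rule hom_eq_on_generate[OF assms(1,1) \<theta>(1) id _ _ assms(4)[OF that]])
      (use BF \<theta>(2) in \<open>auto simp: \<tau>_def\<close>)
  have fix2: "\<theta>' (w t) = w t" if "t \<in> D" for t
    by (rule hom_eq_on_generate[OF assms(1,1) \<theta>'(1) id _ _ assms(4)[OF that]])
      (use BF \<theta>'(2) in auto)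
  have \<theta>\<theta>': "\<theta> (\<theta>' \<gamma>) = \<gamma>" if "\<gamma> \<in> carrier F" for \<gamma>
  proof -
    have "(\<theta> \<circ> \<theta>') \<gamma> = \<gamma>"
    proof (rule hom_eq_on_generate[OF assms(1,1) _ id BF])
      show "\<theta> \<circ> \<theta>' \<in> hom F F" using \<theta>'(1) \<theta>(1) by (rule Group.hom_compose)
      show "\<gamma> \<in> generate F B" using that free_basis_generate[OF assms(1,2)] by simp
      show "(\<theta> \<circ> \<theta>') b = b" if "b \<in> B" for b
      proof (cases "b \<in> D")
        case True
        then show ?thesis
          using that BF wF[OF True] fix1[OF True] \<theta>(2)[OF that] \<theta>'(2)[OF that]
          by (auto simp: \<tau>_def m_assoc subset_iff)
      qed (use that \<theta> \<theta>' in \<open>auto simp: \<tau>_def\<close>)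
    qed
    then show ?thesis by simp
  qed
  have \<theta>'\<theta>: "\<theta>' (\<theta> \<gamma>) = \<gamma>" if "\<gamma> \<in> carrier F" for \<gamma>
  proof -
    have "(\<theta>' \<circ> \<theta>) \<gamma> = \<gamma>"
    proof (rule hom_eq_on_generate[OF assms(1,1) _ id BF])
      show "\<theta>' \<circ> \<theta> \<in> hom F F" using \<theta>(1) \<theta>'(1) by (rule Group.hom_compose)
      show "\<gamma> \<in> generate F B" using that free_basis_generate[OF assms(1,2)] by simp
      show "(\<theta>' \<circ> \<theta>) b = b" if "b \<in> B" for b
      proof (cases "b \<in> D")
        case True
        then show ?thesis
          using that BF wF[OF True] fix2[OF True] \<theta>(2)[OF that] \<theta>'(2)[OF that]
          by (auto simp: \<tau>_def m_assoc subset_iff)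
      qed (use that \<theta> \<theta>' in \<open>auto simp: \<tau>_def\<close>)
    qed
    then show ?thesis by simp
  qed
  have bij: "bij_betw \<theta> (carrier F) (carrier F)"
    by (rule bij_betw_byWitness[where f' = \<theta>']) (use \<theta>\<theta>' \<theta>'\<theta> in auto)
  have "\<theta> ` B = \<tau> ` B"
    using \<theta>(2) by auto
  then show "free_basis F (\<tau> ` B)"
    using free_basis_image[OF assms(1,2) \<theta>(1) bij] by simp
  have "inj_on \<theta> B"
    using BF bij by (meson bij_betw_def inj_on_subset)
  then show "inj_on \<tau> B"
    using \<theta>(2) by (metis inj_on_cong)
qed

text \<open>A Nielsen move on a single element. The second claim says that the new element does not
  collide with an old one, which keeps the elements of the pair in the Euclidean algorithm distinct
  and outside the rest of the basis.\<close>

lemma free_basis_replace: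
  assumes "group F" "free_basis F B" "x \<in> B" "w \<in> generate F (B - {x})"
  shows "free_basis F (insert (x \<otimes>\<^bsub>F\<^esub> w) (B - {x}))" "x \<otimes>\<^bsub>F\<^esub> w \<notin> B - {x}"
proof -
  let ?\<tau> = "\<lambda>t. if t \<in> {x} then t \<otimes>\<^bsub>F\<^esub> w else t"
  have "?\<tau> ` B = insert (x \<otimes>\<^bsub>F\<^esub> w) (B - {x})"
    using assms(3) by force
  then show "free_basis F (insert (x \<otimes>\<^bsub>F\<^esub> w) (B - {x}))"
    using free_basis_transvection(1)[OF assms(1,2), of "{x}" "\<lambda>_. w"] assms(3,4) by simp
  have "inj_on ?\<tau> B"
    using free_basis_transvection(2)[OF assms(1,2), of "{x}" "\<lambda>_. w"] assms(3,4) by simp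
  then have "x = x \<otimes>\<^bsub>F\<^esub> w" if "x \<otimes>\<^bsub>F\<^esub> w \<in> B - {x}"
    using assms(3) that inj_onD[of ?\<tau> B x "x \<otimes>\<^bsub>F\<^esub> w"] by simp
  then show "x \<otimes>\<^bsub>F\<^esub> w \<notin> B - {x}"
    by (metis DiffE singletonI)
qed

text \<open>The elements of \<open>S i\<close> are those of degree \<open>i\<close>. An element may have several degrees, because
  degrees are read off from powers of a root of unity.\<close>

lemma free_basis_euclid:
  fixes S :: "int \<Rightarrow> 'h set"
  assumes F: "group F"
    and S: "\<And>a b i j. \<lbrakk>a \<in> carrier F; b \<in> carrier F; a \<in> S i; b \<in> S j\<rbrakk> \<Longrightarrow> a \<otimes>\<^bsub>F\<^esub> inv\<^bsub>F\<^esub> b \<in> S (i - j)"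
    and "free_basis F ({x, y} \<union> C)" "x \<noteq> y" "x \<notin> C" "y \<notin> C" "x \<in> S (int s)" "y \<in> S (int t)"
  shows "\<exists>x' y'. free_basis F ({x', y'} \<union> C) \<and> x' \<noteq> y' \<and> x' \<notin> C \<and> y' \<notin> C \<and> y' \<in> S 0"
  using assms(3-)
proof (induction "s + t" arbitrary: s t x y rule: less_induct)
  case less
  interpret group F by fact
  have xy: "x \<in> carrier F" "y \<in> carrier F"
    using free_basisD(1)[OF less.prems(1)] by auto
  consider "t = 0" | "s = 0" | "0 < s" "s \<le> t" | "0 < t" "t < s" by linarith
  then show ?case
  proof cases
    case 1
    then show ?thesis using less.prems by auto
  next
    case 2
    then show ?thesis using less.prems
      by (intro exI[of _ y] exI[of _ x]) (auto simp: insert_commute)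
  next
    case 3
    have d: "({x, y} \<union> C) - {y} = {x} \<union> C" using less.prems by auto
    have "inv\<^bsub>F\<^esub> x \<in> generate F ({x} \<union> C)" by (auto intro: generate.intros)
    then have "free_basis F (insert (y \<otimes>\<^bsub>F\<^esub> inv\<^bsub>F\<^esub> x) ({x} \<union> C))" "y \<otimes>\<^bsub>F\<^esub> inv\<^bsub>F\<^esub> x \<notin> {x} \<union> C"
      using free_basis_replace[OF F less.prems(1), of y "inv\<^bsub>F\<^esub> x"] d by auto
    moreover have "insert (y \<otimes>\<^bsub>F\<^esub> inv\<^bsub>F\<^esub> x) ({x} \<union> C) = {x, y \<otimes>\<^bsub>F\<^esub> inv\<^bsub>F\<^esub> x} \<union> C" by auto
    moreover have "y \<otimes>\<^bsub>F\<^esub> inv\<^bsub>F\<^esub> x \<in> S (int (t - s))"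
      using S[OF xy(2,1) less.prems(6,5)] 3 by (simp add: of_nat_diff)
    ultimately show ?thesis
      using less.hyps[of s "t - s" x "y \<otimes>\<^bsub>F\<^esub> inv\<^bsub>F\<^esub> x"] less.prems 3 by auto
  next
    case 4
    have d: "({x, y} \<union> C) - {x} = {y} \<union> C" using less.prems by auto
    have "inv\<^bsub>F\<^esub> y \<in> generate F ({y} \<union> C)" by (auto intro: generate.intros)
    then have "free_basis F (insert (x \<otimes>\<^bsub>F\<^esub> inv\<^bsub>F\<^esub> y) ({y} \<union> C))" "x \<otimes>\<^bsub>F\<^esub> inv\<^bsub>F\<^esub> y \<notin> {y} \<union> C"
      using free_basis_replace[OF F less.prems(1), of x "inv\<^bsub>F\<^esub> y"] d by auto
    moreover have "insert (x \<otimes>\<^bsub>F\<^esub> inv\<^bsub>F\<^esub> y) ({y} \<union> C) = {x \<otimes>\<^bsub>F\<^esub> inv\<^bsub>F\<^esub> y, y} \<union> C" by auto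
    moreover have "x \<otimes>\<^bsub>F\<^esub> inv\<^bsub>F\<^esub> y \<in> S (int (s - t))"
      using S[OF xy less.prems(5,6)] 4 by (simp add: of_nat_diff)
    ultimately show ?thesis
      using less.hyps[of "s - t" t "x \<otimes>\<^bsub>F\<^esub> inv\<^bsub>F\<^esub> y" y] less.prems 4 by auto
  qed
qed

section \<open>Eigenspaces in representations of finite groups\<close>

lemma sum_fun_apply: "(\<Sum>i\<in>I. f i) x = (\<Sum>i\<in>I. f i x)"
  for f :: "'b \<Rightarrow> 'c \<Rightarrow> 'd :: comm_monoid_add"
  by (induction I rule: infinite_finite_induct) auto

section \<open>Roots of unity\<close>

definition unity_root :: "nat \<Rightarrow> complex" where
  "unity_root n = cis (2 * pi / real n)"

lemma unity_root_nonzero [simp]: "unity_root n \<noteq> 0"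
  by (simp add: unity_root_def)

lemma unity_root_power: "unity_root n ^ k = cis (2 * pi * real k / real n)"
  by (simp add: unity_root_def DeMoivre mult_ac)

lemma unity_root_power_self [simp]: "unity_root n ^ n = 1"
  by (cases "n = 0") (simp_all add: unity_root_power)

lemma unity_root_power_neq_1: "\<lbrakk>0 < k; k < n\<rbrakk> \<Longrightarrow> unity_root n ^ k \<noteq> 1"
proof
  assume k: "0 < k" "k < n" and "unity_root n ^ k = 1"
  then have "cis (2 * pi * real k / real n) = cis (2 * pi * real 0 / real n)"
    by (simp add: unity_root_power)
  then show False
    using inj_onD[OF bij_betw_imp_inj_on[OF bij_betw_roots_unity[of n]], of k 0] k by auto
qed

lemma unity_root_exhausts:
  assumes "0 < n" "z ^ n = 1"
  obtains k where "k < n" "z = unity_root n ^ k"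
  using bij_betw_roots_unity[OF assms(1)] assms(2) unfolding bij_betw_def unity_root_power by auto

lemma sum_powers_root_of_unity:
  fixes z :: "'a :: field"
  assumes "z ^ n = 1" "z \<noteq> 1"
  shows "(\<Sum>i<n. z ^ i) = 0"
  using geometric_sum[OF assms(2), of n] assms(1) by simp

text \<open>The p-th roots of unity form a group of prime order, so \<open>u\<close> generates it
  and the inverse of \<open>v\<close> is a power of \<open>u\<close>.\<close>

lemma prime_root_of_unity_power:
  fixes u v :: complex
  assumes "prime p" "u ^ p = 1" "u \<noteq> 1" "v ^ p = 1"
  obtains a :: nat where "v * u ^ a = 1"
proof -
  have p: "0 < p" using assms(1) prime_gt_0_nat by blast
  obtain s where s: "u = unity_root p ^ s" "s < p" using unity_root_exhausts[OF p assms(2)] by auto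
  obtain t where t: "v = unity_root p ^ t" using unity_root_exhausts[OF p assms(4)] by auto
  have "\<not> p dvd s" using s assms(3) by (auto dest: dvd_imp_le)
  then have "coprime s p" using assms(1) by (simp add: coprime_commute prime_imp_coprime)
  then obtain r where r: "[s * r = 1] (mod p)" using cong_solve_coprime_nat by auto
  \<comment> \<open>The factor \<open>(p - 1) * t\<close> stands for \<open>- t\<close> modulo
    \<open>p\<close> while staying in the natural numbers.\<close>
  have "[s * (r * ((p - 1) * t)) = 1 * ((p - 1) * t)] (mod p)"
    using cong_mult[OF r cong_refl[of "(p - 1) * t"]] by (simp add: mult_ac)
  then have "[t + s * (r * ((p - 1) * t)) = t + (p - 1) * t] (mod p)"
    by (simp add: cong_add_lcancel_nat)
  moreover have "t + (p - 1) * t = p * t" using p by (cases p) auto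
  ultimately have "p dvd t + s * (r * ((p - 1) * t))"
    by (metis cong_dvd_iff dvd_triv_left)
  then obtain m where "t + s * (r * ((p - 1) * t)) = p * m" by (auto elim: dvdE)
  then have "unity_root p ^ t * (unity_root p ^ s) ^ (r * ((p - 1) * t)) = (unity_root p ^ p) ^ m"
    by (simp only: power_mult[symmetric] power_add[symmetric])
  then show thesis using that by (simp add: s(1) t)
qed

text \<open>Nothing is required of \<open>T\<close> outside \<open>W\<close>, so the same operator
  can be restricted to ever smaller invariant subspaces. The ambient function space accommodates
  both homomorphisms on a kernel and coordinate vectors.\<close>

definition linear_endo :: "('i \<Rightarrow> complex) set \<Rightarrow> (('i \<Rightarrow> complex) \<Rightarrow> 'i \<Rightarrow> complex) \<Rightarrow> bool" where
  "linear_endo W T \<longleftrightarrow> chains.subspace W \<and> (\<forall>f \<in> W. T f \<in> W) \<and>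
     (\<forall>f \<in> W. \<forall>g \<in> W. T (f + g) = T f + T g) \<and> (\<forall>c. \<forall>f \<in> W. T (chain_scale c f) = chain_scale c (T f))"

lemma linear_endoD:
  assumes "linear_endo W T"
  shows "chains.subspace W" "f \<in> W \<Longrightarrow> T f \<in> W"
    "f \<in> W \<Longrightarrow> g \<in> W \<Longrightarrow> T (f + g) = T f + T g"
    "f \<in> W \<Longrightarrow> T (chain_scale c f) = chain_scale c (T f)"
  using assms by (auto simp: linear_endo_def)

lemma linear_endo_zero: "linear_endo W T \<Longrightarrow> T 0 = 0"
  using linear_endoD(4)[of W T 0 0] chains.subspace_0[of W] by (auto simp: linear_endoD)

lemma linear_endo_sum:
  assumes "linear_endo W T" "\<And>j. j \<in> J \<Longrightarrow> g j \<in> W"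
  shows "T (\<Sum>j\<in>J. g j) = (\<Sum>j\<in>J. T (g j))"
  using assms(2)
proof (induction J rule: infinite_finite_induct)
  case (insert j J)
  then have "(\<Sum>j\<in>J. g j) \<in> W"
    using linear_endoD(1)[OF assms(1)] chains.subspace_sum by (metis insertCI)
  then have "T (g j + (\<Sum>j\<in>J. g j)) = T (g j) + T (\<Sum>j\<in>J. g j)"
    by (intro linear_endoD(3)[OF assms(1)] insert.prems) auto
  also have "T (\<Sum>j\<in>J. g j) = (\<Sum>j\<in>J. T (g j))"
    using insert.IH insert.prems by blast
  finally show ?case
    unfolding sum.insert[OF insert(1,2)] .
qed (use assms(1) linear_endo_zero in auto)

lemma linear_endo_funpow: "\<lbrakk>linear_endo W T; f \<in> W\<rbrakk> \<Longrightarrow> (T ^^ k) f \<in> W"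
  by (induction k) (auto simp: linear_endoD)

lemma subspace_eigenspace: "linear_endo W T \<Longrightarrow> chains.subspace {f \<in> W. T f = chain_scale c f}"
  unfolding chains.subspace_def
  by (auto simp: linear_endoD linear_endo_zero linear_endoD(1)[THEN chains.subspace_0]
      linear_endoD(1)[THEN chains.subspace_add] linear_endoD(1)[THEN chains.subspace_scale]
      chains.scale_right_distrib chains.scale_left_commute)

text \<open>Since \<open>T\<close> has finite order on \<open>f\<close>, the averages
  \<open>P s\<close> project \<open>f\<close> to the eigenspaces of the powers of
  \<open>unity_root N\<close>. They add up to \<open>N\<close> times \<open>f\<close>, so one of
  them is nonzero. This needs no characteristic polynomial and works in infinite dimension.\<close>

lemma eigenvector_root_of_unity:
  assumes T: "linear_endo W T" and N: "0 < N" and f: "f \<in> W" "f \<noteq> 0" "(T ^^ N) f = f"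
  obtains s v where "v \<in> W" "v \<noteq> 0" "T v = chain_scale (unity_root N ^ s) v"
proof -
  let ?\<theta> = "inverse (unity_root N)"
  define g where "g s j = chain_scale ((?\<theta> ^ s) ^ j) ((T ^^ j) f)" for s j
  define P where "P s = (\<Sum>j<N. g s j)" for s
  have gW: "g s j \<in> W" for s j
    unfolding g_def using linear_endo_funpow[OF T f(1)] linear_endoD(1)[OF T] chains.subspace_scale by blast
  have PW: "P s \<in> W" for s
    unfolding P_def using linear_endoD(1)[OF T] gW by (simp add: chains.subspace_sum)
  have eig: "T (P s) = chain_scale (unity_root N ^ s) (P s)" for s
  proof -
    have step: "T (g s j) = chain_scale (unity_root N ^ s) (g s (Suc j))" for j
      using linear_endoD(4)[OF T linear_endo_funpow[OF T f(1)]]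
      by (simp add: g_def power_inverse flip: power_mult_distrib)
    \<comment> \<open>The shift from \<open>g s j\<close> to \<open>g s (Suc j)\<close> closes up
      cyclically, because both the coefficient and the iterate of \<open>T\<close> return after
      \<open>N\<close> steps.\<close>
    have "g s N = g s 0"
      using f(3) by (simp add: g_def flip: power_mult) (simp add: power_inverse mult.commute[of s] power_mult)
    moreover have "g s 0 + (\<Sum>j<N. g s (Suc j)) = (\<Sum>j<N. g s j) + g s N"
      by (metis sum.lessThan_Suc sum.lessThan_Suc_shift)
    ultimately have "(\<Sum>j<N. g s (Suc j)) = P s"
      by (simp add: P_def add.commute)
    then show ?thesis
      using linear_endo_sum[OF T, of "{..<N}" "g s"] gW step
      by (simp add: P_def flip: chains.scale_sum_right)
  qed
  \<comment> \<open>Orthogonality of characters: summing over \<open>s\<close> kills every iterate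
    except \<open>j = 0\<close>.\<close>
  have "(\<Sum>s<N. P s) i = of_nat N * f i" for i
  proof -
    have "(\<Sum>s<N. P s) i = (\<Sum>s<N. \<Sum>j<N. (?\<theta> ^ j) ^ s * (T ^^ j) f i)"
      by (simp add: P_def g_def chain_scale_def sum_fun_apply mult.commute flip: power_mult)
    also have "\<dots> = (\<Sum>j<N. (\<Sum>s<N. (?\<theta> ^ j) ^ s) * (T ^^ j) f i)"
      by (subst sum.swap) (simp add: sum_distrib_right)
    also have "\<dots> = (\<Sum>j<N. if j = 0 then of_nat N * f i else 0)"
    proof (rule sum.cong)
      fix j assume "j \<in> {..<N}"
      then have "j \<noteq> 0 \<Longrightarrow> (\<Sum>s<N. (?\<theta> ^ j) ^ s) = 0"
        using unity_root_power_neq_1[of j N]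
        by (intro sum_powers_root_of_unity)
          (simp_all add: power_inverse mult.commute[of j] power_mult flip: power_mult[of "unity_root N" j])
      then show "(\<Sum>s<N. (?\<theta> ^ j) ^ s) * (T ^^ j) f i = (if j = 0 then of_nat N * f i else 0)"
        by simp
    qed simp
    also have "\<dots> = of_nat N * f i"
      using N by simp
    finally show ?thesis .
  qed
  moreover obtain i where "f i \<noteq> 0"
    using f(2) by (metis ext zero_fun_apply)
  ultimately have "(\<Sum>s<N. P s) \<noteq> 0"
    using N by (metis mult_eq_0_iff of_nat_eq_0_iff less_irrefl zero_fun_apply)
  then obtain s where "P s \<noteq> 0"
    by (meson sum.neutral)
  then show thesis
    using that PW eig by blast
qed

text \<open>A right action, because \<open>G\<close> acts from the right on the homomorphisms on a kernel
  by precomposition with conjugation.\<close>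

locale fin_rep = group G for G (structure) +
  fixes W :: "('i \<Rightarrow> complex) set" and act :: "'a \<Rightarrow> ('i \<Rightarrow> complex) \<Rightarrow> 'i \<Rightarrow> complex"
  assumes finite_carrier: "finite (carrier G)"
    and subspace: "chains.subspace W"
    and endo: "g \<in> carrier G \<Longrightarrow> linear_endo W (act g)"
    and act_one: "f \<in> W \<Longrightarrow> act \<one> f = f"
    and act_mult: "\<lbrakk>g \<in> carrier G; h \<in> carrier G; f \<in> W\<rbrakk> \<Longrightarrow> act (g \<otimes> h) f = act h (act g f)"
begin

lemmas act_in = linear_endoD(2)[OF endo]
  and act_add = linear_endoD(3)[OF endo]
  and act_scale = linear_endoD(4)[OF endo]

abbreviation \<epsilon> :: complex where "\<epsilon> \<equiv> unity_root (Coset.order G)"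

lemma order_pos: "0 < Coset.order G"
  using finite_carrier order_gt_0_iff_finite by blast

lemma act_pow: "\<lbrakk>g \<in> carrier G; f \<in> W\<rbrakk> \<Longrightarrow> act (g [^] k) f = (act g ^^ k) f"
  by (induction k) (auto simp: act_one act_mult)

lemma funpow_order: "\<lbrakk>g \<in> carrier G; f \<in> W\<rbrakk> \<Longrightarrow> (act g ^^ Coset.order G) f = f"
  by (metis act_pow act_one pow_order_eq_1)

lemma act_pow_scalar:
  assumes "g \<in> carrier G" "f \<in> W" "act g f = chain_scale c f"
  shows "act (g [^] k) f = chain_scale (c ^ k) f"
  by (induction k) (use assms in \<open>auto simp: act_one act_mult act_scale mult.commute\<close>)

lemma act_inv_scalar:
  assumes "g \<in> carrier G" "f \<in> W" "act g f = chain_scale c f" "c \<noteq> 0"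
  shows "act (inv g) f = chain_scale (inverse c) f"
proof -
  have "f = act (inv g) (chain_scale c f)"
    using assms act_mult[of g "inv g" f] by (simp add: act_one)
  also have "\<dots> = chain_scale c (act (inv g) f)"
    using assms by (simp add: act_scale)
  finally have "chain_scale (inverse c) f = chain_scale (inverse c) (chain_scale c (act (inv g) f))"
    by simp
  then show ?thesis using assms(4) by simp
qed

lemma subrep:
  assumes "W' \<subseteq> W" "chains.subspace W'" "\<And>g f. g \<in> carrier G \<Longrightarrow> f \<in> W' \<Longrightarrow> act g f \<in> W'"
  shows "fin_rep G W' act"
proof unfold_locales
  fix g assume g: "g \<in> carrier G"
  show "linear_endo W' (act g)"
    unfolding linear_endo_def using assms act_add[OF g] act_scale[OF g] g by (auto simp: subset_iff)
qed (use assms finite_carrier act_one act_mult in \<open>auto simp: subset_iff\<close>)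

text \<open>An eigenspace of \<open>c\<close> is invariant if \<open>c\<close> commutes with
  everything. Commutation is demanded of the operators on \<open>W\<close> only, because after a
  restriction more elements act centrally than lie in the center of \<open>G\<close>.\<close>

lemma eigenspace_subrep:
  assumes c: "c \<in> carrier G" "\<And>g f. g \<in> carrier G \<Longrightarrow> f \<in> W \<Longrightarrow> act (c \<otimes> g) f = act (g \<otimes> c) f"
    and "W \<noteq> {0}"
  shows "\<exists>s. \<exists>W' \<subseteq> W. fin_rep G W' act \<and> W' \<noteq> {0} \<and> (\<forall>f \<in> W'. act c f = chain_scale (\<epsilon> ^ s) f)"
proof -
  obtain f where f: "f \<in> W" "f \<noteq> 0"
    using assms(3) subspace chains.subspace_0 by blast
  obtain s v where v: "v \<in> W" "v \<noteq> 0" "act c v = chain_scale (\<epsilon> ^ s) v"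
    by (rule eigenvector_root_of_unity[OF endo[OF c(1)] order_pos f funpow_order[OF c(1) f(1)]])
  define W' where "W' = {f \<in> W. act c f = chain_scale (\<epsilon> ^ s) f}"
  have "fin_rep G W' act"
  proof (rule subrep)
    show "W' \<subseteq> W" "chains.subspace W'"
      unfolding W'_def using subspace_eigenspace[OF endo[OF c(1)]] by auto
    fix g f assume "g \<in> carrier G" "f \<in> W'"
    then show "act g f \<in> W'"
      using c(2)[of g f] by (simp add: W'_def act_in act_scale act_mult c(1))
  qed
  moreover have "v \<in> W'" "W' \<subseteq> W" "\<forall>f \<in> W'. act c f = chain_scale (\<epsilon> ^ s) f"
    using v by (auto simp: W'_def)
  ultimately show ?thesis
    using v(2) by (intro exI[of _ s] exI[of _ W'] conjI) auto
qed

text \<open>Takes the place of Schur's lemma. Each eigenspace is again invariant under all of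
  \<open>G\<close>, so the elements of \<open>C\<close> can be made scalar one after the
  other.\<close>

lemma joint_eigenspace_subrep:
  assumes "finite C" "C \<subseteq> carrier G"
    "\<And>c g f. c \<in> C \<Longrightarrow> g \<in> carrier G \<Longrightarrow> f \<in> W \<Longrightarrow> act (c \<otimes> g) f = act (g \<otimes> c) f"
    and "W \<noteq> {0}"
  shows "\<exists>W' \<subseteq> W. fin_rep G W' act \<and> W' \<noteq> {0} \<and>
    (\<forall>c \<in> C. \<exists>s. \<forall>f \<in> W'. act c f = chain_scale (\<epsilon> ^ s) f)"
  using assms(1-3)
proof (induction C)
  case empty
  then show ?case using assms(4) fin_rep_axioms by blast
next
  case (insert c C)
  have "C \<subseteq> carrier G" "\<And>c g f. c \<in> C \<Longrightarrow> g \<in> carrier G \<Longrightarrow> f \<in> W \<Longrightarrow> act (c \<otimes> g) f = act (g \<otimes> c) f"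
    using insert.prems by auto
  from insert.IH[OF this] obtain W' where W': "W' \<subseteq> W" "fin_rep G W' act" "W' \<noteq> {0}"
    "\<forall>c \<in> C. \<exists>s. \<forall>f \<in> W'. act c f = chain_scale (\<epsilon> ^ s) f" by blast
  then interpret W': fin_rep G W' act by simp
  have c: "c \<in> carrier G" "\<And>g f. g \<in> carrier G \<Longrightarrow> f \<in> W' \<Longrightarrow> act (c \<otimes> g) f = act (g \<otimes> c) f"
    using insert.prems W' by auto
  obtain s W'' where W'': "W'' \<subseteq> W'" "fin_rep G W'' act" "W'' \<noteq> {0}"
    "\<forall>f \<in> W''. act c f = chain_scale (\<epsilon> ^ s) f"
    using W'.eigenspace_subrep[OF c W'(3)] by blast
  have "W'' \<subseteq> W \<and> fin_rep G W'' act \<and> W'' \<noteq> {0} \<and>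
    (\<forall>c \<in> insert c C. \<exists>s. \<forall>f \<in> W''. act c f = chain_scale (\<epsilon> ^ s) f)"
  proof (intro conjI ballI)
    fix c' assume "c' \<in> insert c C"
    then consider "c' = c" | "c' \<in> C" by blast
    then show "\<exists>s. \<forall>f \<in> W''. act c' f = chain_scale (\<epsilon> ^ s) f"
    proof cases
      case 1 then show ?thesis using W''(4) by blast
    next
      case 2 then show ?thesis using W'(4) W''(1) by (meson subsetD)
    qed
  qed (use W'(1) W'' in auto)
  then show ?case by blast
qed

end

section \<open>Commutators in groups of nilpotency class at most two\<close>

definition commutator :: "('g, 'm) monoid_scheme \<Rightarrow> 'g \<Rightarrow> 'g \<Rightarrow> 'g" where
  "commutator G a b = a \<otimes>\<^bsub>G\<^esub> b \<otimes>\<^bsub>G\<^esub> inv\<^bsub>G\<^esub> a \<otimes>\<^bsub>G\<^esub> inv\<^bsub>G\<^esub> b"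

lemma (in group) commutator_closed [intro, simp]:
  "\<lbrakk>a \<in> carrier G; b \<in> carrier G\<rbrakk> \<Longrightarrow> commutator G a b \<in> carrier G"
  by (simp add: commutator_def)

lemma (in group) commutator_swap:
  "\<lbrakk>a \<in> carrier G; b \<in> carrier G\<rbrakk> \<Longrightarrow> a \<otimes> b = commutator G a b \<otimes> (b \<otimes> a)"
proof -
  assume [simp]: "a \<in> carrier G" "b \<in> carrier G"
  have "commutator G a b \<otimes> (b \<otimes> a) = a \<otimes> b \<otimes> (inv a \<otimes> ((inv b \<otimes> b) \<otimes> a))"
    by (simp only: commutator_def m_assoc m_closed inv_closed \<open>a \<in> carrier G\<close> \<open>b \<in> carrier G\<close>)
  then show "a \<otimes> b = commutator G a b \<otimes> (b \<otimes> a)" by simp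
qed

lemma hom_commutator:
  assumes "group F" "group H" "\<theta> \<in> hom F H" "a \<in> carrier F" "b \<in> carrier F"
  shows "\<theta> (commutator F a b) = commutator H (\<theta> a) (\<theta> b)"
proof -
  interpret group_hom F H \<theta>
    using assms by (simp add: group_hom_def group_hom_axioms_def)
  show ?thesis using assms by (simp add: commutator_def)
qed

text \<open>Treats the abelian and the 2-step nilpotent case together.\<close>

locale class2_group = group G for G (structure) +
  assumes commutator_central: "\<lbrakk>a \<in> carrier G; b \<in> carrier G\<rbrakk> \<Longrightarrow> commutator G a b \<in> center G"
begin

lemma centerD: "z \<in> center G \<Longrightarrow> g \<in> carrier G \<Longrightarrow> z \<otimes> g = g \<otimes> z"
  by (simp add: center_def)

lemma centerI: "\<lbrakk>z \<in> carrier G; \<And>g. g \<in> carrier G \<Longrightarrow> z \<otimes> g = g \<otimes> z\<rbrakk> \<Longrightarrow> z \<in> center G"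
  by (simp add: center_def)

lemma commutator_mult_right:
  assumes [simp]: "a \<in> carrier G" "b \<in> carrier G" "c \<in> carrier G"
  shows "commutator G a (b \<otimes> c) = commutator G a b \<otimes> commutator G a c"
proof -
  have "commutator G a b \<otimes> commutator G a c = a \<otimes> b \<otimes> inv a \<otimes> (inv b \<otimes> commutator G a c)"
    by (simp add: commutator_def[of G a b] m_assoc)
  \<comment> \<open>Moving the central factor \<open>commutator G a c\<close> past
    \<open>inv b\<close> puts it next to \<open>inv a\<close>, where the product collapses.\<close>
  also have "inv b \<otimes> commutator G a c = commutator G a c \<otimes> inv b"
    by (rule centerD[OF commutator_central, symmetric]) simp_all
  also have "a \<otimes> b \<otimes> inv a \<otimes> (commutator G a c \<otimes> inv b) = a \<otimes> b \<otimes> (inv a \<otimes> a) \<otimes> c \<otimes> inv a \<otimes> inv c \<otimes> inv b"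
    by (simp only: commutator_def m_assoc m_closed inv_closed assms)
  also have "\<dots> = commutator G a (b \<otimes> c)"
    by (simp add: commutator_def m_assoc inv_mult_group)
  finally show ?thesis ..
qed

lemma commutator_inv_swap:
  "\<lbrakk>a \<in> carrier G; b \<in> carrier G\<rbrakk> \<Longrightarrow> commutator G b a = inv (commutator G a b)"
  by (simp add: commutator_def inv_mult_group m_assoc)

lemma commutator_mult_left:
  assumes [simp]: "a \<in> carrier G" "b \<in> carrier G" "c \<in> carrier G"
  shows "commutator G (a \<otimes> b) c = commutator G a c \<otimes> commutator G b c"
proof -
  have "commutator G (a \<otimes> b) c = inv (commutator G c a \<otimes> commutator G c b)"
    using commutator_inv_swap[of c "a \<otimes> b"] by (simp add: commutator_mult_right)
  also have "\<dots> = commutator G b c \<otimes> commutator G a c"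
    using commutator_inv_swap[of c a] commutator_inv_swap[of c b] by (simp add: inv_mult_group)
  also have "\<dots> = commutator G a c \<otimes> commutator G b c"
    by (rule centerD[OF commutator_central]) simp_all
  finally show ?thesis .
qed

lemma commutator_hom: "a \<in> carrier G \<Longrightarrow> group_hom G G (commutator G a)"
  by unfold_locales (auto simp: hom_def commutator_mult_right)

lemma commutator_self: "a \<in> carrier G \<Longrightarrow> commutator G a a = \<one>"
  by (simp add: commutator_def m_assoc)

lemma commutator_inv_right:
  "\<lbrakk>a \<in> carrier G; b \<in> carrier G\<rbrakk> \<Longrightarrow> commutator G a (inv b) = inv (commutator G a b)"
  using group_hom.hom_inv[OF commutator_hom] by blast

lemma commutator_pow_right:
  "\<lbrakk>a \<in> carrier G; b \<in> carrier G\<rbrakk> \<Longrightarrow> commutator G a (b [^] (k::nat)) = commutator G a b [^] k"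
  using group_hom.hom_nat_pow[OF commutator_hom] by blast

end

text \<open>Two runs of the Euclidean algorithm. The first runs on \<open>x2\<close> and
  \<open>x3\<close>, with degrees given by the pairing with \<open>x1\<close>, and ends with a basis
  element that commutes with \<open>x1\<close> on \<open>W'\<close>. The second runs on that element
  and \<open>x1\<close>, with degrees given by their eigenvalues at a common eigenvector. The first
  run needs three basis elements.\<close>

lemma primitive_fixing_vector:
  fixes G :: "('g, 'm) monoid_scheme" and W :: "('i \<Rightarrow> complex) set"
  assumes F: "group F" "free_basis F B" "3 \<le> card B" and \<phi>: "\<phi> \<in> hom F G"
    and G: "class2_group G" "fin_rep G W act" and W: "W \<noteq> {0}"
  shows "\<exists>\<gamma> v. primitive F \<gamma> \<and> v \<in> W \<and> v \<noteq> 0 \<and> act (\<phi> \<gamma>) v = v"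
proof -
  interpret class2_group G by fact
  interpret R0: fin_rep G W act by fact
  interpret h: group_hom F G \<phi>
    using F(1) \<phi> by (simp add: group_hom_def group_hom_axioms_def is_group)
  have "center G \<subseteq> carrier G" by (auto simp: center_def)
  \<comment> \<open>On \<open>W'\<close> all commutators act by powers of \<epsilon>, which gives
    the pairing with \<open>x1\<close> its integer exponents.\<close>
  then obtain W' where W': "W' \<subseteq> W" "fin_rep G W' act" "W' \<noteq> {0}"
    "\<forall>c \<in> center G. \<exists>s. \<forall>f \<in> W'. act c f = chain_scale (unity_root (Coset.order G) ^ s) f"
    using R0.joint_eigenspace_subrep[of "center G"] W R0.finite_carrier centerD
    by (metis finite_subset)
  interpret R: fin_rep G W' act by (rule W'(2))
  obtain x1 x2 x3 where x: "x1 \<in> B" "x2 \<in> B" "x3 \<in> B" "x1 \<noteq> x2" "x1 \<noteq> x3" "x2 \<noteq> x3"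
  proof -
    obtain T where "T \<subseteq> B" "card T = 3" using F(3) by (meson obtain_subset_with_card_n)
    then show thesis using that by (auto simp: card_3_iff)
  qed
  have BF: "B \<subseteq> carrier F" using free_basisD(1)[OF F(2)] .
  let ?a = "\<phi> x1"
  have a: "?a \<in> carrier G" using x BF by auto
  \<comment> \<open>The degree of \<open>y\<close> is an exponent of the scalar of
    \<open>commutator G ?a (\<phi> y)\<close>. Bimultiplicativity of commutators makes quotients
    subtract degrees.\<close>
  define S where "S i = {y \<in> carrier F. \<forall>f \<in> W'. act (commutator G ?a (\<phi> y)) f = chain_scale (unity_root (Coset.order G) powi i) f}" for i
  have S: "b \<otimes>\<^bsub>F\<^esub> inv\<^bsub>F\<^esub> c \<in> S (i - j)"
    if "b \<in> carrier F" "c \<in> carrier F" "b \<in> S i" "c \<in> S j" for b c i j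
  proof -
    have "act (commutator G ?a (\<phi> (b \<otimes>\<^bsub>F\<^esub> inv\<^bsub>F\<^esub> c))) f = chain_scale (unity_root (Coset.order G) powi (i - j)) f" if f: "f \<in> W'" for f
    proof -
      have 1: "act (commutator G ?a (\<phi> b)) f = chain_scale (unity_root (Coset.order G) powi i) f"
        "act (commutator G ?a (\<phi> c)) f = chain_scale (unity_root (Coset.order G) powi j) f"
        using that \<open>b \<in> S i\<close> \<open>c \<in> S j\<close> by (auto simp: S_def)
      have "act (inv\<^bsub>G\<^esub> (commutator G ?a (\<phi> c))) f = chain_scale (inverse (unity_root (Coset.order G) powi j)) f"
        using R.act_inv_scalar[OF _ f 1(2)] a \<open>c \<in> carrier F\<close> by simp
      moreover have "commutator G ?a (\<phi> (b \<otimes>\<^bsub>F\<^esub> inv\<^bsub>F\<^esub> c)) = commutator G ?a (\<phi> b) \<otimes>\<^bsub>G\<^esub> inv\<^bsub>G\<^esub> (commutator G ?a (\<phi> c))"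
        using that \<open>b \<in> carrier F\<close> \<open>c \<in> carrier F\<close> a by (simp add: commutator_mult_right commutator_inv_right)
      ultimately show ?thesis
        using 1 f a \<open>b \<in> carrier F\<close> \<open>c \<in> carrier F\<close>
        by (simp add: R.act_mult R.act_scale power_int_diff divide_inverse)
    qed
    then show ?thesis using that by (simp add: S_def)
  qed
  have Sx: "\<exists>s. x \<in> S (int s)" if "x \<in> B" for x
  proof -
    have "commutator G ?a (\<phi> x) \<in> center G"
      using that BF a by (intro commutator_central) auto
    then show ?thesis
      using W'(4) that BF by (fastforce simp: S_def)
  qed
  obtain s t where st: "x2 \<in> S (int s)" "x3 \<in> S (int t)"
    using Sx x by metis
  \<comment> \<open>\<open>C\<close> still contains \<open>x1\<close>, so \<open>x1\<close> survives
    the first run as a basis element.\<close>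
  define C where "C = B - {x2, x3}"
  have BC: "{x2, x3} \<union> C = B" using x by (auto simp: C_def)
  obtain x' y' where y': "free_basis F ({x', y'} \<union> C)" "x' \<noteq> y'" "x' \<notin> C" "y' \<notin> C" "y' \<in> S 0"
    using free_basis_euclid[of F S x2 x3 C s t, OF F(1) S] BC F(2) x(6) st by (auto simp: C_def)
  have y'F: "y' \<in> carrier F" using free_basisD(1)[OF y'(1)] by auto
  let ?b = "\<phi> y'"
  have b: "?b \<in> carrier G" using y'F by auto
  have ab: "act (?a \<otimes>\<^bsub>G\<^esub> ?b) f = act (?b \<otimes>\<^bsub>G\<^esub> ?a) f" if "f \<in> W'" for f
  proof -
    have "act (commutator G ?a ?b) f = f"
      using y'(5) that by (simp add: S_def)
    then show ?thesis
      unfolding commutator_swap[OF a b] using a b that by (subst R.act_mult) auto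
  qed
  obtain f where f: "f \<in> W'" "f \<noteq> 0"
    using W'(3) R.subspace chains.subspace_0 by blast
  obtain s v0 where v0: "v0 \<in> W'" "v0 \<noteq> 0" "act ?a v0 = chain_scale (unity_root (Coset.order G) ^ s) v0"
    by (rule eigenvector_root_of_unity[OF R.endo[OF a] R.order_pos f R.funpow_order[OF a f(1)]])
  \<comment> \<open>The eigenspace of \<open>x1\<close> is preserved by \<open>y'\<close>, as the
    two commute on \<open>W'\<close>; an eigenvector of \<open>y'\<close> inside it is a common
    one.\<close>
  define U where "U = {f \<in> W'. act ?a f = chain_scale (unity_root (Coset.order G) ^ s) f}"
  have U: "linear_endo U (act ?b)"
    unfolding linear_endo_def
  proof (intro conjI ballI)
    show "chains.subspace U"
      unfolding U_def by (rule subspace_eigenspace[OF R.endo[OF a]])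
    show "act ?b f \<in> U" if "f \<in> U" for f
      using that ab[of f] by (simp add: U_def R.act_in R.act_mult R.act_scale a b)
  qed (auto simp: U_def R.act_add R.act_scale b)
  obtain t v where v: "v \<in> U" "v \<noteq> 0" "act ?b v = chain_scale (unity_root (Coset.order G) ^ t) v"
    by (rule eigenvector_root_of_unity[OF U R.order_pos _ v0(2)])
      (use v0 R.funpow_order[OF b] in \<open>auto simp: U_def\<close>)
  have vW: "v \<in> W'" "act ?a v = chain_scale (unity_root (Coset.order G) ^ s) v" using v(1) by (auto simp: U_def)
  define Q where "Q i = {y \<in> carrier F. act (\<phi> y) v = chain_scale (unity_root (Coset.order G) powi i) v}" for i
  have Q: "b \<otimes>\<^bsub>F\<^esub> inv\<^bsub>F\<^esub> c \<in> Q (i - j)"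
    if "b \<in> carrier F" "c \<in> carrier F" "b \<in> Q i" "c \<in> Q j" for b c i j
  proof -
    have "act (inv\<^bsub>G\<^esub> \<phi> c) v = chain_scale (inverse (unity_root (Coset.order G) powi j)) v"
      using R.act_inv_scalar[OF _ vW(1)] that by (auto simp: Q_def)
    then show ?thesis
      using that vW(1) by (simp add: Q_def R.act_mult R.act_scale power_int_diff divide_inverse)
  qed
  \<comment> \<open>The basis is split anew, now around the commuting pair \<open>x1\<close>,
    \<open>y'\<close>.\<close>
  define C' where "C' = ({x', y'} \<union> C) - {x1, y'}"
  have x1: "x1 \<in> C" "x1 \<noteq> y'" using x y' by (auto simp: C_def)
  then have "{x1, y'} \<union> C' = {x', y'} \<union> C" by (auto simp: C'_def)
  moreover have "x1 \<in> Q (int s)" "y' \<in> Q (int t)"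
    using vW v x(1) BF y'F by (auto simp: Q_def)
  ultimately obtain x'' y'' where "free_basis F ({x'', y''} \<union> C')" "y'' \<in> Q 0"
    using free_basis_euclid[of F Q x1 y' C' s t, OF F(1) Q] y'(1) x1(2) by (auto simp: C'_def)
  then show ?thesis
    using v vW W'(1) by (intro exI[of _ y''] exI[of _ v]) (auto simp: primitive_def Q_def)
qed

section \<open>Cocycles that vanish on powers of primitive elements\<close>

text \<open>\<open>E f \<gamma>\<close> is the pairing of \<open>f\<close> with the value at \<open>\<gamma>\<close> of a cocycle with values in the dual of \<open>W\<close>.\<close>

locale primitive_cocycle = fin_rep G W act + h: group_hom F G \<phi>
  for F :: "('h, 'k) monoid_scheme" and G :: "('g, 'm) monoid_scheme" (structure)
    and \<phi> and W :: "('i \<Rightarrow> complex) set" and act +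
  fixes E :: "('i \<Rightarrow> complex) \<Rightarrow> 'h \<Rightarrow> complex"
  assumes E_mult: "\<lbrakk>f \<in> W; \<gamma> \<in> carrier F; \<delta> \<in> carrier F\<rbrakk> \<Longrightarrow>
      E f (\<gamma> \<otimes>\<^bsub>F\<^esub> \<delta>) = E f \<gamma> + E (act (\<phi> \<gamma>) f) \<delta>"
    and E_scale: "\<lbrakk>f \<in> W; \<gamma> \<in> carrier F\<rbrakk> \<Longrightarrow> E (chain_scale c f) \<gamma> = c * E f \<gamma>"
    and E_primitive: "\<lbrakk>f \<in> W; primitive F \<gamma>; \<phi> (\<gamma> [^]\<^bsub>F\<^esub> (m::nat)) = \<one>\<rbrakk> \<Longrightarrow> E f (\<gamma> [^]\<^bsub>F\<^esub> m) = 0"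
begin

lemma E_one: "f \<in> W \<Longrightarrow> E f \<one>\<^bsub>F\<^esub> = 0"
  using E_mult[of f "\<one>\<^bsub>F\<^esub>" "\<one>\<^bsub>F\<^esub>"] by (simp add: act_one)

lemma E_inv:
  assumes "f \<in> W" "\<gamma> \<in> carrier F"
  shows "E f (inv\<^bsub>F\<^esub> \<gamma>) = - E (act (inv (\<phi> \<gamma>)) f) \<gamma>"
  using E_mult[of f "inv\<^bsub>F\<^esub> \<gamma>" \<gamma>] assms by (simp add: E_one eq_neg_iff_add_eq_0)

lemma E_pow:
  assumes "f \<in> W" "\<gamma> \<in> carrier F"
  shows "E f (\<gamma> [^]\<^bsub>F\<^esub> (m::nat)) = (\<Sum>j<m. E (act (\<phi> \<gamma> [^] j) f) \<gamma>)"
  using assms by (induction m) (auto simp: E_one E_mult h.hom_nat_pow)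

lemma E_pow_scalar:
  assumes "f \<in> W" "\<gamma> \<in> carrier F" "act (\<phi> \<gamma>) f = chain_scale c f"
  shows "E f (\<gamma> [^]\<^bsub>F\<^esub> (m::nat)) = (\<Sum>j<m. c ^ j) * E f \<gamma>"
  using assms by (simp add: E_pow act_pow_scalar[OF _ assms(1,3)] E_scale sum_distrib_right)

text \<open>Here \<open>\<gamma> [^] q\<close> need only fix \<open>f\<close>, not lie in the kernel
  of \<phi>. Its power by the order of \<open>G\<close> does lie there, and on it the cocycle takes
  the order of \<open>G\<close> times the value in question.\<close>

lemma E_primitive_pow:
  assumes "f \<in> W" "primitive F \<gamma>" "\<gamma> \<in> carrier F" "act (\<phi> \<gamma> [^] q) f = f"
  shows "E f (\<gamma> [^]\<^bsub>F\<^esub> (q::nat)) = 0"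
proof -
  let ?N = "Coset.order G"
  have "\<phi> (\<gamma> [^]\<^bsub>F\<^esub> (q * ?N)) = \<one>"
    using assms(3) by (simp add: h.hom_nat_pow nat_pow_pow[symmetric] pow_order_eq_1)
  then have "E f ((\<gamma> [^]\<^bsub>F\<^esub> q) [^]\<^bsub>F\<^esub> ?N) = 0"
    using E_primitive[OF assms(1,2)] assms(3) by (simp add: h.G.nat_pow_pow)
  moreover have "E f ((\<gamma> [^]\<^bsub>F\<^esub> q) [^]\<^bsub>F\<^esub> ?N) = (\<Sum>j<?N. 1 ^ j) * E f (\<gamma> [^]\<^bsub>F\<^esub> q)"
    by (rule E_pow_scalar) (use assms in \<open>simp_all add: h.hom_nat_pow\<close>)
  ultimately show ?thesis using order_pos by simp
qed

lemma E_primitive_trivial: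
  assumes "f \<in> W" "primitive F \<gamma>" "\<gamma> \<in> carrier F" "act (\<phi> \<gamma>) f = f"
  shows "E f \<gamma> = 0"
  using E_primitive_pow[of f \<gamma> 1] assms by simp

text \<open>The hypothesis ranges over all of \<open>W\<close>, because the cocycle rule changes the
  vector along a word.\<close>

lemma E_eq_0_if_basis:
  assumes "free_basis F B" "\<And>f b. f \<in> W \<Longrightarrow> b \<in> B \<Longrightarrow> E f b = 0" "f \<in> W" "\<gamma> \<in> carrier F"
  shows "E f \<gamma> = 0"
proof -
  have BF: "B \<subseteq> carrier F" using free_basisD(1)[OF assms(1)] .
  have "\<gamma> \<in> generate F B"
    using assms(4) free_basis_generate[OF h.G.group_axioms assms(1)] by simp
  then show ?thesis
    using assms(3)
  proof (induction arbitrary: f)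
    case (inv b)
    then show ?case using assms(2) BF by (auto simp: E_inv act_in subset_iff)
  next
    case (eng a b)
    then have "a \<in> carrier F" "b \<in> carrier F"
      using BF h.G.generate_in_carrier by blast+
    then show ?case using eng by (simp add: E_mult act_in)
  qed (auto simp: E_one assms(2))
qed

text \<open>\<open>E'\<close> differs from \<open>E\<close> by the coboundary of \<open>f \<mapsto> E f z / (c - 1)\<close>.\<close>

lemma normalize:
  assumes z: "z \<in> carrier F" "\<And>f. f \<in> W \<Longrightarrow> act (\<phi> z) f = chain_scale c f" "c \<noteq> 1"
  defines "E' \<equiv> \<lambda>f \<gamma>. E f \<gamma> - (E (act (\<phi> \<gamma>) f) z - E f z) / (c - 1)"
  shows "primitive_cocycle F G \<phi> W act E'"
    and "\<And>f. f \<in> W \<Longrightarrow> E' f z = 0"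
    and "\<And>f \<gamma>. \<lbrakk>f \<in> W; \<phi> \<gamma> = \<one>\<rbrakk> \<Longrightarrow> E' f \<gamma> = E f \<gamma>"
proof -
  have *: "(E (act (\<phi> (\<gamma> \<otimes>\<^bsub>F\<^esub> \<delta>)) f) z - E f z) / (c - 1) =
      (E (act (\<phi> \<gamma>) f) z - E f z) / (c - 1) + (E (act (\<phi> \<delta>) (act (\<phi> \<gamma>) f)) z - E (act (\<phi> \<gamma>) f) z) / (c - 1)"
    if "f \<in> W" "\<gamma> \<in> carrier F" "\<delta> \<in> carrier F" for f \<gamma> \<delta>
    unfolding add_divide_distrib[symmetric] using that by (simp add: act_mult)
  show "primitive_cocycle F G \<phi> W act E'"
  proof unfold_locales
    fix f \<gamma> \<delta> assume 1: "f \<in> W" "\<gamma> \<in> carrier F" "\<delta> \<in> carrier F"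
    then show "E' f (\<gamma> \<otimes>\<^bsub>F\<^esub> \<delta>) = E' f \<gamma> + E' (act (\<phi> \<gamma>) f) \<delta>"
      unfolding E'_def using *[OF 1] E_mult[OF 1] by simp
  next
    fix f d \<gamma> assume "f \<in> W" "\<gamma> \<in> carrier F"
    then show "E' (chain_scale d f) \<gamma> = d * E' f \<gamma>"
      using z(1) by (simp add: E'_def E_scale act_scale act_in algebra_simps diff_divide_distrib)
  next
    fix f \<gamma> and m :: nat assume "f \<in> W" "primitive F \<gamma>" "\<phi> (\<gamma> [^]\<^bsub>F\<^esub> m) = \<one>"
    then show "E' f (\<gamma> [^]\<^bsub>F\<^esub> m) = 0"
      by (simp add: E'_def E_primitive act_one)
  qed
  show "E' f z = 0" if "f \<in> W" for f
    using that z by (simp add: E'_def E_scale divide_simps) (simp add: algebra_simps)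
  show "E' f \<gamma> = E f \<gamma>" if "f \<in> W" "\<phi> \<gamma> = \<one>" for f \<gamma>
    using that by (simp add: E'_def act_one)
qed

lemma subcocycle:
  assumes "W' \<subseteq> W" "fin_rep G W' act"
  shows "primitive_cocycle F G \<phi> W' act E"
proof -
  interpret W': fin_rep G W' act by fact
  show ?thesis
    using assms(1) E_mult E_scale E_primitive by unfold_locales (auto simp: subset_iff)
qed

text \<open>Basis elements other than \<open>z\<close> are primitive and act trivially, so the
  cocycle vanishes there, and also at \<open>z\<close> if \<open>c = 1\<close>. If \<open>c\<close>
  differs from 1, a coboundary removes the value at \<open>z\<close>. It changes nothing on the
  kernel of \<phi>, and the argument for the other elements applies to the new cocycle too.\<close>

lemma vanish_if_scalar_trivial_off:
  assumes B: "free_basis F B" "z \<in> B"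
    and z: "\<And>f. f \<in> W \<Longrightarrow> act (\<phi> z) f = chain_scale c f"
    and triv: "\<And>f x. \<lbrakk>f \<in> W; x \<in> B - {z}\<rbrakk> \<Longrightarrow> act (\<phi> x) f = f"
    and f: "f \<in> W" "\<kappa> \<in> carrier F" "\<phi> \<kappa> = \<one>"
  shows "E f \<kappa> = 0"
proof -
  have BF: "B \<subseteq> carrier F" using free_basisD(1)[OF B(1)] .
  have prim: "primitive F b" if "b \<in> B" for b using that B(1) by (auto simp: primitive_def)
  show ?thesis
  proof (cases "c = 1")
    case True
    then have "E g b = 0" if "g \<in> W" "b \<in> B" for g b
      using E_primitive_trivial[OF that(1) prim[OF that(2)]] that z triv BF by (cases "b = z") auto
    then show ?thesis using E_eq_0_if_basis[OF B(1)] f by blast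
  next
    case False
    have zF: "z \<in> carrier F" using B BF by blast
    define E' where "E' = (\<lambda>f \<gamma>. E f \<gamma> - (E (act (\<phi> \<gamma>) f) z - E f z) / (c - 1))"
    interpret E': primitive_cocycle F G \<phi> W act E'
      unfolding E'_def by (rule normalize[OF zF z False])
    have "E' g b = 0" if "g \<in> W" "b \<in> B" for g b
    proof (cases "b = z")
      case True
      then show ?thesis using normalize(2)[OF zF z False that(1)] by (simp add: E'_def)
    next
      case False
      then show ?thesis
        using E'.E_primitive_trivial[OF that(1) prim[OF that(2)]] that triv BF by auto
    qed
    then have "E' f \<kappa> = 0" using E'.E_eq_0_if_basis[OF B(1)] f by blast
    then show ?thesis using normalize(3)[OF zF z False f(1,3)] by (simp add: E'_def)
  qed
qed

text \<open>If two basis elements acted nontrivially, the Euclidean algorithm on the exponents of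
  their scalars would make one of them trivial. Hence a basis with the fewest nontrivial elements
  has at most one.\<close>

lemma vanish_if_scalars:
  assumes B: "free_basis F B" "finite B" "B \<noteq> {}"
    and sc: "\<And>g. g \<in> carrier G \<Longrightarrow> \<exists>s. \<forall>f \<in> W. act g f = chain_scale (\<epsilon> ^ s) f"
    and f: "f \<in> W" "\<kappa> \<in> carrier F" "\<phi> \<kappa> = \<one>"
  shows "E f \<kappa> = 0"
proof -
  define nt where "nt B = {x \<in> B. \<exists>f \<in> W. act (\<phi> x) f \<noteq> f}" for B
  define P where "P B \<longleftrightarrow> free_basis F B \<and> finite B \<and> B \<noteq> {}" for B
  have "P B" using B by (simp add: P_def)
  then obtain B0 where B0: "P B0" "\<And>C. P C \<Longrightarrow> card (nt B0) \<le> card (nt C)"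
    using ex_has_least_nat[of P B "\<lambda>B. card (nt B)"] by blast
  have B0F: "B0 \<subseteq> carrier F" "free_basis F B0" "finite B0"
    using B0(1) free_basisD(1) by (auto simp: P_def)
  define S where "S i = {y \<in> carrier F. \<forall>f \<in> W. act (\<phi> y) f = chain_scale (\<epsilon> powi i) f}" for i
  have S: "a \<otimes>\<^bsub>F\<^esub> inv\<^bsub>F\<^esub> b \<in> S (i - j)"
    if "a \<in> carrier F" "b \<in> carrier F" "a \<in> S i" "b \<in> S j" for a b i j
  proof -
    have "act (inv (\<phi> b)) f = chain_scale (inverse (\<epsilon> powi j)) f" if "f \<in> W" for f
      using act_inv_scalar[of "\<phi> b" f] \<open>b \<in> S j\<close> that by (auto simp: S_def)
    then show ?thesis
      using that by (simp add: S_def act_mult act_scale act_in power_int_diff divide_inverse)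
  qed
  have "x = y" if xy: "x \<in> nt B0" "y \<in> nt B0" for x y
  proof (rule ccontr)
    assume ne: "x \<noteq> y"
    define C where "C = B0 - {x, y}"
    have xyB: "x \<in> B0" "y \<in> B0" using xy by (auto simp: nt_def)
    then have BC: "{x, y} \<union> C = B0" by (auto simp: C_def)
    have "\<exists>s. x \<in> S (int s)" if "x \<in> B0" for x
      using sc[of "\<phi> x"] that B0F by (auto simp: S_def)
    then obtain s t where st: "x \<in> S (int s)" "y \<in> S (int t)"
      using xyB by metis
    obtain x' y' where new: "free_basis F ({x', y'} \<union> C)" "y' \<in> S 0"
      using free_basis_euclid[of F S x y C s t, OF h.G.group_axioms S] BC B0F(2) ne st by (auto simp: C_def)
    have "nt ({x', y'} \<union> C) \<subseteq> insert x' (nt C)"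
      using new(2) by (auto simp: nt_def S_def)
    moreover have fin: "finite (nt C)" using B0F(3) by (auto simp: nt_def C_def)
    ultimately have "card (nt ({x', y'} \<union> C)) \<le> card (insert x' (nt C))"
      by (intro card_mono) auto
    also have "\<dots> \<le> Suc (card (nt C))" using fin by (simp add: card_insert_if)
    also have "\<dots> < card (nt B0)"
    proof -
      have "nt B0 = insert x (insert y (nt C))" using xy by (auto simp: nt_def C_def)
      moreover have "x \<notin> nt C" "y \<notin> nt C" by (auto simp: nt_def C_def)
      ultimately show ?thesis using ne fin by simp
    qed
    finally have "card (nt ({x', y'} \<union> C)) < card (nt B0)" .
    moreover have "P ({x', y'} \<union> C)" using new B0F(3) by (auto simp: P_def C_def)
    ultimately show False using B0(2) by (meson not_less)
  qed
  \<comment> \<open>If every element of \<open>B0\<close> acts trivially, any of them serves as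
    \<open>z\<close>.\<close>
  then obtain z where z: "z \<in> B0" "nt B0 \<subseteq> {z}"
    using B0(1) by (cases "nt B0 = {}") (auto simp: P_def nt_def, blast)
  obtain s where "\<forall>f \<in> W. act (\<phi> z) f = chain_scale (\<epsilon> ^ s) f"
    using sc[OF h.hom_closed[of z]] z(1) B0F(1) by blast
  then show ?thesis
    using vanish_if_scalar_trivial_off[OF B0F(2) z(1) _ _ f] z(2) by (force simp: nt_def)
qed

text \<open>The elements \<open>x \<otimes> z [^] a\<close> are primitive, and averaging over \<open>a\<close> isolates the value at \<open>x\<close>.\<close>

lemma vanish_at_twistable:
  assumes B: "free_basis F B" "z \<in> B" "x \<in> B" "x \<noteq> z"
    and z: "\<And>f. f \<in> W \<Longrightarrow> act (\<phi> z) f = chain_scale c f" "\<And>f. f \<in> W \<Longrightarrow> E f z = 0"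
    and q: "0 < q" "c ^ q = 1" "\<And>j. 0 < j \<Longrightarrow> j < q \<Longrightarrow> c ^ j \<noteq> 1"
    and x: "\<And>f. f \<in> W \<Longrightarrow> act (\<phi> x [^] q) f = f" and f: "f \<in> W"
  shows "E f x = 0"
proof -
  have BF: "B \<subseteq> carrier F" using free_basisD(1)[OF B(1)] .
  have xF: "x \<in> carrier F" "z \<in> carrier F" using B BF by auto
  define \<gamma> where "\<gamma> a = x \<otimes>\<^bsub>F\<^esub> z [^]\<^bsub>F\<^esub> (a::nat)" for a
  have \<gamma>F: "\<gamma> a \<in> carrier F" for a using xF by (simp add: \<gamma>_def)
  have "z [^]\<^bsub>F\<^esub> a \<in> generate F (B - {x})" for a :: nat
  proof -
    have "B - {x} \<subseteq> carrier F" "z \<in> generate F (B - {x})" using B BF by (auto intro: generate.incl)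
    then show ?thesis
      by (induction a) (auto intro: generate.one generate.eng)
  qed
  then have prim: "primitive F (\<gamma> a)" for a
    using free_basis_replace(1)[OF h.G.group_axioms B(1,3)] by (auto simp: primitive_def \<gamma>_def)
  have zpow: "act (\<phi> z [^] (a::nat)) f = chain_scale (c ^ a) f" if "f \<in> W" for f a
    using act_pow_scalar[OF _ that z(1)[OF that]] xF by simp
  have act1: "act (\<phi> (\<gamma> a)) f = chain_scale (c ^ a) (act (\<phi> x) f)" if "f \<in> W" for f a
    using that xF by (simp add: \<gamma>_def act_mult h.hom_nat_pow zpow act_in)
  have actj: "act (\<phi> (\<gamma> a) [^] (j::nat)) f = chain_scale ((c ^ a) ^ j) (act (\<phi> x [^] j) f)" if "f \<in> W" for f a j
  proof (induction j)
    case (Suc j)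
    then show ?case
      using that xF \<gamma>F by (simp add: act_mult act1 act_in act_scale mult.commute)
  qed (use that in \<open>simp add: act_one\<close>)
  \<comment> \<open>The values at the powers of \<open>z\<close> drop out because the cocycle is
    normalized there, so the twist shows only in the action, as a factor
    \<open>c ^ a\<close>.\<close>
  have E\<gamma>: "E f (\<gamma> a) = E f x" if "f \<in> W" for f a
    using that xF z by (simp add: \<gamma>_def E_mult E_pow_scalar[OF _ _ z(1)] act_in)
  have "(\<Sum>j<q. (c ^ a) ^ j * E (act (\<phi> x [^] j) f) x) = 0" for a
  proof -
    have "act (\<phi> (\<gamma> a) [^] q) f = f"
      using actj[OF f, of a q] x[OF f] q(2) by (simp add: power_commutes flip: power_mult)
        (simp add: mult.commute[of a] power_mult)
    then have "E f (\<gamma> a [^]\<^bsub>F\<^esub> q) = 0"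
      by (rule E_primitive_pow[OF f prim \<gamma>F])
    then show ?thesis
      using f xF by (simp add: E_pow \<gamma>F actj E_scale E\<gamma> act_in)
  qed
  then have "0 = (\<Sum>a<q. \<Sum>j<q. (c ^ a) ^ j * E (act (\<phi> x [^] j) f) x)"
    by simp
  also have "\<dots> = (\<Sum>j<q. (\<Sum>a<q. (c ^ j) ^ a) * E (act (\<phi> x [^] j) f) x)"
    unfolding sum_distrib_right
    by (subst sum.swap) (simp add: mult.commute[of "_ :: nat"] flip: power_mult)
  also have "\<dots> = (\<Sum>j<q. if j = 0 then of_nat q * E f x else 0)"
  proof (rule sum.cong)
    fix j assume j: "j \<in> {..<q}"
    have "(\<Sum>a<q. (c ^ j) ^ a) = 0" if "j \<noteq> 0"
    proof (rule sum_powers_root_of_unity)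
      show "(c ^ j) ^ q = 1" using q(2) by (metis mult.commute power_mult power_one)
      show "c ^ j \<noteq> 1" using q(3)[of j] j that by simp
    qed
    then show "(\<Sum>a<q. (c ^ j) ^ a) * E (act (\<phi> x [^] j) f) x = (if j = 0 then of_nat q * E f x else 0)"
      using f by (simp add: act_one)
  qed simp
  also have "\<dots> = of_nat q * E f x" using q(1) by simp
  finally show ?thesis using q(1) by simp
qed

text \<open>After normalizing at \<open>z\<close>, let \<open>q\<close> be the order of
  \<open>c\<close>, which is \<open>p\<close> or its square. A basis element \<open>b\<close> whose
  \<open>q\<close>-th power acts trivially can be twisted by powers of \<open>z\<close>. Otherwise
  \<open>q\<close> is \<open>p\<close>, and \<open>b [^] p\<close> acts by a nontrivial p-th root of
  unity \<open>\<mu>\<close>. A power of \<open>b [^] p\<close> then cancels the scalar of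
  \<open>z\<close>, which forces the value at \<open>b [^] p\<close> to be 0; commuting
  \<open>b\<close> with its own power settles \<open>b\<close>.\<close>

lemma vanish_if_central_scalar:
  assumes B: "free_basis F B" "z \<in> B" and p: "prime p"
    and z: "\<And>f. f \<in> W \<Longrightarrow> act (\<phi> z) f = chain_scale c f" "c \<noteq> 1" "c ^ (p * p) = 1"
    and x: "\<And>x. x \<in> B - {z} \<Longrightarrow> \<exists>\<mu>. \<mu> ^ p = 1 \<and> (\<forall>f \<in> W. act (\<phi> x [^] p) f = chain_scale \<mu> f)"
    and f: "f \<in> W" "\<kappa> \<in> carrier F" "\<phi> \<kappa> = \<one>"
  shows "E f \<kappa> = 0"
proof -
  have BF: "B \<subseteq> carrier F" using free_basisD(1)[OF B(1)] .
  have zF: "z \<in> carrier F" using B BF by blast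
  define E' where "E' = (\<lambda>f \<gamma>. E f \<gamma> - (E (act (\<phi> \<gamma>) f) z - E f z) / (c - 1))"
  interpret E': primitive_cocycle F G \<phi> W act E'
    unfolding E'_def by (rule normalize[OF zF z(1,2)])
  have E'z: "E' g z = 0" if "g \<in> W" for g
    using normalize(2)[OF zF z(1,2) that] by (simp add: E'_def)
  \<comment> \<open>The exact order of \<open>c\<close>. It divides the square of \<open>p\<close>
    and is not 1, so it is \<open>p\<close> or that square.\<close>
  define q where "q = (LEAST q. 0 < q \<and> c ^ q = 1)"
  have p0: "0 < p" using p prime_gt_0_nat by blast
  have q: "0 < q" "c ^ q = 1"
    unfolding q_def using LeastI[of "\<lambda>q. 0 < q \<and> c ^ q = 1" "p * p"] z(3) p0 by auto
  have qmin: "c ^ j \<noteq> 1" if "0 < j" "j < q" for j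
    using not_less_Least[of j "\<lambda>q. 0 < q \<and> c ^ q = 1"] that by (auto simp: q_def)
  have "c ^ (p * p) = (c ^ q) ^ (p * p div q) * c ^ (p * p mod q)"
    by (simp flip: power_mult power_add)
  then have "c ^ (p * p mod q) = 1" using z(3) q by simp
  then have "q dvd p ^ 2"
    using qmin[of "p * p mod q"] q(1) by (auto simp: power2_eq_square dvd_eq_mod_eq_0)
  then obtain i where i: "i \<le> 2" "q = p ^ i"
    using divides_primepow_nat[OF p] by blast
  have "i \<noteq> 0" using i q z(2) by (cases i) auto
  then have i12: "i = 1 \<or> i = 2" using i(1) by auto
  have "E' g b = 0" if g: "g \<in> W" and b: "b \<in> B" for g b
  proof (cases "b = z")
    case True
    then show ?thesis using E'z g by simp
  next
    case False
    then obtain \<mu> where \<mu>: "\<mu> ^ p = 1" "\<And>f. f \<in> W \<Longrightarrow> act (\<phi> b [^] p) f = chain_scale \<mu> f"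
      using x b by blast
    have bF: "b \<in> carrier F" using b BF by blast
    show ?thesis
    \<comment> \<open>In both alternatives the \<open>q\<close>-th power of \<open>b\<close> acts
      trivially, since \<open>\<mu> ^ p = 1\<close> covers \<open>i = 2\<close>.\<close>
    proof (cases "i = 2 \<or> \<mu> = 1")
      case True
      have "act (\<phi> b [^] q) f = f" if "f \<in> W" for f
      proof -
        have "act ((\<phi> b [^] p) [^] (p ^ (i - 1))) f = chain_scale (\<mu> ^ (p ^ (i - 1))) f"
          using act_pow_scalar[OF _ that \<mu>(2)[OF that]] bF by simp
        moreover have "\<mu> ^ (p ^ (i - 1)) = 1" using True i12 \<mu>(1) by auto
        moreover have "p * p ^ (i - 1) = q" using i i12 by (auto simp: power2_eq_square)
        ultimately show ?thesis using bF by (simp add: nat_pow_pow)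
      qed
      then show ?thesis
        using E'.vanish_at_twistable[OF B b False z(1) E'z q qmin _ g] by blast
    next
      case False
      then have "c ^ p = 1" "\<mu> \<noteq> 1" using i12 i q by auto
      then obtain a where a: "c * \<mu> ^ a = 1"
        using prime_root_of_unity_power[OF p \<mu>(1)] by blast
      \<comment> \<open>Here \<open>z \<otimes> w [^] a\<close> is primitive and acts trivially.\<close>
      define w where "w = b [^]\<^bsub>F\<^esub> p"
      have wF: "w \<in> carrier F" "\<phi> w = \<phi> b [^] p" using bF by (simp_all add: w_def h.hom_nat_pow)
      have bg: "b [^]\<^bsub>F\<^esub> k \<in> generate F (B - {z})" for k :: nat
      proof -
        have "b \<in> generate F (B - {z})" using b \<open>b \<noteq> z\<close> by (auto intro: generate.incl)
        then show ?thesis by (induction k) (auto intro: generate.one generate.eng)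
      qed
      have "w [^]\<^bsub>F\<^esub> a = b [^]\<^bsub>F\<^esub> (p * a)" using bF by (simp add: w_def h.G.nat_pow_pow)
      then have prim: "primitive F (z \<otimes>\<^bsub>F\<^esub> w [^]\<^bsub>F\<^esub> a)"
        using free_basis_replace(1)[OF h.G.group_axioms B bg] by (auto simp: primitive_def)
      have "E' f w = 0" if f: "f \<in> W" for f
      proof -
        have wa: "act (\<phi> w [^] a) f = chain_scale (\<mu> ^ a) f" if "f \<in> W" for f
          using act_pow_scalar[OF _ that, of "\<phi> w" \<mu> a] \<mu>(2)[OF that] wF bF by simp
        have "act (\<phi> (z \<otimes>\<^bsub>F\<^esub> w [^]\<^bsub>F\<^esub> a)) f = f"
          using f zF wF(1) a by (simp add: act_mult act_scale h.hom_nat_pow wa z(1))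
        then have "E' f (z \<otimes>\<^bsub>F\<^esub> w [^]\<^bsub>F\<^esub> a) = 0"
          using E'.E_primitive_trivial[OF f prim] zF wF by simp
        then have "c * E' f (w [^]\<^bsub>F\<^esub> a) = 0"
          using f zF wF E'z z(1) by (simp add: E'.E_mult E'.E_scale)
        then have "(\<Sum>j<a. \<mu> ^ j) * E' f w = 0"
          using E'.E_pow_scalar[OF f wF(1), of \<mu> a] \<mu>(2)[OF f] wF a by auto
        \<comment> \<open>The product telescopes to \<open>\<mu> ^ a - 1\<close>, and
          \<open>\<mu> ^ a\<close> is the inverse of \<open>c\<close>, hence not 1.\<close>
        moreover have "(\<mu> - 1) * (\<Sum>j<a. \<mu> ^ j) \<noteq> 0"
        proof -
          have "\<mu> ^ a \<noteq> 1" using a z(2) by auto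
          then show ?thesis using power_diff_1_eq[of \<mu> a] by (metis right_minus_eq)
        qed
        ultimately show ?thesis by auto
      qed note w0 = this
      \<comment> \<open>As a power of \<open>b\<close>, \<open>w\<close> commutes with
        \<open>b\<close>. The cocycle rule gives \<open>\<mu>\<close> times the value at
        \<open>b\<close> for one order and the value itself for the other.\<close>
      have "E' g (w \<otimes>\<^bsub>F\<^esub> b) = E' g (b \<otimes>\<^bsub>F\<^esub> w)"
        unfolding w_def using bF by (metis h.G.nat_pow_Suc h.G.nat_pow_Suc2)
      moreover have "E' g (w \<otimes>\<^bsub>F\<^esub> b) = \<mu> * E' g b"
        using g bF wF w0 \<mu>(2) by (simp add: E'.E_mult E'.E_scale)
      moreover have "E' g (b \<otimes>\<^bsub>F\<^esub> w) = E' g b"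
        using g bF wF w0 by (simp add: E'.E_mult act_in)
      ultimately show ?thesis using \<open>\<mu> \<noteq> 1\<close> by simp
    qed
  qed
  then have "E' f \<kappa> = 0" using E'.E_eq_0_if_basis[OF B(1)] f by blast
  then show ?thesis using normalize(3)[OF zF z(1,2) f(1,3)] by (simp add: E'_def)
qed

end

section \<open>Alternating forms with values in roots of unity\<close>

lemma (in group) bimultiplicative_pow_left:
  fixes \<beta> :: "'a \<Rightarrow> 'a \<Rightarrow> complex"
  assumes "\<And>a b c. \<lbrakk>a \<in> carrier G; b \<in> carrier G; c \<in> carrier G\<rbrakk> \<Longrightarrow> \<beta> (a \<otimes> b) c = \<beta> a c * \<beta> b c"
    and "\<beta> \<one> y = 1" "x \<in> carrier G" "y \<in> carrier G"
  shows "\<beta> (x [^] (k::nat)) y = \<beta> x y ^ k"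
  by (induction k) (use assms in simp_all)

text \<open>Symplectic Gram-Schmidt: a hyperbolic pair is split off until all remaining basis elements pair
  trivially with each other. An odd number of them does not run out.\<close>

lemma radical_basis_element:
  fixes \<beta> :: "'h \<Rightarrow> 'h \<Rightarrow> complex"
  assumes F: "group F" and p: "prime p"
    and left: "\<And>a b c. \<lbrakk>a \<in> carrier F; b \<in> carrier F; c \<in> carrier F\<rbrakk> \<Longrightarrow> \<beta> (a \<otimes>\<^bsub>F\<^esub> b) c = \<beta> a c * \<beta> b c"
    and right: "\<And>a b c. \<lbrakk>a \<in> carrier F; b \<in> carrier F; c \<in> carrier F\<rbrakk> \<Longrightarrow> \<beta> a (b \<otimes>\<^bsub>F\<^esub> c) = \<beta> a b * \<beta> a c"
    and alt: "\<And>a. a \<in> carrier F \<Longrightarrow> \<beta> a a = 1"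
    and \<beta>p: "\<And>a b. \<lbrakk>a \<in> carrier F; b \<in> carrier F\<rbrakk> \<Longrightarrow> \<beta> a b ^ p = 1"
    and B: "free_basis F B" "odd (card B)"
  shows "\<exists>B' z. free_basis F B' \<and> z \<in> B' \<and> (\<forall>y \<in> B'. \<beta> z y = 1)"
proof -
  interpret group F by fact
  have p0: "0 < p" using p prime_gt_0_nat by blast
  have nz: "\<beta> a b \<noteq> 0" if "a \<in> carrier F" "b \<in> carrier F" for a b
    using \<beta>p[OF that] p0 by (metis power_0_left less_irrefl zero_neq_one)
  have one: "\<beta> \<one>\<^bsub>F\<^esub> c = 1" if "c \<in> carrier F" for c
    using left[of "\<one>\<^bsub>F\<^esub>" "\<one>\<^bsub>F\<^esub>" c] nz[of "\<one>\<^bsub>F\<^esub>" c] that by simp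
  have skew: "\<beta> a b * \<beta> b a = 1" if "a \<in> carrier F" "b \<in> carrier F" for a b
  proof -
    have "\<beta> (a \<otimes>\<^bsub>F\<^esub> b) (a \<otimes>\<^bsub>F\<^esub> b) = \<beta> a a * \<beta> b a * (\<beta> a b * \<beta> b b)"
      using that by (simp add: left right)
    then show ?thesis using alt that by (simp add: mult.commute)
  qed
  have pow: "\<beta> (a [^]\<^bsub>F\<^esub> (k::nat)) b = \<beta> a b ^ k" if "a \<in> carrier F" "b \<in> carrier F" for a b k
    using bimultiplicative_pow_left[of \<beta> b a k] left one that by blast
  \<comment> \<open>Generalized for the induction: \<open>C\<close> is what remains after some
    hyperbolic pairs have been split off, and it pairs trivially with everything split off so far.
    Each further pair lowers its size by two, so it stays odd and never becomes empty.\<close>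
  have "\<exists>B' z. free_basis F B' \<and> z \<in> B' \<and> (\<forall>y \<in> B'. \<beta> z y = 1)"
    if "free_basis F B" "C \<subseteq> B" "odd (card C)" "\<forall>c \<in> C. \<forall>d \<in> B - C. \<beta> c d = 1" for B C
    using that
  proof (induction "card C" arbitrary: B C rule: less_induct)
    case less
    have BF: "B \<subseteq> carrier F" using free_basisD(1)[OF less.prems(1)] .
    have finC: "finite C" "C \<noteq> {}" using less.prems(3) by (auto intro: card_ge_0_finite simp: odd_pos)
    show ?case
    proof (cases "\<forall>c \<in> C. \<forall>d \<in> C. \<beta> c d = 1")
      case True
      then show ?thesis
        using finC(2) less.prems by (metis DiffI all_not_in_conv subsetD)
    next
      case False
      then obtain x y where xy: "x \<in> C" "y \<in> C" "\<beta> x y \<noteq> 1" by blast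
      have xyF: "x \<in> carrier F" "y \<in> carrier F" using xy less.prems(2) BF by auto
      have "x \<noteq> y" using xy(3) alt xyF by auto
      have yx: "\<beta> y x \<noteq> 1" using skew[OF xyF] xy(3) by auto
      define D where "D = C - {x, y}"
      have DB: "D \<subseteq> B" using less.prems(2) by (auto simp: D_def)
      \<comment> \<open>Primality of \<open>p\<close> is essential: \<open>\<beta> x y\<close> and
        \<open>\<beta> y x\<close> generate the p-th roots of unity, so suitable powers cancel the
        pairings of \<open>t\<close> with \<open>y\<close> and with \<open>x\<close>.\<close>
      have "\<exists>a b. \<beta> t y * \<beta> x y ^ a = 1 \<and> \<beta> t x * \<beta> y x ^ b = 1" if "t \<in> carrier F" for t
        using prime_root_of_unity_power[OF p \<beta>p[OF xyF] xy(3) \<beta>p[OF that xyF(2)]]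
          prime_root_of_unity_power[OF p \<beta>p[OF xyF(2,1)] yx \<beta>p[OF that xyF(1)]] by metis
      then obtain a b :: "'h \<Rightarrow> nat" where ab:
        "\<And>t. t \<in> carrier F \<Longrightarrow> \<beta> t y * \<beta> x y ^ a t = 1 \<and> \<beta> t x * \<beta> y x ^ b t = 1" by metis
      \<comment> \<open>Multiplying \<open>t\<close> by \<open>w t\<close> makes it orthogonal to
        both \<open>x\<close> and \<open>y\<close>. The exponents do not interfere, as
        \<open>x\<close> and \<open>y\<close> pair trivially with themselves.\<close>
      define w where "w t = x [^]\<^bsub>F\<^esub> a t \<otimes>\<^bsub>F\<^esub> y [^]\<^bsub>F\<^esub> b t" for t
      define \<tau> where "\<tau> = (\<lambda>t. if t \<in> D then t \<otimes>\<^bsub>F\<^esub> w t else t)"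
      have powg: "u [^]\<^bsub>F\<^esub> (k::nat) \<in> generate F (B - D)" if "u \<in> B - D" for u k
        by (induction k) (use that in \<open>auto intro: generate.intros\<close>)
      have "w t \<in> generate F (B - D)" for t
        unfolding w_def using powg xy less.prems(2) by (intro generate.eng) (auto simp: D_def)
      then have \<tau>: "free_basis F (\<tau> ` B)" "inj_on \<tau> B"
        unfolding \<tau>_def using free_basis_transvection[OF F less.prems(1) DB] by blast+
      have \<beta>\<tau>: "\<beta> (t \<otimes>\<^bsub>F\<^esub> w t) d = \<beta> t d * (\<beta> x d ^ a t * \<beta> y d ^ b t)"
        if "t \<in> carrier F" "d \<in> carrier F" for t d
        using that xyF by (simp add: w_def left pow)
      have diff: "\<tau> ` B - \<tau> ` D = \<tau> ` (B - D)"
        using \<tau>(2) DB by (simp add: inj_on_image_set_diff)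
      have "\<tau> ` (B - D) = B - D" by (auto simp: \<tau>_def)
      have "\<beta> c d = 1" if cd: "c \<in> \<tau> ` D" "d \<in> \<tau> ` B - \<tau> ` D" for c d
      proof -
        obtain t where t: "t \<in> D" "c = t \<otimes>\<^bsub>F\<^esub> w t"          using cd(1) by (auto simp: \<tau>_def)
        have tF: "t \<in> carrier F" "t \<in> C" using t(1) DB BF by (auto simp: D_def)
        have d: "d \<in> B - D" using that(2) diff \<open>\<tau> ` (B - D) = B - D\<close> by simp
        then have dF: "d \<in> carrier F" using BF by blast
        consider "d = x" | "d = y" | "d \<in> B - C" using d by (auto simp: D_def)
        then show ?thesis
        proof cases
          case 1
          then show ?thesis using \<beta>\<tau>[OF tF(1) dF] ab[OF tF(1)] alt[OF xyF(1)] t(2) by simp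
        next
          case 2
          then show ?thesis using \<beta>\<tau>[OF tF(1) dF] ab[OF tF(1)] alt[OF xyF(2)] t(2) by simp
        next
          case 3
          then show ?thesis using \<beta>\<tau>[OF tF(1) dF] less.prems(4) xy(1,2) tF(2) t(2) by simp
        qed
      qed
      moreover have "card (\<tau> ` D) = card D"
        using \<tau>(2) DB by (meson card_image inj_on_subset)
      moreover have "card C = card D + 2"
      proof -
        have "C = insert x (insert y D)" "x \<notin> insert y D" "y \<notin> D"
          using xy \<open>x \<noteq> y\<close> by (auto simp: D_def)
        then show ?thesis using finC(1) by (metis add_2_eq_Suc' card_insert_disjoint finite_insert)
      qed
      ultimately show ?thesis
        using less.hyps[of "\<tau> ` D" "\<tau> ` B"] \<tau>(1) image_mono[OF DB, of \<tau>] less.prems(3) by auto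
    qed
  qed
  from this[of B B] B show ?thesis by auto
qed

text \<open>Conjugation is an automorphism. This makes the homomorphisms that kill powers of
  primitive elements stable under the action of \<open>G\<close>.\<close>

lemma primitive_conj:
  assumes "group F" "primitive F \<gamma>" "a \<in> carrier F"
  shows "primitive F (a \<otimes>\<^bsub>F\<^esub> \<gamma> \<otimes>\<^bsub>F\<^esub> inv\<^bsub>F\<^esub> a)"
proof -
  interpret group F by fact
  obtain B where B: "free_basis F B" "\<gamma> \<in> B" using assms(2) by (auto simp: primitive_def)
  let ?\<theta> = "\<lambda>g. a \<otimes>\<^bsub>F\<^esub> g \<otimes>\<^bsub>F\<^esub> inv\<^bsub>F\<^esub> a"
  have 1: "inv\<^bsub>F\<^esub> a \<otimes>\<^bsub>F\<^esub> (a \<otimes>\<^bsub>F\<^esub> g) = g" "a \<otimes>\<^bsub>F\<^esub> (inv\<^bsub>F\<^esub> a \<otimes>\<^bsub>F\<^esub> g) = g" if "g \<in> carrier F" for g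
    using assms(3) that by (simp_all flip: m_assoc)
  have "?\<theta> \<in> hom F F"
    using assms(3) by (intro homI) (simp_all add: m_assoc 1)
  moreover have "bij_betw ?\<theta> (carrier F) (carrier F)"
    by (rule bij_betw_byWitness[where f' = "\<lambda>g. inv\<^bsub>F\<^esub> a \<otimes>\<^bsub>F\<^esub> g \<otimes>\<^bsub>F\<^esub> a"])
      (use assms(3) in \<open>auto simp: m_assoc 1\<close>)
  ultimately have "free_basis F (?\<theta> ` B)"
    by (rule free_basis_image[OF assms(1) B(1)])
  then show ?thesis using B(2) by (auto simp: primitive_def)
qed

lemma (in group) pow_conj:
  assumes [simp]: "a \<in> carrier G" "g \<in> carrier G"
  shows "(a \<otimes> g \<otimes> inv a) [^] (k::nat) = a \<otimes> g [^] k \<otimes> inv a"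
proof (induction k)
  case (Suc k)
  have "inv a \<otimes> (a \<otimes> (g \<otimes> inv a)) = g \<otimes> inv a"
    by (simp flip: m_assoc)
  then show ?case using Suc by (simp add: m_assoc)
qed simp

lemma (in group) multiplicative_on_generate:
  fixes \<chi> :: "'a \<Rightarrow> complex"
  assumes "\<And>a b. \<lbrakk>a \<in> carrier G; b \<in> carrier G\<rbrakk> \<Longrightarrow> \<chi> (a \<otimes> b) = \<chi> a * \<chi> b"
    and "\<chi> \<one> = 1" "A \<subseteq> carrier G" "\<And>a. a \<in> A \<Longrightarrow> \<chi> a = 1" "g \<in> generate G A"
  shows "\<chi> g = 1"
  using assms(5)
proof induction
  case (inv h)
  then have "h \<in> carrier G" using assms(3) by blast
  then show ?case using assms(1)[of "inv h" h] assms(2) assms(4)[OF inv] by simp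
next
  case (eng a b)
  then show ?case using assms(1,3) generate_in_carrier by simp
qed (use assms in auto)

section \<open>Vanishing of primitive cocycles for groups of class two\<close>

context primitive_cocycle
begin

text \<open>Asking for a single nonzero \<open>f\<close> leaves the freedom to restrict: first to a
  joint eigenspace of the center, then to one of all of \<open>G\<close> if commutators act
  trivially there, and otherwise to an eigenspace of a basis element in the radical of the
  commutator form.\<close>

lemma class2_vanish:
  assumes class2: "class2_group G" and B: "free_basis F B" "finite B" "B \<noteq> {}" and surj: "\<phi> ` carrier F = carrier G"
    and odd: "\<not> comm_group G \<Longrightarrow> odd (card B) \<and> (\<exists>p::nat. prime p \<and> (\<forall>z \<in> center G. z [^] p = \<one>))"
    and W: "W \<noteq> {0}"
  shows "\<exists>f \<in> W. f \<noteq> 0 \<and> (\<forall>\<kappa> \<in> carrier F. \<phi> \<kappa> = \<one> \<longrightarrow> E f \<kappa> = 0)"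
proof -
  interpret class2_group G by fact
  have cG: "center G \<subseteq> carrier G" by (auto simp: center_def)
  have "finite (center G)" using finite_subset[OF cG finite_carrier] .
  moreover have "act (c \<otimes> g) f = act (g \<otimes> c) f" if "c \<in> center G" "g \<in> carrier G" for c g f
    using centerD[OF that] by simp
  ultimately obtain W' where W': "W' \<subseteq> W" "fin_rep G W' act" "W' \<noteq> {0}"
    "\<forall>c \<in> center G. \<exists>s. \<forall>f \<in> W'. act c f = chain_scale (\<epsilon> ^ s) f"
    using joint_eigenspace_subrep[OF _ cG _ W] by blast
  interpret W': fin_rep G W' act by fact
  interpret C': primitive_cocycle F G \<phi> W' act E
    by (rule subcocycle[OF W'(1,2)])
  have nonzero: "\<exists>f \<in> V. f \<noteq> 0" if "fin_rep G V act" "V \<noteq> {0}" for V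
    using that chains.subspace_0[OF fin_rep.subspace[OF that(1)]] by auto
  obtain f0 where f0: "f0 \<in> W'" "f0 \<noteq> 0" using nonzero[OF W'(2,3)] by blast
  obtain e where e: "\<forall>c \<in> center G. \<forall>f \<in> W'. act c f = chain_scale (\<epsilon> ^ e c) f"
    using bchoice[OF W'(4)] by blast
  \<comment> \<open>The central character on \<open>W'\<close>. A fixed nonzero vector
    \<open>f0\<close> determines its values, which yields multiplicativity.\<close>
  define sc where "sc c = \<epsilon> ^ e c" for c
  have sc: "act c f = chain_scale (sc c) f" if "c \<in> center G" "f \<in> W'" for c f
    using e that by (simp add: sc_def)
  have sc_unique: "sc c = d" if "c \<in> center G" "act c f0 = chain_scale d f0" for c d
    using sc[OF that(1) f0(1)] that(2) f0(2) by simp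
  have sc_mult: "sc (c \<otimes> d) = sc c * sc d" if "c \<in> center G" "d \<in> center G" "c \<otimes> d \<in> center G" for c d
  proof (rule sc_unique[OF that(3)])
    have "c \<in> carrier G" "d \<in> carrier G" using that cG by auto
    then have "act (c \<otimes> d) f0 = act d (act c f0)"
      using f0(1) by (rule W'.act_mult)
    then show "act (c \<otimes> d) f0 = chain_scale (sc c * sc d) f0"
      using that \<open>d \<in> carrier G\<close> f0(1) by (simp add: sc W'.act_scale)
  qed
  have center_pow: "c [^] (k::nat) \<in> center G" if "c \<in> center G" for c k
  proof (induction k)
    case (Suc k)
    have "c \<in> carrier G" using \<open>c \<in> center G\<close> cG by blast
    have "c [^] k \<otimes> c \<otimes> g = g \<otimes> (c [^] k \<otimes> c)" if g: "g \<in> carrier G" for g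
    proof -
      have "c [^] k \<otimes> c \<otimes> g = c [^] k \<otimes> g \<otimes> c"
        using \<open>c \<in> carrier G\<close> g centerD[OF \<open>c \<in> center G\<close> g] by (simp add: m_assoc)
      then show ?thesis
        using \<open>c \<in> carrier G\<close> g centerD[OF Suc g] by (simp add: m_assoc)
    qed
    then show ?case using centerI[of "c [^] Suc k"] \<open>c \<in> carrier G\<close> by simp
  qed (simp add: center_def)
  have sc_one: "sc \<one> = 1"
    using f0(1) by (intro sc_unique) (auto simp: center_def W'.act_one)
  have sc_pow: "sc (c [^] (k::nat)) = sc c ^ k" if "c \<in> center G" for c k
  proof (induction k)
    case (Suc k)
    then show ?case
      using sc_mult[OF center_pow[OF that] that] center_pow[OF that, of "Suc k"] by simp
  qed (simp add: sc_one)
  show ?thesis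
  proof (cases "\<forall>a \<in> carrier G. \<forall>b \<in> carrier G. sc (commutator G a b) = 1")
    case True
    have "act (a \<otimes> b) f = act (b \<otimes> a) f" if "a \<in> carrier G" "b \<in> carrier G" "f \<in> W'" for a b f
    proof -
      have "act (commutator G a b) f = f"
        using True that sc[OF commutator_central] by simp
      then show ?thesis
        using that unfolding commutator_swap[OF that(1,2)] by (subst W'.act_mult) auto
    qed
    then obtain V where V: "V \<subseteq> W'" "fin_rep G V act" "V \<noteq> {0}"
      "\<forall>c \<in> carrier G. \<exists>s. \<forall>f \<in> V. act c f = chain_scale (\<epsilon> ^ s) f"
      using W'.joint_eigenspace_subrep[OF finite_carrier subset_refl _ W'(3)] by blast
    interpret V: primitive_cocycle F G \<phi> V act E
      by (rule C'.subcocycle[OF V(1,2)])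
    obtain f where f: "f \<in> V" "f \<noteq> 0" using nonzero[OF V(2,3)] by blast
    have "E f \<kappa> = 0" if "\<kappa> \<in> carrier F" "\<phi> \<kappa> = \<one>" for \<kappa>
      using V.vanish_if_scalars[OF B _ f(1) that] V(4) by blast
    then show ?thesis using f V(1) W'(1) by blast
  next
    case False
    then obtain a0 b0 where ab0: "a0 \<in> carrier G" "b0 \<in> carrier G" "sc (commutator G a0 b0) \<noteq> 1" by blast
    \<comment> \<open>A nontrivial scalar of a commutator rules out the abelian case and so releases
      the assumptions on the rank and on the center.\<close>
    have "\<not> comm_group G"
    proof
      assume "comm_group G"
      then have "a0 \<otimes> b0 = b0 \<otimes> a0"
        using comm_monoid.m_comm[OF comm_group.axioms(1) ab0(1,2)] by simp
      then have "commutator G a0 b0 = b0 \<otimes> a0 \<otimes> inv a0 \<otimes> inv b0"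
        by (simp add: commutator_def)
      also have "\<dots> = \<one>" using ab0 by (simp add: m_assoc)
      finally have "commutator G a0 b0 = \<one>" .
      then show False using ab0(3) sc_one by simp
    qed
    then obtain p :: nat where p: "odd (card B)" "prime p" "\<And>z. z \<in> center G \<Longrightarrow> z [^] p = \<one>"
      using odd by blast
    have sc_p: "sc c ^ p = 1" if "c \<in> center G" for c
      using sc_pow[OF that, of p] p(3)[OF that] sc_one by simp
    \<comment> \<open>The commutator form, pulled back to \<open>F\<close>. The exponent
      \<open>p\<close> of the center makes its values p-th roots of unity.\<close>
    define \<beta> where "\<beta> a b = sc (commutator G (\<phi> a) (\<phi> b))" for a b
    have \<beta>_left: "\<beta> (a \<otimes>\<^bsub>F\<^esub> b) c = \<beta> a c * \<beta> b c" if "a \<in> carrier F" "b \<in> carrier F" "c \<in> carrier F" for a b c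
    proof -
      have "commutator G (\<phi> a) (\<phi> c) \<in> center G" "commutator G (\<phi> b) (\<phi> c) \<in> center G"
        "commutator G (\<phi> a \<otimes> \<phi> b) (\<phi> c) \<in> center G"
        using that by (simp_all add: commutator_central)
      then show ?thesis
        using that sc_mult by (simp add: \<beta>_def commutator_mult_left)
    qed
    have \<beta>_right: "\<beta> a (b \<otimes>\<^bsub>F\<^esub> c) = \<beta> a b * \<beta> a c" if "a \<in> carrier F" "b \<in> carrier F" "c \<in> carrier F" for a b c
    proof -
      have "commutator G (\<phi> a) (\<phi> b) \<in> center G" "commutator G (\<phi> a) (\<phi> c) \<in> center G"
        "commutator G (\<phi> a) (\<phi> b \<otimes> \<phi> c) \<in> center G"
        using that by (simp_all add: commutator_central)
      then show ?thesis
        using that sc_mult by (simp add: \<beta>_def commutator_mult_right)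
    qed
    have \<beta>_alt: "\<beta> a a = 1" if "a \<in> carrier F" for a
      unfolding \<beta>_def using that by (simp add: commutator_self sc_one)
    have \<beta>_p: "\<beta> a b ^ p = 1" if "a \<in> carrier F" "b \<in> carrier F" for a b
      unfolding \<beta>_def using that commutator_central by (simp add: sc_p)
    have \<beta>_one: "\<beta> \<one>\<^bsub>F\<^esub> b = 1" "\<beta> b \<one>\<^bsub>F\<^esub> = 1" if "b \<in> carrier F" for b
      unfolding \<beta>_def using that by (simp_all add: commutator_def sc_one)
    obtain B' z where B': "free_basis F B'" "z \<in> B'" "\<forall>y \<in> B'. \<beta> z y = 1"
      using radical_basis_element[of F p \<beta> B, OF h.G.group_axioms p(2) \<beta>_left \<beta>_right \<beta>_alt \<beta>_p B(1) p(1)]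
      by auto
    have B'F: "B' \<subseteq> carrier F" using free_basisD(1)[OF B'(1)] .
    have gen: "generate F B' = carrier F" using free_basis_generate[OF h.G.group_axioms B'(1)] .
    have zF: "z \<in> carrier F" using B' B'F by blast
    have \<beta>_if_basis: "\<beta> a b = 1" if "a \<in> carrier F" "b \<in> carrier F" "\<And>y. y \<in> B' \<Longrightarrow> \<beta> a y = 1" for a b
      by (rule h.G.multiplicative_on_generate[of "\<beta> a" B' b])
        (use \<beta>_right[OF that(1)] \<beta>_one(2)[OF that(1)] B'F that gen in auto)
    have \<beta>z: "\<beta> z b = 1" if "b \<in> carrier F" for b
      using \<beta>_if_basis[OF zF that] B'(3) by blast
    have \<beta>_swap: "\<beta> a z = 1" if "a \<in> carrier F" for a
    proof -
      have "\<beta> (a \<otimes>\<^bsub>F\<^esub> z) (a \<otimes>\<^bsub>F\<^esub> z) = 1" using that zF by (intro \<beta>_alt) simp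
      moreover have "\<beta> (a \<otimes>\<^bsub>F\<^esub> z) (a \<otimes>\<^bsub>F\<^esub> z) = \<beta> a a * \<beta> z a * (\<beta> a z * \<beta> z z)"
        using that zF by (simp add: \<beta>_left \<beta>_right)
      ultimately show ?thesis
        using that zF \<beta>_alt \<beta>z by simp
    qed
    \<comment> \<open>Otherwise the form would be trivial on a basis, \<open>z\<close> being in the
      radical, and hence on all of \<open>F\<close>; but it is nontrivial at preimages of
      \<open>a0\<close> and \<open>b0\<close>.\<close>
    have "\<exists>x \<in> B' - {z}. \<exists>y \<in> B' - {z}. \<beta> x y \<noteq> 1"
    proof (rule ccontr)
      assume neg: "\<not> ?thesis"
      have all: "\<beta> x y = 1" if "x \<in> B'" "y \<in> B'" for x y
        using that neg \<beta>z \<beta>_swap B'F by (cases "x = z"; cases "y = z") auto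
      obtain a b where ab: "a \<in> carrier F" "b \<in> carrier F" "\<phi> a = a0" "\<phi> b = b0"
        using ab0 surj by (metis image_iff)
      have "\<beta> x b = 1" if "x \<in> B'" for x
        using \<beta>_if_basis[of x b] all that B'F ab by blast
      then have "\<beta> a b = 1"
        by (intro h.G.multiplicative_on_generate[of "\<lambda>a. \<beta> a b" B' a])
          (use \<beta>_left[OF _ _ ab(2)] \<beta>_one(1)[OF ab(2)] B'F ab gen in auto)
      then show False using ab0(3) ab by (simp add: \<beta>_def)
    qed
    then obtain x y where xy: "x \<in> B' - {z}" "y \<in> B' - {z}" "\<beta> x y \<noteq> 1" by blast
    have xyF: "x \<in> carrier F" "y \<in> carrier F" using xy B'F by auto
    \<comment> \<open>Being in the radical, \<open>z\<close> acts centrally on \<open>W'\<close>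
      although \<open>\<phi> z\<close> need not be central in \<open>G\<close>; its eigenspaces are
      therefore subrepresentations.\<close>
    have comm_z: "act (\<phi> z \<otimes> g) f = act (g \<otimes> \<phi> z) f" if gf: "g \<in> carrier G" "f \<in> W'" for g f
    proof -
      obtain b where b: "b \<in> carrier F" "\<phi> b = g" using gf(1) surj by (metis image_iff)
      have "sc (commutator G (\<phi> z) g) = 1" using \<beta>z[OF b(1)] b(2) by (simp add: \<beta>_def)
      then have "act (commutator G (\<phi> z) g) f = f"
        using sc[OF commutator_central[OF _ gf(1)] gf(2)] zF by simp
      then show ?thesis
        using gf zF by (subst commutator_swap, simp, simp) (subst W'.act_mult, auto)
    qed
    have "\<phi> z \<in> carrier G" using zF by simp
    then obtain s V where V: "V \<subseteq> W'" "fin_rep G V act" "V \<noteq> {0}"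
      "\<forall>f \<in> V. act (\<phi> z) f = chain_scale (\<epsilon> ^ s) f"
      using W'.eigenspace_subrep[OF _ comm_z W'(3)] by blast
    interpret V: primitive_cocycle F G \<phi> V act E
      by (rule C'.subcocycle[OF V(1,2)])
    obtain f where f: "f \<in> V" "f \<noteq> 0" using nonzero[OF V(2,3)] by blast
    \<comment> \<open>Commutators with a p-th power are p-th powers of central elements, hence
      trivial.\<close>
    have pow_central: "a [^] p \<in> center G" if "a \<in> carrier G" for a
    proof -
      have "a [^] p \<otimes> g = g \<otimes> a [^] p" if g: "g \<in> carrier G" for g
      proof -
        have "commutator G g (a [^] p) = \<one>"
          using commutator_pow_right[OF g \<open>a \<in> carrier G\<close>, of p] p(3)[OF commutator_central[OF g \<open>a \<in> carrier G\<close>]] by simp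
        then show ?thesis using commutator_swap[OF g, of "a [^] p"] \<open>a \<in> carrier G\<close> g by simp
      qed
      then show ?thesis using centerI[of "a [^] p"] \<open>a \<in> carrier G\<close> by blast
    qed
    have scalar_p: "\<exists>\<mu>. \<mu> ^ p = 1 \<and> (\<forall>f \<in> V. act (\<phi> x [^] p) f = chain_scale \<mu> f)" if "x \<in> carrier F" for x
    proof -
      have "\<phi> x [^] p \<in> center G" using pow_central that by simp
      then show ?thesis using sc sc_p V(1) by blast
    qed
    have "\<exists>B'' z' c. free_basis F B'' \<and> z' \<in> B'' \<and> c \<noteq> 1 \<and> c ^ (p * p) = 1 \<and>
      (\<forall>f \<in> V. act (\<phi> z') f = chain_scale c f)"
    proof (cases "\<epsilon> ^ s = 1")
      case True
      \<comment> \<open>\<open>z\<close> acts trivially here. The commutator of \<open>x\<close> and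
        \<open>y\<close> acts by the nontrivial scalar \<open>\<beta> x y\<close>, and since it is a
        word in basis elements other than \<open>z\<close>, multiplying \<open>z\<close> by it gives
        another basis.\<close>
      define w where "w = commutator F x y"
      have wF: "w \<in> carrier F" "\<phi> w = commutator G (\<phi> x) (\<phi> y)"
        using xyF hom_commutator[OF h.G.group_axioms group_axioms h.homh] by (auto simp: w_def)
      have "inv\<^bsub>F\<^esub> x \<in> generate F (B' - {z})" "inv\<^bsub>F\<^esub> y \<in> generate F (B' - {z})"
        "x \<in> generate F (B' - {z})" "y \<in> generate F (B' - {z})"
        using xy by (auto intro: generate.incl generate.inv)
      then have "w \<in> generate F (B' - {z})"
        unfolding w_def commutator_def by (intro generate.eng)
      then have "free_basis F (insert (z \<otimes>\<^bsub>F\<^esub> w) (B' - {z}))"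
        by (rule free_basis_replace(1)[OF h.G.group_axioms B'(1,2)])
      moreover have "act (\<phi> (z \<otimes>\<^bsub>F\<^esub> w)) f = chain_scale (\<beta> x y) f" if "f \<in> V" for f
        using that V(1,4) True zF wF xyF sc[OF commutator_central, of "\<phi> x" "\<phi> y" f]
        by (auto simp: V.act_mult \<beta>_def)
      moreover have "\<beta> x y ^ (p * p) = 1"
        by (simp add: power_mult \<beta>_p[OF xyF])
      ultimately show ?thesis using xy(3) by blast
    next
      case False
      \<comment> \<open>The p-th power of \<open>\<phi> z\<close> is central, so the p-th power of
        the scalar of \<open>z\<close> is itself a p-th root of unity.\<close>
      obtain \<mu> where \<mu>: "\<mu> ^ p = 1" "act (\<phi> z [^] p) f = chain_scale \<mu> f"
        using scalar_p[OF zF] f by blast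
      have "chain_scale ((\<epsilon> ^ s) ^ p) f = chain_scale \<mu> f"
        using V.act_pow_scalar[of "\<phi> z" f "\<epsilon> ^ s" p] V(4) f(1) zF \<mu>(2) by auto
      then have "(\<epsilon> ^ s) ^ p = \<mu>" using f(2) by auto
      then have "(\<epsilon> ^ s) ^ (p * p) = 1" using \<mu>(1) by (simp add: power_mult)
      then show ?thesis using False B' V(4) by blast
    qed
    then obtain B'' z' c where new: "free_basis F B''" "z' \<in> B''" "c \<noteq> 1" "c ^ (p * p) = 1"
      "\<And>f. f \<in> V \<Longrightarrow> act (\<phi> z') f = chain_scale c f" by blast
    have "x \<in> carrier F" if "x \<in> B'' - {z'}" for x
      using that free_basisD(1)[OF new(1)] by blast
    then have "E f \<kappa> = 0" if "\<kappa> \<in> carrier F" "\<phi> \<kappa> = \<one>" for \<kappa>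
      using V.vanish_if_central_scalar[OF new(1,2) p(2) new(5,3,4) scalar_p f(1) that] by blast
    then show ?thesis using f V(1) W'(1) by blast
  qed
qed

end

section \<open>The exponent of the center\<close>

lemma prime_exponent_center:
  assumes "class2_group G" "\<not> comm_group G"
    and cyc: "\<And>H. \<lbrakk>subgroup H G; H \<subseteq> center G; cyclic_group (subgroup_generated G H); H \<noteq> {\<one>\<^bsub>G\<^esub>}\<rbrakk>
      \<Longrightarrow> prime (card H)"
  shows "\<exists>p::nat. prime p \<and> (\<forall>z \<in> center G. z [^]\<^bsub>G\<^esub> p = \<one>\<^bsub>G\<^esub>)"
proof -
  interpret class2_group G by fact
  have cG: "center G \<subseteq> carrier G" by (auto simp: center_def)
  have sub: "subgroup (center G) G"
  proof
    fix x y assume "x \<in> center G" "y \<in> center G"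
    then have x: "x \<in> carrier G" "\<And>g. g \<in> carrier G \<Longrightarrow> x \<otimes>\<^bsub>G\<^esub> g = g \<otimes>\<^bsub>G\<^esub> x"
      and y: "y \<in> carrier G" "\<And>g. g \<in> carrier G \<Longrightarrow> y \<otimes>\<^bsub>G\<^esub> g = g \<otimes>\<^bsub>G\<^esub> y"
      using cG centerD by auto
    show "x \<otimes>\<^bsub>G\<^esub> y \<in> center G"
    proof (rule centerI)
      fix g assume g: "g \<in> carrier G"
      have "x \<otimes>\<^bsub>G\<^esub> y \<otimes>\<^bsub>G\<^esub> g = x \<otimes>\<^bsub>G\<^esub> g \<otimes>\<^bsub>G\<^esub> y"
        using x(1) y(1) y(2)[OF g] g by (simp add: m_assoc)
      then show "x \<otimes>\<^bsub>G\<^esub> y \<otimes>\<^bsub>G\<^esub> g = g \<otimes>\<^bsub>G\<^esub> (x \<otimes>\<^bsub>G\<^esub> y)"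
        using x(1) y(1) x(2)[OF g] g by (simp add: m_assoc)
    qed (use x(1) y(1) in simp)
    show "inv\<^bsub>G\<^esub> x \<in> center G"
    proof (rule centerI)
      fix g assume g: "g \<in> carrier G"
      have "inv\<^bsub>G\<^esub> (inv\<^bsub>G\<^esub> g \<otimes>\<^bsub>G\<^esub> x) = inv\<^bsub>G\<^esub> (x \<otimes>\<^bsub>G\<^esub> inv\<^bsub>G\<^esub> g)"
        using x(2)[of "inv\<^bsub>G\<^esub> g"] g by simp
      then show "inv\<^bsub>G\<^esub> x \<otimes>\<^bsub>G\<^esub> g = g \<otimes>\<^bsub>G\<^esub> inv\<^bsub>G\<^esub> x"
        using x(1) g by (simp add: inv_mult_group)
    qed (use x(1) in simp)
  qed (use cG in \<open>auto simp: center_def\<close>)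
  have ord_prime: "prime (ord z)" if z: "z \<in> center G" "z \<noteq> \<one>\<^bsub>G\<^esub>" for z
  proof -
    have zG: "z \<in> carrier G" using z cG by blast
    let ?H = "generate G {z}"
    have "subgroup ?H G" using zG by (simp add: generate_is_subgroup)
    moreover have "?H \<subseteq> center G"
      using generate_subgroup_incl[OF _ sub, of "{z}"] z by simp
    \<comment> \<open>Generating from the subgroup gives the same group as generating from
      \<open>z\<close>, which is cyclic by construction.\<close>
    moreover have "cyclic_group (subgroup_generated G ?H)"
    proof -
      have "generate G ?H = ?H"
        using generate_subgroup_incl[OF subset_refl \<open>subgroup ?H G\<close>] generate.incl by fastforce
      moreover have "carrier G \<inter> ?H = ?H" "carrier G \<inter> {z} = {z}"
        using zG \<open>?H \<subseteq> center G\<close> cG by auto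
      ultimately have "subgroup_generated G ?H = subgroup_generated G {z}"
        by (simp add: subgroup_generated_def)
      then show ?thesis using cyclic_group_generated[of z] by simp
    qed
    moreover have "?H \<noteq> {\<one>\<^bsub>G\<^esub>}"
      using z(2) generate.incl[of z "{z}" G] by auto
    ultimately have "prime (card ?H)" by (rule cyc)
    then show ?thesis using generate_pow_card[OF zG] by simp
  qed
  \<comment> \<open>A nontrivial commutator is a central element different from the identity; its
    order is the common prime to which all other orders are compared.\<close>
  obtain a b where ab: "a \<in> carrier G" "b \<in> carrier G" "commutator G a b \<noteq> \<one>\<^bsub>G\<^esub>"
  proof -
    have "\<exists>a \<in> carrier G. \<exists>b \<in> carrier G. a \<otimes>\<^bsub>G\<^esub> b \<noteq> b \<otimes>\<^bsub>G\<^esub> a"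
      using assms(2) group_comm_groupI by metis
    then show thesis
      using that commutator_swap by (metis l_one m_closed)
  qed
  define z where "z = commutator G a b"
  have z: "z \<in> center G" "z \<noteq> \<one>\<^bsub>G\<^esub>" using ab commutator_central by (auto simp: z_def)
  have zG: "z \<in> carrier G" using z cG by blast
  have "w [^]\<^bsub>G\<^esub> ord z = \<one>\<^bsub>G\<^esub>" if w: "w \<in> center G" for w
  proof (cases "w = \<one>\<^bsub>G\<^esub> \<or> z \<otimes>\<^bsub>G\<^esub> w = \<one>\<^bsub>G\<^esub>")
    case True
    have wG: "w \<in> carrier G" using w cG by blast
    show ?thesis
    proof (cases "w = \<one>\<^bsub>G\<^esub>")
      case False
      then have "w = inv\<^bsub>G\<^esub> z" using True zG wG by (metis inv_equality inv_inv)
      then show ?thesis using zG by (simp add: nat_pow_inv pow_ord_eq_1)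
    qed (use wG in simp)
  next
    case False
    have wG: "w \<in> carrier G" using w cG by blast
    define r where "r = ord (z \<otimes>\<^bsub>G\<^esub> w)"
    have "z \<otimes>\<^bsub>G\<^esub> w \<in> center G" using sub z(1) w by (simp add: subgroup.m_closed)
    then have pr: "prime (ord z)" "prime (ord w)" "prime r"
      using ord_prime z w False by (auto simp: r_def)
    have "(z \<otimes>\<^bsub>G\<^esub> w) [^]\<^bsub>G\<^esub> r = \<one>\<^bsub>G\<^esub>"
      unfolding r_def using zG wG by (simp add: pow_ord_eq_1)
    then have zw: "z [^]\<^bsub>G\<^esub> r \<otimes>\<^bsub>G\<^esub> w [^]\<^bsub>G\<^esub> r = \<one>\<^bsub>G\<^esub>"
      using pow_mult_distrib[OF centerD[OF z(1) wG] zG wG] by simp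
    \<comment> \<open>Two commuting elements of different prime orders would have a product of
      composite order. Concretely, \<open>ord z\<close> divides \<open>r * ord w\<close>, and all
      three are prime.\<close>
    have "r = ord z \<or> r = ord w"
    proof -
      have "(z [^]\<^bsub>G\<^esub> r \<otimes>\<^bsub>G\<^esub> w [^]\<^bsub>G\<^esub> r) [^]\<^bsub>G\<^esub> ord w = z [^]\<^bsub>G\<^esub> (r * ord w)"
      proof -
        have "w [^]\<^bsub>G\<^esub> (r * ord w) = \<one>\<^bsub>G\<^esub>"
          using wG pow_eq_id[of w "r * ord w"] by simp
        moreover have "z [^]\<^bsub>G\<^esub> r \<otimes>\<^bsub>G\<^esub> w [^]\<^bsub>G\<^esub> r = (z \<otimes>\<^bsub>G\<^esub> w) [^]\<^bsub>G\<^esub> r"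
          using pow_mult_distrib[OF centerD[OF z(1) wG] zG wG] by simp
        ultimately show ?thesis
          using pow_mult_distrib[OF centerD[OF z(1) wG] zG wG, of "r * ord w"] zG wG by (simp add: nat_pow_pow)
      qed
      then have "ord z dvd r * ord w"
        using zw zG pow_eq_id[of z "r * ord w"] by simp
      then have "ord z dvd r \<or> ord z dvd ord w" using pr(1) by (simp add: prime_dvd_mult_iff)
      then have "ord z = r \<or> ord z = ord w" using pr by (metis primes_dvd_imp_eq)
      moreover have ?thesis if "ord z = ord w"
      proof -
        have "(z \<otimes>\<^bsub>G\<^esub> w) [^]\<^bsub>G\<^esub> ord z = \<one>\<^bsub>G\<^esub>"
          using pow_mult_distrib[OF centerD[OF z(1) wG] zG wG, of "ord z"] pow_ord_eq_1[OF zG] pow_ord_eq_1[OF wG] that by simp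
        then have "r dvd ord z" using zG wG by (simp add: r_def pow_eq_id)
        then show ?thesis using pr by (metis primes_dvd_imp_eq)
      qed
      ultimately show ?thesis by auto
    qed
    then show ?thesis
    proof
      assume r: "r = ord z"
      then have "w [^]\<^bsub>G\<^esub> r = \<one>\<^bsub>G\<^esub>" using zw pow_ord_eq_1[OF zG] wG by simp
      then show ?thesis using r by simp
    next
      assume r: "r = ord w"
      then have "z [^]\<^bsub>G\<^esub> r = \<one>\<^bsub>G\<^esub>" using zw pow_ord_eq_1[OF wG] zG by simp
      then have "ord z dvd r" using zG pow_eq_id by simp
      then have "ord z = ord w" using pr r by (metis primes_dvd_imp_eq)
      then show ?thesis using pow_ord_eq_1[OF wG] by simp
    qed
  qed
  then show ?thesis using ord_prime[OF z] by blast
qed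

lemma two_step_nilpotent_class2: "two_step_nilpotent G \<Longrightarrow> class2_group G"
proof -
  assume G: "two_step_nilpotent G"
  then interpret group G by (simp add: two_step_nilpotent_def)
  show ?thesis
  proof
    fix a b assume ab: "a \<in> carrier G" "b \<in> carrier G"
    then have "commutator G a b \<in> derived G (carrier G)"
      unfolding derived_def commutator_def by (intro generate.incl) auto
    then show "commutator G a b \<in> center G"
      using G by (auto simp: two_step_nilpotent_def)
  qed
qed

lemma comm_group_class2: "comm_group G \<Longrightarrow> class2_group G"
proof -
  assume "comm_group G"
  then interpret comm_group G .
  show ?thesis
  proof
    fix a b assume "a \<in> carrier G" "b \<in> carrier G"
    then show "commutator G a b \<in> center G"
      by (auto simp: center_def commutator_def intro: m_comm)
  qed
qed

text \<open>Homomorphisms on the kernel of \<open>\<phi>\<close> form a representation of \<open>G\<close> under conjugation. Averaging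
  over a transversal extends each of them to a cocycle on the whole group.\<close>

theorem kernel_hom_vanish:
  fixes F :: "('h, 'k) monoid_scheme" and G :: "('g, 'm) monoid_scheme" and f :: "'h \<Rightarrow> complex"
  assumes F: "group F" "free_basis F B" "finite B" "B \<noteq> {}" and G: "class2_group G" "finite (carrier G)"
    and \<phi>: "\<phi> \<in> hom F G" "\<phi> ` carrier F = carrier G"
    and odd: "\<not> comm_group G \<Longrightarrow> odd (card B) \<and> (\<exists>p::nat. prime p \<and> (\<forall>z \<in> center G. z [^]\<^bsub>G\<^esub> p = \<one>\<^bsub>G\<^esub>))"
    and f_hom: "\<And>k l. \<lbrakk>k \<in> kernel F G \<phi>; l \<in> kernel F G \<phi>\<rbrakk> \<Longrightarrow> f (k \<otimes>\<^bsub>F\<^esub> l) = f k + f l"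
    and f_prim: "\<And>\<gamma> m. \<lbrakk>primitive F \<gamma>; \<gamma> [^]\<^bsub>F\<^esub> (m::nat) \<in> kernel F G \<phi>\<rbrakk> \<Longrightarrow> f (\<gamma> [^]\<^bsub>F\<^esub> m) = 0"
    and \<kappa>: "\<kappa> \<in> kernel F G \<phi>"
  shows "f \<kappa> = 0"
proof -
  interpret G: class2_group G by fact
  interpret F: group F by fact
  interpret h: group_hom F G \<phi> using \<phi>(1) by unfold_locales
  define K where "K = kernel F G \<phi>"
  have K: "k \<in> K \<longleftrightarrow> k \<in> carrier F \<and> \<phi> k = \<one>\<^bsub>G\<^esub>" for k by (auto simp: K_def kernel_def)
  \<comment> \<open>All homomorphisms on the kernel that kill primitive powers, extended by 0 so
    that they form a subspace of the functions on \<open>F\<close>.\<close>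
  define M where "M = {u :: 'h \<Rightarrow> complex. (\<forall>k. k \<notin> K \<longrightarrow> u k = 0) \<and>
    (\<forall>k \<in> K. \<forall>l \<in> K. u (k \<otimes>\<^bsub>F\<^esub> l) = u k + u l) \<and>
    (\<forall>\<gamma> m. primitive F \<gamma> \<longrightarrow> \<gamma> [^]\<^bsub>F\<^esub> (m::nat) \<in> K \<longrightarrow> u (\<gamma> [^]\<^bsub>F\<^esub> m) = 0)}"
  define s where "s g = inv_into (carrier F) \<phi> g" for g
  have s: "s g \<in> carrier F" "\<phi> (s g) = g" if "g \<in> carrier G" for g
    using that \<phi>(2) unfolding s_def by (auto intro: inv_into_into f_inv_into_f)
  \<comment> \<open>Conjugation uses the chosen preimage \<open>s g\<close>; \<open>M_conj\<close>
    shows that the choice does not matter on \<open>M\<close>.\<close>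
  define act where "act g u = (\<lambda>k. if k \<in> K then u (s g \<otimes>\<^bsub>F\<^esub> k \<otimes>\<^bsub>F\<^esub> inv\<^bsub>F\<^esub> s g) else 0)" for g and u :: "'h \<Rightarrow> complex"
  have M_hom: "u (k \<otimes>\<^bsub>F\<^esub> l) = u k + u l" if "u \<in> M" "k \<in> K" "l \<in> K" for u k l
    using that by (simp add: M_def)
  have M_off: "u k = 0" if "u \<in> M" "k \<notin> K" for u k
    using that by (simp add: M_def)
  have M_prim: "u (\<gamma> [^]\<^bsub>F\<^esub> m) = 0" if "u \<in> M" "primitive F \<gamma>" "\<gamma> [^]\<^bsub>F\<^esub> m \<in> K" for u \<gamma> and m :: nat
    using that by (simp add: M_def)
  have prim_F: "\<gamma> \<in> carrier F" if "primitive F \<gamma>" for \<gamma>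
    using that free_basisD(1) by (auto simp: primitive_def)
  have conj_K: "a \<otimes>\<^bsub>F\<^esub> k \<otimes>\<^bsub>F\<^esub> inv\<^bsub>F\<^esub> a \<in> K" if "a \<in> carrier F" "k \<in> K" for a k
    using that by (simp add: K)
  \<comment> \<open>Two preimages differ by an element of the kernel, and a homomorphism to an
    abelian group does not see conjugation by that element.\<close>
  have M_conj: "u (a \<otimes>\<^bsub>F\<^esub> k \<otimes>\<^bsub>F\<^esub> inv\<^bsub>F\<^esub> a) = u (b \<otimes>\<^bsub>F\<^esub> k \<otimes>\<^bsub>F\<^esub> inv\<^bsub>F\<^esub> b)"
    if u: "u \<in> M" and ab: "a \<in> carrier F" "b \<in> carrier F" "\<phi> a = \<phi> b" and k: "k \<in> K" for u a b k
  proof -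
    define c where "c = a \<otimes>\<^bsub>F\<^esub> inv\<^bsub>F\<^esub> b"
    have c: "c \<in> K" "inv\<^bsub>F\<^esub> c \<in> K" "c \<in> carrier F" using ab by (auto simp: c_def K)
    have kF: "k \<in> carrier F" using k by (simp add: K)
    let ?k = "b \<otimes>\<^bsub>F\<^esub> k \<otimes>\<^bsub>F\<^esub> inv\<^bsub>F\<^esub> b"
    have a: "a = c \<otimes>\<^bsub>F\<^esub> b" using ab by (simp add: c_def F.m_assoc)
    have "a \<otimes>\<^bsub>F\<^esub> k \<otimes>\<^bsub>F\<^esub> inv\<^bsub>F\<^esub> a = c \<otimes>\<^bsub>F\<^esub> (?k \<otimes>\<^bsub>F\<^esub> inv\<^bsub>F\<^esub> c)"
      unfolding a using ab(2) kF c(3) by (simp add: F.m_assoc F.inv_mult_group)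
    moreover have "u (c \<otimes>\<^bsub>F\<^esub> (?k \<otimes>\<^bsub>F\<^esub> inv\<^bsub>F\<^esub> c)) = u c + (u ?k + u (inv\<^bsub>F\<^esub> c))"
    proof -
      have "?k \<otimes>\<^bsub>F\<^esub> inv\<^bsub>F\<^esub> c \<in> K" using conj_K[OF ab(2) k] c(2) by (simp add: K)
      then show ?thesis using M_hom[OF u] c conj_K[OF ab(2) k] by simp
    qed
    moreover have "u c + u (inv\<^bsub>F\<^esub> c) = u \<one>\<^bsub>F\<^esub>"
      using M_hom[OF u c(1,2)] c(3) by simp
    moreover have "u \<one>\<^bsub>F\<^esub> = 0"
      using M_hom[OF u, of "\<one>\<^bsub>F\<^esub>" "\<one>\<^bsub>F\<^esub>"] by (simp add: K)
    ultimately show ?thesis by simp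
  qed
  have act_eq: "act (\<phi> a) u k = u (a \<otimes>\<^bsub>F\<^esub> k \<otimes>\<^bsub>F\<^esub> inv\<^bsub>F\<^esub> a)" if "u \<in> M" "a \<in> carrier F" "k \<in> K" for u a k
    using that(3) M_conj[OF that(1) s(1)[OF h.hom_closed[OF that(2)]] that(2) s(2)[OF h.hom_closed[OF that(2)]] that(3)]
    by (simp add: act_def)
  have act_off: "act g u k = 0" if "k \<notin> K" for g u k
    using that by (simp add: act_def)
  have act_M: "act g u \<in> M" if g: "g \<in> carrier G" and u: "u \<in> M" for g u
  proof -
    have "act g u (k \<otimes>\<^bsub>F\<^esub> l) = act g u k + act g u l" if kl: "k \<in> K" "l \<in> K" for k l
    proof -
      have F: "k \<in> carrier F" "l \<in> carrier F" "k \<otimes>\<^bsub>F\<^esub> l \<in> K" using kl by (auto simp: K)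
      have "inv\<^bsub>F\<^esub> s g \<otimes>\<^bsub>F\<^esub> (s g \<otimes>\<^bsub>F\<^esub> x) = x" if "x \<in> carrier F" for x
        using that s(1)[OF g] by (simp flip: F.m_assoc)
      then have "s g \<otimes>\<^bsub>F\<^esub> (k \<otimes>\<^bsub>F\<^esub> l) \<otimes>\<^bsub>F\<^esub> inv\<^bsub>F\<^esub> s g =
        (s g \<otimes>\<^bsub>F\<^esub> k \<otimes>\<^bsub>F\<^esub> inv\<^bsub>F\<^esub> s g) \<otimes>\<^bsub>F\<^esub> (s g \<otimes>\<^bsub>F\<^esub> l \<otimes>\<^bsub>F\<^esub> inv\<^bsub>F\<^esub> s g)"
        using s(1)[OF g] F by (simp add: F.m_assoc)
      then show ?thesis
        using F kl M_hom[OF u] conj_K[OF s(1)[OF g]] by (simp add: act_def)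
    qed
    moreover have "act g u (\<gamma> [^]\<^bsub>F\<^esub> m) = 0" if \<gamma>: "primitive F \<gamma>" "\<gamma> [^]\<^bsub>F\<^esub> m \<in> K" for \<gamma> and m :: nat
    proof -
      have "s g \<otimes>\<^bsub>F\<^esub> \<gamma> [^]\<^bsub>F\<^esub> m \<otimes>\<^bsub>F\<^esub> inv\<^bsub>F\<^esub> s g = (s g \<otimes>\<^bsub>F\<^esub> \<gamma> \<otimes>\<^bsub>F\<^esub> inv\<^bsub>F\<^esub> s g) [^]\<^bsub>F\<^esub> m"
        using F.pow_conj s(1)[OF g] prim_F[OF \<gamma>(1)] by simp
      then show ?thesis
        using \<gamma> M_prim[OF u primitive_conj[OF F(1) \<gamma>(1) s(1)[OF g]], of m] conj_K[OF s(1)[OF g] \<gamma>(2)]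
        by (simp add: act_def)
    qed
    ultimately show ?thesis by (simp add: M_def act_def)
  qed
  have sub: "chains.subspace M"
    unfolding chains.subspace_def by (simp add: M_def chain_scale_def algebra_simps)
  have rep: "fin_rep G M act"
  proof unfold_locales
    show "linear_endo M (act g)" if "g \<in> carrier G" for g
      using sub act_M[OF that] by (auto simp: linear_endo_def act_def chain_scale_def fun_eq_iff)
    show "act \<one>\<^bsub>G\<^esub> u = u" if "u \<in> M" for u
    proof
      fix k show "act \<one>\<^bsub>G\<^esub> u k = u k"
        using act_eq[OF that, of "\<one>\<^bsub>F\<^esub>" k] M_off[OF that] by (cases "k \<in> K") (auto simp: act_off K)
    qed
    show "act (g \<otimes>\<^bsub>G\<^esub> h) u = act h (act g u)" if gh: "g \<in> carrier G" "h \<in> carrier G" and u: "u \<in> M" for g h u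
    proof
      fix k
      show "act (g \<otimes>\<^bsub>G\<^esub> h) u k = act h (act g u) k"
      proof (cases "k \<in> K")
        case True
        then have kF: "k \<in> carrier F" by (simp add: K)
        have "act (g \<otimes>\<^bsub>G\<^esub> h) u k = u ((s g \<otimes>\<^bsub>F\<^esub> s h) \<otimes>\<^bsub>F\<^esub> k \<otimes>\<^bsub>F\<^esub> inv\<^bsub>F\<^esub> (s g \<otimes>\<^bsub>F\<^esub> s h))"
          using act_eq[OF u, of "s g \<otimes>\<^bsub>F\<^esub> s h" k] s gh True by simp
        also have "\<dots> = u (s g \<otimes>\<^bsub>F\<^esub> (s h \<otimes>\<^bsub>F\<^esub> k \<otimes>\<^bsub>F\<^esub> inv\<^bsub>F\<^esub> s h) \<otimes>\<^bsub>F\<^esub> inv\<^bsub>F\<^esub> s g)"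
          using s gh kF by (simp add: F.m_assoc F.inv_mult_group)
        also have "\<dots> = act h (act g u) k"
          using True conj_K[OF s(1)[OF gh(2)]] by (simp add: act_def)
        finally show ?thesis .
      qed (simp add: act_off)
    qed
  qed (use G(2) sub in auto)
  \<comment> \<open>The summand compares \<open>\<gamma> \<otimes> s g\<close> with the chosen
    representative of its coset, which gives an element of the kernel. On the kernel itself every
    summand is \<open>u \<gamma>\<close>, so the average extends \<open>u\<close>.\<close>
  define E where "E u \<gamma> = (\<Sum>g\<in>carrier G. u (\<gamma> \<otimes>\<^bsub>F\<^esub> s g \<otimes>\<^bsub>F\<^esub> inv\<^bsub>F\<^esub> s (\<phi> \<gamma> \<otimes>\<^bsub>G\<^esub> g))) / of_nat (Coset.order G)"
    for u :: "'h \<Rightarrow> complex" and \<gamma>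
  have ord: "Coset.order G \<noteq> 0" using fin_rep.order_pos[OF rep] by simp
  have E_K: "E u k = u k" if "u \<in> M" "k \<in> K" for u k
  proof -
    have "k \<otimes>\<^bsub>F\<^esub> s g \<otimes>\<^bsub>F\<^esub> inv\<^bsub>F\<^esub> s (\<phi> k \<otimes>\<^bsub>G\<^esub> g) = k" if "g \<in> carrier G" for g
      using \<open>k \<in> K\<close> s(1)[OF that] that by (simp add: K F.m_assoc)
    then have "(\<Sum>g\<in>carrier G. u (k \<otimes>\<^bsub>F\<^esub> s g \<otimes>\<^bsub>F\<^esub> inv\<^bsub>F\<^esub> s (\<phi> k \<otimes>\<^bsub>G\<^esub> g))) = of_nat (Coset.order G) * u k"
      by (simp add: Coset.order_def)
    then show ?thesis using ord by (simp add: E_def)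
  qed
  have E_mult: "E u (\<gamma> \<otimes>\<^bsub>F\<^esub> \<delta>) = E u \<gamma> + E (act (\<phi> \<gamma>) u) \<delta>"
    if u: "u \<in> M" and \<gamma>: "\<gamma> \<in> carrier F" and \<delta>: "\<delta> \<in> carrier F" for u \<gamma> \<delta>
  proof -
    define t where "t \<gamma> g = \<gamma> \<otimes>\<^bsub>F\<^esub> s g \<otimes>\<^bsub>F\<^esub> inv\<^bsub>F\<^esub> s (\<phi> \<gamma> \<otimes>\<^bsub>G\<^esub> g)" for \<gamma> g
    have tK: "t \<gamma> g \<in> K" if "\<gamma> \<in> carrier F" "g \<in> carrier G" for \<gamma> g
      using that s by (simp add: t_def K)
    have "u (t (\<gamma> \<otimes>\<^bsub>F\<^esub> \<delta>) g) = act (\<phi> \<gamma>) u (t \<delta> g) + u (t \<gamma> (\<phi> \<delta> \<otimes>\<^bsub>G\<^esub> g))" if g: "g \<in> carrier G" for g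
    proof -
      have c: "inv\<^bsub>F\<^esub> a \<otimes>\<^bsub>F\<^esub> (a \<otimes>\<^bsub>F\<^esub> x) = x" if "a \<in> carrier F" "x \<in> carrier F" for a x
        using that by (simp flip: F.m_assoc)
      \<comment> \<open>The comparison for a product passes through the representative of
        \<open>\<phi> \<delta> \<otimes> g\<close>. Conjugating the first factor by \<gamma>
        produces the action of \<open>\<phi> \<gamma>\<close>.\<close>
      have "t (\<gamma> \<otimes>\<^bsub>F\<^esub> \<delta>) g = (\<gamma> \<otimes>\<^bsub>F\<^esub> t \<delta> g \<otimes>\<^bsub>F\<^esub> inv\<^bsub>F\<^esub> \<gamma>) \<otimes>\<^bsub>F\<^esub> t \<gamma> (\<phi> \<delta> \<otimes>\<^bsub>G\<^esub> g)"
        using \<gamma> \<delta> g s(1) by (simp add: t_def F.m_assoc G.m_assoc c)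
      then show ?thesis
        using M_hom[OF u conj_K[OF \<gamma> tK[OF \<delta> g]] tK[OF \<gamma>, of "\<phi> \<delta> \<otimes>\<^bsub>G\<^esub> g"]] act_eq[OF u \<gamma> tK[OF \<delta> g]] \<delta> g
        by simp
    qed
    then have "(\<Sum>g\<in>carrier G. u (t (\<gamma> \<otimes>\<^bsub>F\<^esub> \<delta>) g)) =
      (\<Sum>g\<in>carrier G. act (\<phi> \<gamma>) u (t \<delta> g)) + (\<Sum>g\<in>carrier G. u (t \<gamma> (\<phi> \<delta> \<otimes>\<^bsub>G\<^esub> g)))"
      by (simp add: sum.distrib)
    moreover have "(\<Sum>g\<in>carrier G. u (t \<gamma> (\<phi> \<delta> \<otimes>\<^bsub>G\<^esub> g))) = (\<Sum>g\<in>carrier G. u (t \<gamma> g))"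
    proof (rule sum.reindex_bij_betw)
      have c: "inv\<^bsub>G\<^esub> \<phi> \<delta> \<otimes>\<^bsub>G\<^esub> (\<phi> \<delta> \<otimes>\<^bsub>G\<^esub> x) = x" "\<phi> \<delta> \<otimes>\<^bsub>G\<^esub> (inv\<^bsub>G\<^esub> \<phi> \<delta> \<otimes>\<^bsub>G\<^esub> x) = x" if "x \<in> carrier G" for x
        using that \<delta> by (simp_all flip: G.m_assoc)
      show "bij_betw ((\<otimes>\<^bsub>G\<^esub>) (\<phi> \<delta>)) (carrier G) (carrier G)"
        by (rule bij_betw_byWitness[where f' = "\<lambda>g. inv\<^bsub>G\<^esub> (\<phi> \<delta>) \<otimes>\<^bsub>G\<^esub> g"]) (use c \<delta> in auto)
    qed
    ultimately show ?thesis
      by (simp add: E_def t_def add_divide_distrib)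
  qed
  have coc: "primitive_cocycle F G \<phi> M act E"
  proof -
    interpret R: fin_rep G M act by fact
    show ?thesis
    proof unfold_locales
      fix u \<gamma> c assume "u \<in> M" "\<gamma> \<in> carrier F"
      show "E (chain_scale c u) \<gamma> = c * E u \<gamma>"
        by (simp add: E_def chain_scale_def flip: sum_distrib_left)
    next
      fix u \<gamma> and m :: nat assume *: "u \<in> M" "primitive F \<gamma>" "\<phi> (\<gamma> [^]\<^bsub>F\<^esub> m) = \<one>\<^bsub>G\<^esub>"
      then have "\<gamma> [^]\<^bsub>F\<^esub> m \<in> K" using prim_F by (simp add: K)
      then show "E u (\<gamma> [^]\<^bsub>F\<^esub> m) = 0" using E_K M_prim * by simp
    qed (rule E_mult)
  qed
  \<comment> \<open>On the kernel \<open>E u\<close> equals \<open>u\<close>, so the nonzero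
    \<open>u\<close> supplied by \<open>class2_vanish\<close> would be 0.\<close>
  have "M = {0}"
  proof (rule ccontr)
    assume "M \<noteq> {0}"
    then obtain u where u: "u \<in> M" "u \<noteq> 0" "\<forall>\<kappa> \<in> carrier F. \<phi> \<kappa> = \<one>\<^bsub>G\<^esub> \<longrightarrow> E u \<kappa> = 0"
      using primitive_cocycle.class2_vanish[OF coc G(1) F(2-4) \<phi>(2) odd] by blast
    have "u k = 0" for k
      using u(1,3) E_K[OF u(1), of k] M_off[OF u(1), of k] by (cases "k \<in> K") (auto simp: K)
    then show False using u(2) by (auto simp: fun_eq_iff)
  qed
  moreover have "(\<lambda>k. if k \<in> K then f k else 0) \<in> M"
    using f_hom f_prim by (auto simp: M_def K_def[symmetric]) (auto simp: K)
  ultimately have "(\<lambda>k. if k \<in> K then f k else 0) = 0" by blast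
  then have "(\<lambda>k. if k \<in> K then f k else 0) \<kappa> = (0 :: 'h \<Rightarrow> complex) \<kappa>" by (rule fun_cong)
  then show ?thesis using \<kappa> by (simp add: K_def)
qed

section \<open>Edge paths and homotopy\<close>

definition src :: "('v, 'e) pre_digraph \<Rightarrow> 'e \<times> bool \<Rightarrow> 'v" where
  "src X a = (if snd a then tail X (fst a) else head X (fst a))"

definition trg :: "('v, 'e) pre_digraph \<Rightarrow> 'e \<times> bool \<Rightarrow> 'v" where
  "trg X a = (if snd a then head X (fst a) else tail X (fst a))"

definition edge_path :: "('v, 'e) pre_digraph \<Rightarrow> 'v \<Rightarrow> ('e \<times> bool) list \<Rightarrow> 'v \<Rightarrow> bool" where
  "edge_path X = pre_digraph.awalk (double X)"

lemma src_flip [simp]: "src X (flip a) = trg X a" and trg_flip [simp]: "trg X (flip a) = src X a"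
  by (auto simp: src_def trg_def flip_def)

lemma fst_flip [simp]: "fst (flip a) = fst a"
  by (simp add: flip_def)

lemma double_simps:
  "verts (double X) = verts X" "arcs (double X) = arcs X \<times> UNIV"
  "tail (double X) a = src X a" "head (double X) a = trg X a"
  by (cases a; simp add: double_def src_def trg_def)+

lemma wf_digraph_double: "wf_digraph X \<Longrightarrow> wf_digraph (double X)"
  by unfold_locales
    (auto simp: double_simps src_def trg_def wf_digraph.tail_in_verts wf_digraph.head_in_verts)

lemma edge_path_Nil [simp]: "wf_digraph X \<Longrightarrow> edge_path X u [] v \<longleftrightarrow> u = v \<and> u \<in> verts X"
  by (simp add: edge_path_def wf_digraph.awalk_Nil_iff[OF wf_digraph_double]) (auto simp: double_simps)

lemma edge_path_Cons [simp]:
  "wf_digraph X \<Longrightarrow> edge_path X u (a # w) v \<longleftrightarrow> fst a \<in> arcs X \<and> src X a = u \<and> edge_path X (trg X a) w v"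
  by (auto simp: edge_path_def wf_digraph.awalk_Cons_iff[OF wf_digraph_double] double_simps mem_Times_iff)

lemma edge_path_append:
  "wf_digraph X \<Longrightarrow> edge_path X u (p @ q) v \<longleftrightarrow> (\<exists>m. edge_path X u p m \<and> edge_path X m q v)"
proof (induction p arbitrary: u)
  case Nil
  then have "u \<in> verts X" if "edge_path X u q v"
    using that wf_digraph.awalk_hd_in_verts[OF wf_digraph_double] by (fastforce simp: edge_path_def double_simps)
  then show ?case using Nil by auto
qed auto

lemma edge_path_verts:
  assumes "wf_digraph X" "edge_path X u p v"
  shows "u \<in> verts X" "v \<in> verts X"
  using assms wf_digraph.awalk_hd_in_verts[OF wf_digraph_double] wf_digraph.awalk_last_in_verts[OF wf_digraph_double]
  by (fastforce simp: edge_path_def double_simps)+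

lemma edge_path_unique_end:
  "\<lbrakk>wf_digraph X; edge_path X u p v; edge_path X u p v'\<rbrakk> \<Longrightarrow> v = v'"
  by (induction p arbitrary: u) auto

lemma edge_path_reverse:
  assumes "wf_digraph X" "edge_path X u p v"
  shows "edge_path X v (map flip (rev p)) u"
  using assms(2)
proof (induction p arbitrary: u)
  case (Cons a p)
  then have "u \<in> verts X" using edge_path_verts[OF assms(1)] by blast
  then show ?case
    using Cons assms(1) by (auto simp: edge_path_append)
qed (use assms(1) in auto)

lemma loops_at_iff: "w \<in> loops_at X x \<longleftrightarrow> edge_path X x w x"
  by (simp add: loops_at_def edge_path_def)

lemma loops_at_append: "\<lbrakk>wf_digraph X; u \<in> loops_at X x; v \<in> loops_at X x\<rbrakk> \<Longrightarrow> u @ v \<in> loops_at X x"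
  by (auto simp: loops_at_iff edge_path_append)

lemma loop_power_loops_at:
  "\<lbrakk>wf_digraph X; x \<in> verts X; w \<in> loops_at X x\<rbrakk> \<Longrightarrow> loop_power w k \<in> loops_at X x"
  by (induction k) (auto simp: loop_power_def loops_at_append, simp add: loops_at_iff)

lemma backtrackI:
  "\<lbrakk>p @ q \<in> loops_at X x; p @ [a, flip a] @ q \<in> loops_at X x\<rbrakk> \<Longrightarrow> (p @ q, p @ [a, flip a] @ q) \<in> backtrack X x"
  unfolding backtrack_def by blast

lemma backtrackE:
  assumes "(w, w') \<in> backtrack X x"
  obtains p a q where "w = p @ q" "w' = p @ [a, flip a] @ q" "w \<in> loops_at X x" "w' \<in> loops_at X x"
  using assms unfolding backtrack_def by blast

lemma backtrack_sub: "backtrack X x \<subseteq> loops_at X x \<times> loops_at X x"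
  by (auto simp: backtrack_def)

lemma equiv_homotopy: "equiv (loops_at X x) (homotopy X x)"
proof (rule equivI)
  show "homotopy X x \<subseteq> loops_at X x \<times> loops_at X x" "refl_on (loops_at X x) (homotopy X x)"
    by (auto simp: homotopy_def refl_on_def)
  show "sym (homotopy X x)"
    unfolding homotopy_def by (intro symI) (auto dest: symD[OF sym_rtrancl[OF sym_Un_converse]])
  show "trans (homotopy X x)"
    unfolding homotopy_def by (auto intro!: transI)
qed

lemma homotopy_class_eq_iff:
  "\<lbrakk>u \<in> loops_at X x; v \<in> loops_at X x\<rbrakk> \<Longrightarrow>
   homotopy_class X x u = homotopy_class X x v \<longleftrightarrow> (u, v) \<in> homotopy X x"
  unfolding homotopy_class_def by (rule eq_equiv_class_iff[OF equiv_homotopy])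

lemma homotopy_induct [consumes 1, case_names refl step]:
  assumes "(u, v) \<in> homotopy X x" "P u"
    and "\<And>w w'. \<lbrakk>P w; (w, w') \<in> backtrack X x \<or> (w', w) \<in> backtrack X x\<rbrakk> \<Longrightarrow> P w'"
  shows "P v"
proof -
  have "(u, v) \<in> (backtrack X x \<union> (backtrack X x)\<inverse>)\<^sup>*" using assms(1) by (simp add: homotopy_def)
  then show ?thesis by induction (use assms(2,3) in auto)
qed

lemma homotopy_step:
  assumes "(u, w) \<in> homotopy X x" "(w, w') \<in> backtrack X x \<or> (w', w) \<in> backtrack X x"
  shows "(u, w') \<in> homotopy X x"
  using assms backtrack_sub[of X x] unfolding homotopy_def by (auto intro: rtrancl_into_rtrancl)

lemma homotopy_append:
  assumes X: "wf_digraph X" and "(u, u') \<in> homotopy X x" "(v, v') \<in> homotopy X x"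
  shows "(u @ v, u' @ v') \<in> homotopy X x"
proof -
  have L: "u \<in> loops_at X x" "u' \<in> loops_at X x" "v \<in> loops_at X x"
    using assms by (auto simp: homotopy_def)
  have "(u @ v, u' @ v) \<in> homotopy X x"
    using assms(2)
  proof (induction rule: homotopy_induct)
    case refl
    show ?case using loops_at_append[OF X L(1,3)] by (simp add: homotopy_def)
  next
    case (step w w')
    have "(a @ v, b @ v) \<in> backtrack X x" if ab: "(a, b) \<in> backtrack X x" for a b
    proof -
      obtain p c q where "a = p @ q" "b = p @ [c, flip c] @ q" "a \<in> loops_at X x" "b \<in> loops_at X x"
        using ab by (rule backtrackE)
      then show ?thesis
        using loops_at_append[OF X _ L(3), of a] loops_at_append[OF X _ L(3), of b] backtrackI[of p "q @ v" X x c]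
        by simp
    qed
    then show ?case using homotopy_step[OF step(1)] step(2) by blast
  qed
  moreover have "(u' @ v, u' @ v') \<in> homotopy X x"
    using assms(3)
  proof (induction rule: homotopy_induct)
    case refl
    show ?case using loops_at_append[OF X L(2,3)] by (simp add: homotopy_def)
  next
    case (step w w')
    have "(u' @ a, u' @ b) \<in> backtrack X x" if ab: "(a, b) \<in> backtrack X x" for a b
    proof -
      obtain p c q where "a = p @ q" "b = p @ [c, flip c] @ q" "a \<in> loops_at X x" "b \<in> loops_at X x"
        using ab by (rule backtrackE)
      then show ?thesis
        using loops_at_append[OF X L(2), of a] loops_at_append[OF X L(2), of b] backtrackI[of "u' @ p" q X x c]
        by simp
    qed
    then show ?case using homotopy_step[OF step(1)] step(2) by blast
  qed
  ultimately show ?thesis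
    using equiv_homotopy by (meson equivE transD)
qed

lemma homotopy_class_append:
  assumes X: "wf_digraph X" and "u \<in> loops_at X x" "v \<in> loops_at X x"
  shows "homotopy_class X x u \<otimes>\<^bsub>fundamental_group X x\<^esub> homotopy_class X x v = homotopy_class X x (u @ v)"
proof -
  have r: "(w, w) \<in> homotopy X x" if "w \<in> loops_at X x" for w
    using that by (simp add: homotopy_def)
  have "homotopy X x `` {a @ b | a b. (u, a) \<in> homotopy X x \<and> (v, b) \<in> homotopy X x} = homotopy X x `` {u @ v}"
  proof
    show "homotopy X x `` {a @ b | a b. (u, a) \<in> homotopy X x \<and> (v, b) \<in> homotopy X x} \<subseteq> homotopy X x `` {u @ v}"
      using homotopy_append[OF X, of u _ x v] equiv_homotopy[of X x] by (auto elim!: equivE dest: transD)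
    show "homotopy X x `` {u @ v} \<subseteq> homotopy X x `` {a @ b | a b. (u, a) \<in> homotopy X x \<and> (v, b) \<in> homotopy X x}"
      using r[OF assms(2)] r[OF assms(3)] by blast
  qed
  then show ?thesis
    by (simp add: fundamental_group_def homotopy_class_def)
qed

lemma fundamental_group_carrierE:
  assumes "\<gamma> \<in> carrier (fundamental_group X x)"
  obtains w where "w \<in> loops_at X x" "\<gamma> = homotopy_class X x w"
  using assms by (auto simp: fundamental_group_def homotopy_class_def elim: quotientE)

lemma loop_power_Suc: "loop_power w (Suc k) = loop_power w k @ w"
  by (simp add: loop_power_def replicate_append_same[symmetric])

lemma homotopy_class_loop_power:
  assumes "wf_digraph X" "x \<in> verts X" "w \<in> loops_at X x"
  shows "homotopy_class X x (loop_power w k) = homotopy_class X x w [^]\<^bsub>fundamental_group X x\<^esub> k"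
proof (induction k)
  case 0
  have "homotopy_class X x [] = \<one>\<^bsub>fundamental_group X x\<^esub>" by (simp add: fundamental_group_def)
  then show ?case by (simp add: loop_power_def nat_pow_def)
next
  case (Suc k)
  then show ?case
    using homotopy_class_append[OF assms(1) loop_power_loops_at[OF assms, of k] assms(3)]
    by (simp add: loop_power_Suc nat_pow_def)
qed

lemma map_path_append [simp]: "map_path h (u @ v) = map_path h u @ map_path h v"
  by (simp add: map_path_def)

section \<open>Covers and lifting of paths\<close>

locale graph_cover =
  fixes Y :: "('w, 'f) pre_digraph" and X :: "('v, 'e) pre_digraph" and pv pa
  assumes Y: "wf_digraph Y" and X: "wf_digraph X" and cover: "cover Y X pv pa"
begin

lemma pa_in: "e \<in> arcs Y \<Longrightarrow> pa e \<in> arcs X"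
  using cover by (auto simp: cover_def)

lemma pv_in: "y \<in> verts Y \<Longrightarrow> pv y \<in> verts X"
  using cover by (auto simp: cover_def)

lemma pv_ends: "fst a \<in> arcs Y \<Longrightarrow> src X (map_prod pa id a) = pv (src Y a) \<and> trg X (map_prod pa id a) = pv (trg Y a)"
  using cover by (auto simp: cover_def src_def trg_def)

lemma edge_path_project: "edge_path Y y u y' \<Longrightarrow> edge_path X (pv y) (map_path pa u) (pv y')"
proof (induction u arbitrary: y)
  case (Cons a u)
  then show ?case using Y X pv_ends[of a] pa_in by (auto simp: map_path_def)
qed (use Y X pv_in in \<open>auto simp: map_path_def\<close>)

lemma loops_at_project: "u \<in> loops_at Y y \<Longrightarrow> map_path pa u \<in> loops_at X (pv y)"
  using edge_path_project by (auto simp: loops_at_iff)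

text \<open>The sign of a letter tells whether the outgoing or the incoming star is concerned, and
  equal images have equal signs. The separation matters for an arc that is a loop, which lies in
  both stars as two different letters.\<close>

lemma star_unique:
  assumes "fst a \<in> arcs Y" "fst b \<in> arcs Y" "src Y a = src Y b" "map_prod pa id a = map_prod pa id b"
  shows "a = b"
proof -
  let ?y = "src Y a"
  have y: "?y \<in> verts Y"
    using assms(1) wf_digraph.tail_in_verts[OF Y] wf_digraph.head_in_verts[OF Y] by (auto simp: src_def)
  then have "inj_on pa (out_arcs Y ?y)" "inj_on pa (in_arcs Y ?y)"
    using cover by (auto simp: cover_def bij_betw_def)
  moreover obtain e s e' where "a = (e, s)" "b = (e', s)"
    using assms(4) by (cases a; cases b) auto
  ultimately show ?thesis
    using assms by (cases s) (auto simp: src_def inj_on_def)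
qed

lemma star_lift:
  assumes "y \<in> verts Y" "fst a \<in> arcs X" "src X a = pv y"
  shows "\<exists>b. fst b \<in> arcs Y \<and> src Y b = y \<and> map_prod pa id b = a"
proof -
  have im: "pa ` out_arcs Y y = out_arcs X (pv y)" "pa ` in_arcs Y y = in_arcs X (pv y)"
    using assms(1) cover by (auto simp: cover_def bij_betw_def)
  obtain e s where a: "a = (e, s)" by fastforce
  show ?thesis
  proof (cases s)
    case True
    then have "e \<in> pa ` out_arcs Y y" using assms a im by (simp add: src_def)
    then obtain e' where "e' \<in> arcs Y" "tail Y e' = y" "pa e' = e" by auto
    then show ?thesis using True a by (intro exI[of _ "(e', True)"]) (auto simp: src_def)
  next
    case False
    then have "e \<in> pa ` in_arcs Y y" using assms a im by (simp add: src_def)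
    then obtain e' where "e' \<in> arcs Y" "head Y e' = y" "pa e' = e" by auto
    then show ?thesis using False a by (intro exI[of _ "(e', False)"]) (auto simp: src_def)
  qed
qed

lemma lift_unique:
  "\<lbrakk>edge_path Y y u y1; edge_path Y y u' y2; map_path pa u = map_path pa u'\<rbrakk> \<Longrightarrow> u = u'"
proof (induction u arbitrary: u' y)
  case (Cons a u)
  then obtain b v where u': "u' = b # v" by (cases u') (auto simp: map_path_def)
  then have "a = b" using Cons.prems star_unique[of a b] Y by (auto simp: map_path_def)
  then show ?case using Cons u' Y by (auto simp: map_path_def)
qed (simp add: map_path_def)

end

section \<open>Homology classes of loops\<close>

lemma homology_class_append: "homology_class (u @ v) = homology_class u + homology_class v"
  by (auto simp: homology_class_def fun_eq_iff)

lemma homology_class_Nil [simp]: "homology_class [] = 0"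
  by (auto simp: homology_class_def fun_eq_iff)

lemma homology_class_cancel: "homology_class [a, flip a] = 0"
  by (cases a) (auto simp: homology_class_def fun_eq_iff flip_def)

lemma homology_class_reverse: "homology_class (map flip (rev w)) = - homology_class w"
proof (induction w)
  case (Cons a w)
  have "homology_class [flip a] = - homology_class [a]"
    by (cases a) (auto simp: homology_class_def fun_eq_iff flip_def)
  then show ?case
    using Cons homology_class_append[of "[a]" w] by (simp add: homology_class_append fun_eq_iff)
qed simp

context graph_cover
begin

text \<open>A backtrack lifts to a backtrack, which contributes 0 to homology. To insert one, lift
  its first letter at the point reached so far; to delete one, use that the lift of
  \<open>flip a\<close> is forced.\<close>

lemma backtrack_lift:
  assumes "(w, w') \<in> backtrack X (pv y) \<or> (w', w) \<in> backtrack X (pv y)" "u \<in> loops_at Y y" "map_path pa u = w"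
  shows "\<exists>u' \<in> loops_at Y y. map_path pa u' = w' \<and> homology_class u' = homology_class u"
  using assms(1)
proof
  assume "(w, w') \<in> backtrack X (pv y)"
  then obtain p a q where w: "w = p @ q" "w' = p @ [a, flip a] @ q" "w' \<in> loops_at X (pv y)"
    by (rule backtrackE)
  obtain p' q' where u: "u = p' @ q'" "map_path pa p' = p" "map_path pa q' = q"
    using assms(3) w(1) by (auto simp: map_path_def map_eq_append_conv)
  obtain m where m: "edge_path Y y p' m" "edge_path Y m q' y"
    using assms(2) u(1) Y by (auto simp: loops_at_iff edge_path_append)
  have "edge_path X (pv y) p (pv m)" using edge_path_project[OF m(1)] u(2) by simp
  moreover obtain m' where m': "edge_path X (pv y) p m'" "edge_path X m' ([a, flip a] @ q) (pv y)"
    using w(2,3) X by (auto simp: loops_at_iff edge_path_append)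
  ultimately have "m' = pv m" using edge_path_unique_end[OF X] by blast
  then have "fst a \<in> arcs X" "src X a = pv m" using m'(2) X by auto
  then obtain b where b: "fst b \<in> arcs Y" "src Y b = m" "map_prod pa id b = a"
    using star_lift edge_path_verts[OF Y m(1)] by blast
  let ?u = "p' @ [b, flip b] @ q'"
  have "edge_path Y m ([b, flip b] @ q') y" using b m(2) Y by auto
  then have "?u \<in> loops_at Y y"
    using m(1) Y by (auto simp: loops_at_iff edge_path_append)
  moreover have "map_path pa ?u = w'"
    using u w(2) b(3) map_prod_flip[of pa b] by (simp add: map_path_def)
  moreover have "homology_class ?u = homology_class u"
    using u(1) by (simp add: homology_class_append[of p'] homology_class_append[of "[b, flip b]", simplified] homology_class_cancel)
  ultimately show ?thesis by blast
next
  assume "(w', w) \<in> backtrack X (pv y)"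
  then obtain p a q where w: "w' = p @ q" "w = p @ [a, flip a] @ q"
    by (rule backtrackE)
  have "map (map_prod pa id) u = p @ ([a, flip a] @ q)" using assms(3) w(2) by (simp add: map_path_def)
  then obtain p' r where u: "u = p' @ r" "map_path pa p' = p" "map (map_prod pa id) r = [a, flip a] @ q"
    by (auto simp: map_path_def map_eq_append_conv)
  then obtain b c q' where r: "r = b # c # q'" "map_prod pa id b = a" "map_prod pa id c = flip a" "map_path pa q' = q"
    by (auto simp: map_path_def map_eq_Cons_conv)
  obtain m where m: "edge_path Y y p' m" "edge_path Y m r y"
    using assms(2) u(1) Y by (auto simp: loops_at_iff edge_path_append)
  then have bc: "fst b \<in> arcs Y" "src Y b = m" "fst c \<in> arcs Y" "src Y c = trg Y b" "edge_path Y (trg Y c) q' y"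
    using r(1) Y by auto
  \<comment> \<open>Both letters start at the end of \<open>b\<close> and lie over the same
    letter.\<close>
  have "c = flip b"
    by (rule star_unique) (use bc r(2,3) map_prod_flip[of pa b] in simp_all)
  then have "edge_path Y m q' y" using bc by simp
  then have "p' @ q' \<in> loops_at Y y" using m(1) Y by (auto simp: loops_at_iff edge_path_append)
  moreover have "map_path pa (p' @ q') = w'" using u r w by simp
  moreover have "homology_class (p' @ q') = homology_class u"
    using u(1) r(1) \<open>c = flip b\<close>
    by (simp add: homology_class_append[of p'] homology_class_append[of "[b, flip b]", simplified] homology_class_cancel)
  ultimately show ?thesis by blast
qed

lemma homotopy_lift:
  assumes "(w, w') \<in> homotopy X (pv y)" "u \<in> loops_at Y y" "map_path pa u = w"
  shows "\<exists>u' \<in> loops_at Y y. map_path pa u' = w' \<and> homology_class u' = homology_class u"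
  using assms(1)
proof (induction rule: homotopy_induct)
  case refl
  then show ?case using assms by blast
next
  case (step v v')
  then obtain u' where "u' \<in> loops_at Y y" "map_path pa u' = v" "homology_class u' = homology_class u" by blast
  then show ?case using backtrack_lift[OF step(2)] by metis
qed

text \<open>Makes the homology class in \<open>Y\<close> a function on
  \<open>covering_subgroup\<close>, so that functionals on homology become functions on the kernel
  of \<phi>. A homotopy in \<open>X\<close> lifts without changing the class, and the final lift is
  unique.\<close>

lemma homology_class_well_defined:
  assumes "u \<in> loops_at Y y" "u' \<in> loops_at Y y"
    and "homotopy_class X (pv y) (map_path pa u) = homotopy_class X (pv y) (map_path pa u')"
  shows "homology_class u = homology_class u'"
proof -
  have "(map_path pa u, map_path pa u') \<in> homotopy X (pv y)"
    using homotopy_class_eq_iff[OF loops_at_project[OF assms(1)] loops_at_project[OF assms(2)]] assms(3) by simp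
  then obtain v where v: "v \<in> loops_at Y y" "map_path pa v = map_path pa u'" "homology_class v = homology_class u"
    using homotopy_lift assms(1) by blast
  then have "v = u'" using lift_unique assms(2) by (auto simp: loops_at_iff)
  then show ?thesis using v by simp
qed

text \<open>A loop that is homotopic to the projection of a closed loop lifts to a closed loop
  itself, because the homotopy lifts.\<close>

lemma closed_lift_iff:
  assumes "w \<in> loops_at X (pv y)"
  shows "(\<exists>u. closed_lift Y pa y w u) \<longleftrightarrow> homotopy_class X (pv y) w \<in> covering_subgroup Y X pv pa y"
proof
  assume "\<exists>u. closed_lift Y pa y w u"
  then show "homotopy_class X (pv y) w \<in> covering_subgroup Y X pv pa y"
    by (auto simp: closed_lift_def covering_subgroup_def)
next
  assume "homotopy_class X (pv y) w \<in> covering_subgroup Y X pv pa y"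
  then obtain u where u: "u \<in> loops_at Y y" "homotopy_class X (pv y) w = homotopy_class X (pv y) (map_path pa u)"
    by (auto simp: covering_subgroup_def)
  then have "(map_path pa u, w) \<in> homotopy X (pv y)"
    using homotopy_class_eq_iff[OF loops_at_project[OF u(1)] assms] by simp
  then show "\<exists>u. closed_lift Y pa y w u"
    using homotopy_lift[OF _ u(1)] by (auto simp: closed_lift_def)
qed

end

section \<open>Boundaries, cycles and spanning loops\<close>

lemma boundary_add: "boundary Y (c + d) = boundary Y c + boundary Y d"
  by (auto simp: boundary_def fun_eq_iff sum.distrib)

lemma boundary_scale: "boundary Y (chain_scale a c) = chain_scale a (boundary Y c)"
  by (auto simp: boundary_def chain_scale_def fun_eq_iff sum_distrib_left right_diff_distrib)

lemma subspace_H1: "chains.subspace (H1 Y)"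
  unfolding chains.subspace_def
  by (auto simp: H1_def one_chains_def boundary_add boundary_scale)
    (simp_all add: boundary_def chain_scale_def fun_eq_iff)

lemma boundary_homology_class:
  assumes Y: "fin_digraph Y" and "edge_path Y u w v"
  shows "boundary Y (homology_class w) = (\<lambda>x. of_bool (x = v) - of_bool (x = u))"
proof -
  interpret fin_digraph Y by fact
  have wf: "wf_digraph Y" by unfold_locales
  have single: "boundary Y (homology_class [a]) = (\<lambda>x. of_bool (x = trg Y a) - of_bool (x = src Y a))"
    if a: "fst a \<in> arcs Y" for a
  proof
    fix x
    obtain e s where es: "a = (e, s)" by fastforce
    have h: "homology_class [a] = (\<lambda>e'. if e' = e then if s then 1 else - 1 else 0)"
      using es by (auto simp: homology_class_def)
    have "(\<Sum>e'\<in>in_arcs Y x. homology_class [a] e') = (if head Y e = x then if s then 1 else - 1 else 0)"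
      unfolding h using a es by (subst sum.delta) auto
    moreover have "(\<Sum>e'\<in>out_arcs Y x. homology_class [a] e') = (if tail Y e = x then if s then 1 else - 1 else 0)"
      unfolding h using a es by (subst sum.delta) auto
    ultimately show "boundary Y (homology_class [a]) x = of_bool (x = trg Y a) - of_bool (x = src Y a)"
      using es by (auto simp: boundary_def src_def trg_def)
  qed
  show ?thesis
    using assms(2)
  proof (induction w arbitrary: u)
    case Nil
    then show ?case using wf by (auto simp: boundary_def fun_eq_iff)
  next
    case (Cons a w)
    then have a: "fst a \<in> arcs Y" "src Y a = u" "edge_path Y (trg Y a) w v" using wf by auto
    show ?case
    proof
      fix x
      have "homology_class (a # w) = homology_class [a] + homology_class w"
        using homology_class_append[of "[a]" w] by (simp only: append_Cons append_Nil)
      then have "boundary Y (homology_class (a # w)) x = boundary Y (homology_class [a]) x + boundary Y (homology_class w) x"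
        by (simp only: boundary_add plus_fun_apply)
      then show "boundary Y (homology_class (a # w)) x = of_bool (x = v) - of_bool (x = u)"
        unfolding single[OF a(1)] Cons.IH[OF a(3)] a(2) by simp
    qed
  qed
qed

lemma edge_path_arcs: "\<lbrakk>wf_digraph Y; edge_path Y u w v\<rbrakk> \<Longrightarrow> set w \<subseteq> arcs Y \<times> UNIV"
  by (induction w arbitrary: u) (auto simp: mem_Times_iff)

lemma homology_class_in_H1:
  assumes "fin_digraph Y" "w \<in> loops_at Y y"
  shows "homology_class w \<in> H1 Y"
proof -
  have wf: "wf_digraph Y" using assms(1) by (simp add: fin_digraph_def)
  have w: "edge_path Y y w y" using assms(2) by (simp add: loops_at_iff)
  have "homology_class w e = 0" if "e \<notin> arcs Y" for e
  proof -
    have "(e, s) \<notin> set w" for s using edge_path_arcs[OF wf w] that by auto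
    then show ?thesis by (simp add: homology_class_def)
  qed
  then show ?thesis
    using boundary_homology_class[OF assms(1) w] by (auto simp: H1_def one_chains_def fun_eq_iff)
qed

text \<open>Connectedness refers to the symmetric closure of the digraph, and a step there is an arc
  traversed in one direction or the other.\<close>

lemma connected_edge_path:
  assumes "wf_digraph Y" "connected Y" "u \<in> verts Y" "v \<in> verts Y"
  shows "\<exists>w. edge_path Y u w v"
proof -
  have "(u, v) \<in> (parcs (mk_symmetric Y))\<^sup>*"
    using assms(2-4) reachable_rtranclI[of "with_proj (mk_symmetric Y)" u v]
    by (auto simp: connected_def strongly_connected_def)
  then show ?thesis
  proof induction
    case base
    then show ?case using assms by (intro exI[of _ "[]"]) simp
  next
    case (step x y)
    then obtain w where w: "edge_path Y u w x" by blast
    obtain e where e: "e \<in> arcs Y" "(x, y) = (tail Y e, head Y e) \<or> (x, y) = (head Y e, tail Y e)"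
      using step(2) by (auto simp: mk_symmetric_def)
    then have "\<exists>s. src Y (e, s) = x \<and> trg Y (e, s) = y" by (auto simp: src_def trg_def)
    then obtain s where s: "src Y (e, s) = x" "trg Y (e, s) = y" by blast
    have "y \<in> verts Y"
      using e wf_digraph.tail_in_verts[OF assms(1)] wf_digraph.head_in_verts[OF assms(1)] by auto
    then have "edge_path Y x [(e, s)] y" using s e(1) assms(1) by simp
    then have "edge_path Y u (w @ [(e, s)]) y" using w edge_path_append[OF assms(1)] by blast
    then show ?case by blast
  qed
qed

text \<open>Closing up each arc by paths \<open>T\<close> from the base point writes a cycle \<open>c\<close> as
  \<open>\<Sum>e. c e [T (tail e) \<cdot> e \<cdot> T (head e)\<inverse>]\<close>: the contributions of the paths add up to the boundary of \<open>c\<close>.\<close>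

lemma H1_span_loops:
  assumes Y: "fin_digraph Y" "connected Y" "y \<in> verts Y" and c: "c \<in> H1 Y"
  shows "c \<in> chains.span (homology_class ` loops_at Y y)"
proof -
  interpret fin_digraph Y by fact
  have wf: "wf_digraph Y" by unfold_locales
  obtain T where T: "\<And>v. v \<in> verts Y \<Longrightarrow> edge_path Y y (T v) v"
    using connected_edge_path[OF wf Y(2,3)] by metis
  define l where "l e = T (tail Y e) @ [(e, True)] @ map flip (rev (T (head Y e)))" for e
  have l: "l e \<in> loops_at Y y" if "e \<in> arcs Y" for e
  proof -
    have "edge_path Y (head Y e) (map flip (rev (T (head Y e)))) y"
      using edge_path_reverse[OF wf T] that by simp
    then have "edge_path Y (tail Y e) ([(e, True)] @ map flip (rev (T (head Y e)))) y"
      using that wf by (simp add: src_def trg_def)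
    then show ?thesis
      using T[of "tail Y e"] that wf unfolding l_def by (auto simp: loops_at_iff edge_path_append)
  qed
  have hc: "homology_class (l e) x = of_bool (x = e) + (homology_class (T (tail Y e)) x - homology_class (T (head Y e)) x)" for e x
    unfolding l_def homology_class_append homology_class_reverse by (simp add: homology_class_def)
  have tails: "(\<Sum>e\<in>arcs Y. c e * g (tail Y e)) = (\<Sum>v\<in>verts Y. (\<Sum>e\<in>out_arcs Y v. c e) * g v)" for g :: "'a \<Rightarrow> complex"
  proof -
    have "(\<Sum>v\<in>verts Y. (\<Sum>e\<in>out_arcs Y v. c e) * g v) = (\<Sum>v\<in>verts Y. \<Sum>e\<in>{e \<in> arcs Y. tail Y e = v}. c e * g (tail Y e))"
      by (intro sum.cong) (auto simp: sum_distrib_right out_arcs_def)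
    then show ?thesis
      using sum.group[of "arcs Y" "verts Y" "tail Y" "\<lambda>e. c e * g (tail Y e)"] by (simp add: image_subset_iff)
  qed
  have heads: "(\<Sum>e\<in>arcs Y. c e * g (head Y e)) = (\<Sum>v\<in>verts Y. (\<Sum>e\<in>in_arcs Y v. c e) * g v)" for g :: "'a \<Rightarrow> complex"
  proof -
    have "(\<Sum>v\<in>verts Y. (\<Sum>e\<in>in_arcs Y v. c e) * g v) = (\<Sum>v\<in>verts Y. \<Sum>e\<in>{e \<in> arcs Y. head Y e = v}. c e * g (head Y e))"
      by (intro sum.cong) (auto simp: sum_distrib_right in_arcs_def)
    then show ?thesis
      using sum.group[of "arcs Y" "verts Y" "head Y" "\<lambda>e. c e * g (head Y e)"] by (simp add: image_subset_iff)
  qed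
  have cycle: "(\<Sum>e\<in>in_arcs Y v. c e) = (\<Sum>e\<in>out_arcs Y v. c e)" for v
    using c by (auto simp: H1_def boundary_def fun_eq_iff)
  have "c = (\<Sum>e\<in>arcs Y. chain_scale (c e) (homology_class (l e)))"
  proof
    fix x
    have "(\<Sum>e\<in>arcs Y. chain_scale (c e) (homology_class (l e))) x =
      (\<Sum>e\<in>arcs Y. c e * of_bool (x = e)) + ((\<Sum>e\<in>arcs Y. c e * homology_class (T (tail Y e)) x)
        - (\<Sum>e\<in>arcs Y. c e * homology_class (T (head Y e)) x))"
      by (simp add: sum_fun_apply chain_scale_def hc distrib_left right_diff_distrib sum.distrib sum_subtractf)
    also have "\<dots> = (\<Sum>e\<in>arcs Y. c e * of_bool (x = e))"
      unfolding tails[of "\<lambda>v. homology_class (T v) x"] heads[of "\<lambda>v. homology_class (T v) x"] by (simp add: cycle)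
    also have "\<dots> = (\<Sum>e\<in>arcs Y. if e = x then c x else 0)"
      by (intro sum.cong) auto
    also have "\<dots> = c x"
      using c by (simp add: H1_def one_chains_def)
    finally show "c x = (\<Sum>e\<in>arcs Y. chain_scale (c e) (homology_class (l e))) x" ..
  qed
  also have "\<dots> \<in> chains.span (homology_class ` loops_at Y y)"
    by (intro chains.span_sum chains.span_scale chains.span_base imageI l)
  finally show ?thesis .
qed

section \<open>Primitive homology\<close>

text \<open>Elements of \<open>Bij S\<close> have a fixed value outside \<open>S\<close>, so they
  are determined by finitely many choices.\<close>

lemma finite_Bij: "finite S \<Longrightarrow> finite (Bij S)"
proof (rule finite_subset)
  show "Bij S \<subseteq> S \<rightarrow>\<^sub>E S" by (auto simp: Bij_def PiE_def bij_betw_def)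
qed (rule finite_PiE)

lemma finite_deck_group:
  assumes "fin_digraph Y"
  shows "finite (carrier (deck_group Y pv pa))"
proof (rule finite_subset)
  show "carrier (deck_group Y pv pa) \<subseteq> Bij (verts Y) \<times> Bij (arcs Y)"
    by (auto simp: deck_group_def)
  show "finite (Bij (verts Y) \<times> Bij (arcs Y))"
    using assms by (intro finite_cartesian_product finite_Bij) (auto simp: fin_digraph.finite_verts fin_digraph.finite_arcs)
qed

lemma deck_edge_path:
  assumes Y: "wf_digraph Y" and st: "(s, t) \<in> carrier (deck_group Y pv pa)" and "edge_path Y u p v"
  shows "edge_path Y (s u) (map_path t p) (s v)"
  using assms(3)
proof (induction p arbitrary: u)
  case Nil
  then show ?case
    using Y st Bij_imp_funcset[of s "verts Y"] by (auto simp: deck_group_def map_path_def)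
next
  case (Cons a p)
  have "fst a \<in> arcs Y" "src Y a = u" "edge_path Y (trg Y a) p v" using Cons.prems Y by auto
  moreover have "t (fst a) \<in> arcs Y" "src Y (map_prod t id a) = s (src Y a)" "trg Y (map_prod t id a) = s (trg Y a)"
    using \<open>fst a \<in> arcs Y\<close> st Bij_imp_funcset[of t "arcs Y"]
    by (auto simp: deck_group_def src_def trg_def)
  ultimately show ?case
    using Cons.IH Y by (simp add: map_path_def)
qed

lemma H1_prim_subset_H1:
  assumes Y: "fin_digraph Y"
  shows "H1_prim Y X pv pa y \<subseteq> H1 Y"
  unfolding H1_prim_def
proof (rule chains.span_minimal[OF _ subspace_H1], safe)
  fix u w assume "u \<in> elevations Y pv pa y w"
  then obtain s t u0 where u: "u = map_path t u0" "(s, t) \<in> carrier (deck_group Y pv pa)" "u0 \<in> loops_at Y y"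
    by (auto simp: elevations_def preferred_elevation_def closed_lift_def)
  then have "u \<in> loops_at Y (s y)"
    using deck_edge_path[of Y s t] Y by (auto simp: loops_at_iff fin_digraph_def)
  then show "homology_class u \<in> H1 Y" by (rule homology_class_in_H1[OF Y])
qed

lemma preferred_elevation_in_elevations:
  assumes "wf_digraph Y" "preferred_elevation Y pa y w u"
  shows "u \<in> elevations Y pv pa y w"
proof -
  \<comment> \<open>The identity of the deck group is the extensional identity, not the identity
    function.\<close>
  let ?s = "\<lambda>v\<in>verts Y. v" and ?t = "\<lambda>e\<in>arcs Y. e"
  have "(?s, ?t) \<in> carrier (deck_group Y pv pa)"
    using assms(1) by (auto simp: deck_group_def id_Bij wf_digraph.tail_in_verts wf_digraph.head_in_verts)
  moreover have "set u \<subseteq> arcs Y \<times> UNIV"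
    using assms edge_path_arcs[OF assms(1)]
    by (auto simp: preferred_elevation_def closed_lift_def loops_at_iff)
  then have "map_path ?t u = u"
    unfolding map_path_def by (intro map_idI) auto
  ultimately show ?thesis
    using assms(2) unfolding elevations_def by (intro CollectI exI[of _ ?s] exI[of _ ?t] exI[of _ u]) simp
qed

text \<open>Adding \<open>c\<close> to a basis of \<open>S\<close> keeps it independent, so a
  functional may be prescribed as 1 at \<open>c\<close> and 0 on the basis.\<close>

lemma separating_functional:
  assumes "chains.subspace S" "c \<notin> S"
  obtains L where "Vector_Spaces.linear chain_scale ((*) :: complex \<Rightarrow> _) L" "\<And>s. s \<in> S \<Longrightarrow> L s = 0" "L c \<noteq> 0"
proof -
  interpret P: vector_space_pair "chain_scale :: complex \<Rightarrow> ('a \<Rightarrow> complex) \<Rightarrow> 'a \<Rightarrow> complex" "(*) :: complex \<Rightarrow> complex \<Rightarrow> complex"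
    by unfold_locales (auto simp: chain_scale_def fun_eq_iff algebra_simps)
  obtain B where B: "B \<subseteq> S" "chains.independent B" "S \<subseteq> chains.span B"
    using chains.basis_exists[of S] by metis
  have "chains.span B \<subseteq> S" using B(1) assms(1) by (rule chains.span_minimal)
  then have c: "c \<notin> chains.span B" using assms(2) by blast
  then have "chains.independent (insert c B)" using B(2) by (rule chains.independent_insertI)
  then obtain L where L: "Vector_Spaces.linear chain_scale ((*) :: complex \<Rightarrow> _) L"
    "\<forall>x \<in> insert c B. L x = (if x = c then 1 else 0)"
    using P.linear_independent_extend[of "insert c B" "\<lambda>x. if x = c then 1 else 0"] by blast
  have "c \<notin> B" using c chains.span_base by blast
  then have "L b = 0" if "b \<in> B" for b using L(2) that by auto
  then have "L s = 0" if "s \<in> S" for s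
    using P.linear_eq_0_on_span[OF L(1), of B s] B(3) that by blast
  then show thesis using that L by auto
qed

text \<open>A functional that separates a cycle from primitive homology, read on the kernel of
  \<phi>, is a homomorphism that \<open>kernel_hom_vanish\<close> forces to be 0. Loops at the base
  point span the cycles, so the functional is 0 as well.\<close>

theorem H1_prim_eq_H1:
  fixes X :: "('v, 'e) pre_digraph" and Y :: "('w, 'f) pre_digraph" and y\<^sub>0 :: 'w
    and pv :: "'w \<Rightarrow> 'v" and G :: "('g, 'm) monoid_scheme"
  defines "F \<equiv> fundamental_group X (pv y\<^sub>0)"
  assumes X: "fin_digraph X" and Y: "fin_digraph Y" "connected Y"
    and cov: "cover Y X pv pa" and y: "y\<^sub>0 \<in> verts Y"
    and G: "class2_group G" "finite (carrier G)"
    and \<phi>: "defining_surjection Y X pv pa y\<^sub>0 G \<phi>"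
    and F: "group F" "free_basis F B" "finite B" "B \<noteq> {}"
    and odd: "\<not> comm_group G \<Longrightarrow> odd (card B) \<and> (\<exists>p::nat. prime p \<and> (\<forall>z \<in> center G. z [^]\<^bsub>G\<^esub> p = \<one>\<^bsub>G\<^esub>))"
  shows "H1_prim Y X pv pa y\<^sub>0 = H1 Y"
proof
  show "H1_prim Y X pv pa y\<^sub>0 \<subseteq> H1 Y" by (rule H1_prim_subset_H1[OF Y(1)])
  have wfX: "wf_digraph X" and wfY: "wf_digraph Y" using X Y by (auto simp: fin_digraph_def)
  interpret C: graph_cover Y X pv pa
    using wfX wfY cov by (simp add: graph_cover_def)
  interpret F: group F by (rule F)
  interpret G: class2_group G by (rule G)
  let ?x = "pv y\<^sub>0"
  let ?\<pi> = "homotopy_class X ?x"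
  have x: "?x \<in> verts X" using C.pv_in[OF y] .
  have hom: "\<phi> \<in> hom F G" "\<phi> ` carrier F = carrier G" and ker: "kernel F G \<phi> = covering_subgroup Y X pv pa y\<^sub>0"
    using \<phi> by (auto simp: defining_surjection_def epi_def F_def)
  interpret h: group_hom F G \<phi> using hom(1) by unfold_locales
  have mult: "?\<pi> u \<otimes>\<^bsub>F\<^esub> ?\<pi> v = ?\<pi> (u @ v)" if "u \<in> loops_at X ?x" "v \<in> loops_at X ?x" for u v
    unfolding F_def by (rule homotopy_class_append[OF wfX that])
  show "H1 Y \<subseteq> H1_prim Y X pv pa y\<^sub>0"
  proof (rule subsetI, rule ccontr)
    fix c assume c: "c \<in> H1 Y" "c \<notin> H1_prim Y X pv pa y\<^sub>0"
    obtain L where L: "Vector_Spaces.linear chain_scale ((*) :: complex \<Rightarrow> _) L"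
      "\<And>s. s \<in> H1_prim Y X pv pa y\<^sub>0 \<Longrightarrow> L s = 0" "L c \<noteq> 0"
      using separating_functional[of "H1_prim Y X pv pa y\<^sub>0" c] c(2) unfolding H1_prim_def
      using chains.subspace_span by blast
    interpret L: Vector_Spaces.linear "chain_scale :: complex \<Rightarrow> ('f \<Rightarrow> complex) \<Rightarrow> 'f \<Rightarrow> complex" "(*) :: complex \<Rightarrow> complex \<Rightarrow> complex" L
      by (rule L(1))
    \<comment> \<open>A loop in \<open>Y\<close> representing a kernel element; which one is chosen
      does not affect its homology class.\<close>
    define lift where "lift k = (SOME u. u \<in> loops_at Y y\<^sub>0 \<and> ?\<pi> (map_path pa u) = k)" for k
    define f where "f k = L (homology_class (lift k))" for k
    have f_eq: "f (?\<pi> (map_path pa u)) = L (homology_class u)" if u: "u \<in> loops_at Y y\<^sub>0" for u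
    proof -
      have "lift (?\<pi> (map_path pa u)) \<in> loops_at Y y\<^sub>0 \<and> ?\<pi> (map_path pa (lift (?\<pi> (map_path pa u)))) = ?\<pi> (map_path pa u)"
        unfolding lift_def by (rule someI[of _ u]) (use u in simp)
      then show ?thesis
        using C.homology_class_well_defined[OF _ u] by (simp add: f_def)
    qed
    have kerE: "\<exists>u \<in> loops_at Y y\<^sub>0. k = ?\<pi> (map_path pa u)" if "k \<in> kernel F G \<phi>" for k
      using that unfolding ker covering_subgroup_def by blast
    have f_hom: "f (k \<otimes>\<^bsub>F\<^esub> l) = f k + f l" if kl: "k \<in> kernel F G \<phi>" "l \<in> kernel F G \<phi>" for k l
    proof -
      obtain u v where uv: "u \<in> loops_at Y y\<^sub>0" "k = ?\<pi> (map_path pa u)" "v \<in> loops_at Y y\<^sub>0" "l = ?\<pi> (map_path pa v)"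
        using kerE[OF kl(1)] kerE[OF kl(2)] by blast
      have "k \<otimes>\<^bsub>F\<^esub> l = ?\<pi> (map_path pa (u @ v))"
        unfolding uv using mult C.loops_at_project uv(1,3) by simp
      then have "f (k \<otimes>\<^bsub>F\<^esub> l) = L (homology_class u + homology_class v)"
        using f_eq[OF loops_at_append[OF wfY uv(1,3)]] by (simp only: homology_class_append)
      also have "\<dots> = f k + f l"
        unfolding uv f_eq[OF uv(1)] f_eq[OF uv(3)] by (rule L.add)
      finally show ?thesis .
    qed
    have K_one: "\<one>\<^bsub>F\<^esub> \<in> kernel F G \<phi>" by (simp add: kernel_def)
    have f_one: "f \<one>\<^bsub>F\<^esub> = 0"
      using f_hom[OF K_one K_one] by simp
    have K_pow: "k [^]\<^bsub>F\<^esub> (j::nat) \<in> kernel F G \<phi>" if "k \<in> kernel F G \<phi>" for k j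
      using that by (simp add: kernel_def h.hom_nat_pow)
    have f_pow: "f (k [^]\<^bsub>F\<^esub> (j::nat)) = of_nat j * f k" if "k \<in> kernel F G \<phi>" for k j
      by (induction j) (simp_all add: f_one f_hom[OF K_pow[OF that] that] algebra_simps)
    have f_prim: "f (\<gamma> [^]\<^bsub>F\<^esub> m) = 0" if \<gamma>: "primitive F \<gamma>" "\<gamma> [^]\<^bsub>F\<^esub> m \<in> kernel F G \<phi>" for \<gamma> and m :: nat
    proof -
      have \<gamma>F: "\<gamma> \<in> carrier F" using \<gamma>(1) free_basisD(1) by (auto simp: primitive_def)
      obtain w where w: "w \<in> loops_at X ?x" "\<gamma> = ?\<pi> w"
        using \<gamma>F fundamental_group_carrierE unfolding F_def by metis
      have pow: "?\<pi> (loop_power w k) = \<gamma> [^]\<^bsub>F\<^esub> k" for k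
        unfolding w(2) F_def by (rule homotopy_class_loop_power[OF wfX x w(1)])
      have lift_iff: "(\<exists>u. closed_lift Y pa y\<^sub>0 (loop_power w k) u) \<longleftrightarrow> \<gamma> [^]\<^bsub>F\<^esub> k \<in> kernel F G \<phi>" for k
        unfolding C.closed_lift_iff[OF loop_power_loops_at[OF wfX x w(1)]] ker pow ..
      \<comment> \<open>This exponent is the one in the preferred elevation, whose class
        \<open>L\<close> kills by assumption. It exists because the order of \<open>G\<close> is a
        candidate.\<close>
      define k :: nat where "k = (LEAST k. 1 \<le> k \<and> \<gamma> [^]\<^bsub>F\<^esub> k \<in> kernel F G \<phi>)"
      have "1 \<le> Coset.order G" using G(2) G.order_gt_0_iff_finite by (simp add: Suc_le_eq)
      moreover have "\<gamma> [^]\<^bsub>F\<^esub> Coset.order G \<in> kernel F G \<phi>"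
        using \<gamma>F by (simp add: kernel_def h.hom_nat_pow G.pow_order_eq_1)
      ultimately have "1 \<le> Coset.order G \<and> \<gamma> [^]\<^bsub>F\<^esub> Coset.order G \<in> kernel F G \<phi>" ..
      then have "1 \<le> k \<and> \<gamma> [^]\<^bsub>F\<^esub> k \<in> kernel F G \<phi>"
        unfolding k_def by (rule LeastI)
      then have k: "1 \<le> k" "\<gamma> [^]\<^bsub>F\<^esub> k \<in> kernel F G \<phi>" by simp_all
      have least: "k \<le> j" if "1 \<le> j" "\<gamma> [^]\<^bsub>F\<^esub> j \<in> kernel F G \<phi>" for j
        unfolding k_def using that by (intro Least_le) simp
      obtain u where u: "closed_lift Y pa y\<^sub>0 (loop_power w k) u" using lift_iff k(2) by blast
      then have "preferred_elevation Y pa y\<^sub>0 w u"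
        unfolding preferred_elevation_def using k(1) least lift_iff by blast
      then have "u \<in> elevations Y pv pa y\<^sub>0 w" by (rule preferred_elevation_in_elevations[OF wfY])
      then have "homology_class u \<in> H1_prim Y X pv pa y\<^sub>0"
        unfolding H1_prim_def using w \<gamma>(1) by (intro chains.span_base) (auto simp: F_def)
      then have "f (?\<pi> (map_path pa u)) = 0"
        using f_eq[of u] u L(2) by (auto simp: closed_lift_def)
      then have fk: "f (\<gamma> [^]\<^bsub>F\<^esub> k) = 0"
        using u pow by (simp add: closed_lift_def)
      \<comment> \<open>Passes from the least exponent \<open>k\<close> to an arbitrary
        \<open>m\<close> by computing \<open>f\<close> at the power \<open>m * k\<close> in two
        ways, without a divisibility argument.\<close>
      have "of_nat k * f (\<gamma> [^]\<^bsub>F\<^esub> m) = f (\<gamma> [^]\<^bsub>F\<^esub> (m * k))"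
        using f_pow[OF \<gamma>(2), of k] \<gamma>F by (simp add: F.nat_pow_pow)
      also have "\<dots> = of_nat m * f (\<gamma> [^]\<^bsub>F\<^esub> k)"
        using f_pow[OF k(2), of m] \<gamma>F by (simp add: F.nat_pow_pow mult.commute)
      finally show ?thesis using fk k(1) by simp
    qed
    have L0: "L (homology_class u) = 0" if u: "u \<in> loops_at Y y\<^sub>0" for u
    proof -
      have "?\<pi> (map_path pa u) \<in> kernel F G \<phi>"
        unfolding ker covering_subgroup_def using u by blast
      then have "f (?\<pi> (map_path pa u)) = 0"
      proof (rule kernel_hom_vanish[OF F G hom, rotated -1])
        show "odd (card B) \<and> (\<exists>p::nat. prime p \<and> (\<forall>z \<in> center G. z [^]\<^bsub>G\<^esub> p = \<one>\<^bsub>G\<^esub>))" if "\<not> comm_group G"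
          using odd[OF that] .
        show "f (k \<otimes>\<^bsub>F\<^esub> l) = f k + f l" if "k \<in> kernel F G \<phi>" "l \<in> kernel F G \<phi>" for k l
          using f_hom[OF that] .
        show "f (\<gamma> [^]\<^bsub>F\<^esub> m) = 0" if "primitive F \<gamma>" "\<gamma> [^]\<^bsub>F\<^esub> m \<in> kernel F G \<phi>" for \<gamma> and m :: nat
          using f_prim[OF that] .
      qed
      then show ?thesis using f_eq[OF u] by simp
    qed
    have "c \<in> chains.span (homology_class ` loops_at Y y\<^sub>0)"
      by (rule H1_span_loops[OF Y y c(1)])
    then have "L c = 0"
      by (rule L.eq_0_on_span[rotated]) (use L0 in auto)
    then show False using L(3) by simp
  qed
qed

section \<open>Primitive fixed vectors in matrix representations\<close>

lemma rep_primitive_fixed_vector: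
  fixes G :: "('g, 'm) monoid_scheme"
  assumes F: "group F" "free_basis F B" "3 \<le> card B" and \<phi>: "\<phi> \<in> hom F G"
    and G: "class2_group G" "finite (carrier G)" and \<rho>: "\<rho> \<in> hom G (GL d)" "d \<noteq> 0"
  shows "\<exists>\<gamma> v. primitive F \<gamma> \<and> v \<in> carrier_vec d \<and> v \<noteq> 0\<^sub>v d \<and> \<rho> (\<phi> \<gamma>) *\<^sub>v v = v"
proof -
  interpret class2_group G by (rule G)
  have GL: "carrier (GL d) \<subseteq> carrier_mat d d" "\<one>\<^bsub>GL d\<^esub> = 1\<^sub>m d" "mult (GL d) = (*)"
    by (auto simp: GL_def units_of_def Units_def ring_mat_def)
  have "ring (ring_mat TYPE(complex) d ())" by (rule ring_mat)
  then have "group (GL d)"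
    unfolding GL_def by (intro monoid.units_group) (simp add: ring_def)
  have \<rho>c: "\<rho> g \<in> carrier_mat d d" if "g \<in> carrier G" for g
    using \<rho>(1) GL(1) that by (auto simp: hom_def)
  have \<rho>m: "\<rho> (g \<otimes>\<^bsub>G\<^esub> h) = \<rho> g * \<rho> h" if "g \<in> carrier G" "h \<in> carrier G" for g h
    using \<rho>(1) that GL(3) by (simp add: hom_def)
  have \<rho>1: "\<rho> \<one>\<^bsub>G\<^esub> = 1\<^sub>m d"
    using hom_one[OF \<rho>(1) is_group \<open>group (GL d)\<close>] GL(2) by simp
  \<comment> \<open>A copy of the coordinate space of dimension \<open>d\<close> inside the
    functions on the natural numbers.\<close>
  define W where "W = {v :: nat \<Rightarrow> complex. \<forall>i \<ge> d. v i = 0}"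
  \<comment> \<open>The inverse turns the left action of matrices into the right action required by
    \<open>fin_rep\<close>.\<close>
  define act where "act g v = (\<lambda>i. if i < d then (\<rho> (inv\<^bsub>G\<^esub> g) *\<^sub>v vec d v) $ i else 0)" for g and v :: "nat \<Rightarrow> complex"
  have vec_act: "vec d (act g v) = \<rho> (inv\<^bsub>G\<^esub> g) *\<^sub>v vec d v" if "g \<in> carrier G" for g v
    using \<rho>c[of "inv\<^bsub>G\<^esub> g"] that by (intro eq_vecI) (auto simp: act_def)
  have W_eq: "u = v" if "u \<in> W" "v \<in> W" "vec d u = vec d v" for u v
  proof
    fix i show "u i = v i"
      using that by (cases "i < d") (auto simp: W_def dest!: arg_cong[where f = "\<lambda>w. w $ i"])
  qed
  have act_W: "act g v \<in> W" for g v by (simp add: act_def W_def)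
  have sub: "chains.subspace W" by (auto simp: chains.subspace_def W_def chain_scale_def)
  have rep: "fin_rep G W act"
  proof unfold_locales
    fix g assume g: "g \<in> carrier G"
    have add: "act g (u + v) = act g u + act g v" if "u \<in> W" "v \<in> W" for u v
    proof -
      have "vec d (u + v) = vec d u + vec d v" by auto
      then show ?thesis
        using \<rho>c[of "inv\<^bsub>G\<^esub> g"] g by (auto simp: act_def fun_eq_iff mult_add_distrib_mat_vec[of _ d d])
    qed
    have scale: "act g (chain_scale c v) = chain_scale c (act g v)" for c v
    proof -
      have "vec d (chain_scale c v) = c \<cdot>\<^sub>v vec d v" by (auto simp: chain_scale_def)
      then show ?thesis
        using \<rho>c[of "inv\<^bsub>G\<^esub> g"] g by (auto simp: act_def chain_scale_def fun_eq_iff mult_mat_vec[of _ d d])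
    qed
    show "linear_endo W (act g)"
      using sub act_W add scale by (simp add: linear_endo_def)
  next
    fix v assume v: "v \<in> W"
    show "act \<one>\<^bsub>G\<^esub> v = v"
      by (rule W_eq[OF act_W v]) (simp add: vec_act \<rho>1)
  next
    fix g h v assume g: "g \<in> carrier G" "h \<in> carrier G"
    show "act (g \<otimes>\<^bsub>G\<^esub> h) v = act h (act g v)"
      using g \<rho>c by (intro W_eq act_W) (simp add: vec_act inv_mult_group \<rho>m assoc_mult_mat_vec[of _ d d _ d])
  qed (use G(2) sub in auto)
  have "(\<lambda>i. if i = 0 then 1 else 0) \<in> W" "(\<lambda>i. if i = 0 then 1 else 0) \<noteq> (0 :: nat \<Rightarrow> complex)"
    using \<rho>(2) by (auto simp: W_def fun_eq_iff)
  then have "W \<noteq> {0}" by blast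
  then obtain \<gamma> v where \<gamma>: "primitive F \<gamma>" "v \<in> W" "v \<noteq> 0" "act (\<phi> \<gamma>) v = v"
    using primitive_fixing_vector[OF F \<phi> G(1) rep] by blast
  have "\<gamma> \<in> carrier F" using \<gamma>(1) free_basisD(1) by (auto simp: primitive_def)
  then have g: "\<phi> \<gamma> \<in> carrier G" using \<phi> by (auto simp: hom_def)
  \<comment> \<open>So far the vector is fixed by the matrix of the inverse; applying the matrix of
    \<open>\<phi> \<gamma>\<close> removes the inverse.\<close>
  have "\<rho> (\<phi> \<gamma>) *\<^sub>v vec d v = \<rho> (\<phi> \<gamma>) *\<^sub>v (\<rho> (inv\<^bsub>G\<^esub> \<phi> \<gamma>) *\<^sub>v vec d v)"
    using vec_act[OF g, of v] \<gamma>(4) by simp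
  also have "\<dots> = \<rho> (\<phi> \<gamma> \<otimes>\<^bsub>G\<^esub> inv\<^bsub>G\<^esub> \<phi> \<gamma>) *\<^sub>v vec d v"
    using \<rho>c[OF g] \<rho>c[of "inv\<^bsub>G\<^esub> \<phi> \<gamma>"] g by (subst \<rho>m) (auto simp: assoc_mult_mat_vec[of _ d d _ d])
  also have "\<dots> = vec d v" using g \<rho>1 by simp
  finally have "\<rho> (\<phi> \<gamma>) *\<^sub>v vec d v = vec d v" .
  moreover have "vec d v \<noteq> 0\<^sub>v d"
  proof
    assume "vec d v = 0\<^sub>v d"
    then have "vec d v = vec d 0" by auto
    moreover have "0 \<in> W" by (simp add: W_def)
    ultimately show False using W_eq[OF \<gamma>(2)] \<gamma>(3) by blast
  qed
  ultimately show ?thesis using \<gamma>(1) by (intro exI[of _ \<gamma>] exI[of _ "vec d v"]) simp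
qed

text \<open>An isomorphism class contains the representation that defines it, with the identity
  matrix as intertwiner.\<close>

lemma Irr_representative:
  assumes "C \<in> Irr G"
  obtains d \<rho> where "(d, \<rho>) \<in> C" "\<rho> \<in> hom G (GL d)" "d \<noteq> 0"
proof -
  obtain V where V: "irreducible_rep G V" "C = Restr (rep_iso G) {V. irreducible_rep G V} `` {V}"
    using assms by (auto simp: Irr_def quotient_def)
  obtain d \<rho> where d: "V = (d, \<rho>)" by fastforce
  have \<rho>: "\<rho> \<in> hom G (GL d)" "d \<noteq> 0" using V(1) d by (auto simp: irreducible_rep_def)
  have c: "\<rho> g \<in> carrier_mat d d" if "g \<in> carrier G" for g
    using \<rho>(1) that by (auto simp: hom_def GL_def units_of_def Units_def ring_mat_def)
  have "1\<^sub>m d \<in> carrier (GL d)"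
    by (auto simp: GL_def units_of_def Units_def ring_mat_def intro!: bexI[of _ "1\<^sub>m d"])
  then have "(V, V) \<in> rep_iso G"
    using c by (auto simp: rep_iso_def d left_mult_one_mat[of _ d d] right_mult_one_mat[of _ d d]
        intro!: bexI[of _ "1\<^sub>m d"])
  then have "(d, \<rho>) \<in> C" using V d by auto
  then show thesis using that \<rho> by blast
qed

theorem theorem1p6:
  fixes X :: "('v, 'e) pre_digraph" and Y :: "('w, 'f) pre_digraph"
    and pv :: "'w \<Rightarrow> 'v" and pa :: "'f \<Rightarrow> 'e" and y\<^sub>0 :: 'w
    and G :: "('g, 'm) monoid_scheme" and \<phi> :: "('e \<times> bool) list set \<Rightarrow> 'g" and n :: nat
  assumes "fin_digraph X" "connected X" "fin_digraph Y" "connected Y"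
    and "normal_cover Y X pv pa" and "y\<^sub>0 \<in> verts Y"
    and "group G" and "deck_group Y pv pa \<cong> G"
    and "defining_surjection Y X pv pa y\<^sub>0 G \<phi>"
    and "free_of_rank (fundamental_group X (pv y\<^sub>0)) n" and "n \<ge> 3"
    and "comm_group G \<or> two_step_nilpotent G"
  shows "Irr_pr (fundamental_group X (pv y\<^sub>0)) \<phi> G = Irr G \<and>
    ((\<not> comm_group G \<longrightarrow> odd n \<and>
        (\<forall>H. subgroup H G \<and> H \<subseteq> center G \<and> cyclic_group (subgroup_generated G H) \<and>
           H \<noteq> {\<one>\<^bsub>G\<^esub>} \<longrightarrow> prime (card H)))
      \<longrightarrow> H1_prim Y X pv pa y\<^sub>0 = H1 Y)"
proof -
  let ?F = "fundamental_group X (pv y\<^sub>0)"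
  obtain B where B: "group ?F" "free_basis ?F B" "finite B" "card B = n"
    using assms(10) by (auto simp: free_of_rank_def)
  have G: "class2_group G"
    using assms(12) comm_group_class2 two_step_nilpotent_class2 by blast
  \<comment> \<open>\<open>G\<close> is finite because a deck transformation of a finite graph is a
    pair of bijections of finite sets.\<close>
  obtain h where "bij_betw h (carrier (deck_group Y pv pa)) (carrier G)"
    using assms(8) by (auto simp: is_iso_def iso_def)
  then have fin: "finite (carrier G)"
    using bij_betw_finite finite_deck_group[OF assms(3)] by blast
  have hom: "\<phi> \<in> hom ?F G" using assms(9) by (auto simp: defining_surjection_def epi_def)
  have "C \<in> Irr_pr ?F \<phi> G" if C: "C \<in> Irr G" for C
  proof -
    obtain d \<rho> where \<rho>: "(d, \<rho>) \<in> C" "\<rho> \<in> hom G (GL d)" "d \<noteq> 0"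
      using C by (rule Irr_representative)
    have "\<exists>\<gamma> v. primitive ?F \<gamma> \<and> v \<in> carrier_vec d \<and> v \<noteq> 0\<^sub>v d \<and> \<rho> (\<phi> \<gamma>) *\<^sub>v v = v"
      using rep_primitive_fixed_vector[OF B(1,2) _ hom G fin \<rho>(2,3)] B(4) assms(11) by simp
    then show ?thesis using C \<rho>(1) unfolding Irr_pr_def by blast
  qed
  then have "Irr_pr ?F \<phi> G = Irr G" by (auto simp: Irr_pr_def)
  moreover have "H1_prim Y X pv pa y\<^sub>0 = H1 Y"
    if *: "\<not> comm_group G \<longrightarrow> odd n \<and>
        (\<forall>H. subgroup H G \<and> H \<subseteq> center G \<and> cyclic_group (subgroup_generated G H) \<and>
           H \<noteq> {\<one>\<^bsub>G\<^esub>} \<longrightarrow> prime (card H))"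
  proof (rule H1_prim_eq_H1[OF assms(1,3,4) _ assms(6) G fin assms(9) B(1-3)])
    show "cover Y X pv pa" using assms(5) by (simp add: normal_cover_def)
    show "B \<noteq> {}" using B(4) assms(11) by auto
    assume nc: "\<not> comm_group G"
    have "\<exists>p::nat. prime p \<and> (\<forall>z \<in> center G. z [^]\<^bsub>G\<^esub> p = \<one>\<^bsub>G\<^esub>)"
      by (rule prime_exponent_center[OF G nc]) (use * nc in blast)
    then show "odd (card B) \<and> (\<exists>p::nat. prime p \<and> (\<forall>z \<in> center G. z [^]\<^bsub>G\<^esub> p = \<one>\<^bsub>G\<^esub>))"
      using * nc B(4) by blast
  qed
  ultimately show ?thesis by blast
qed

end
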